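(* Let $\boldsymbol U_h=(\tilde\sigma_h,\tilde\mu_h,\tilde\omega_h)^{\intercal}\in\mathcal P_1(\boldsymbol W_h)$ be the solution of the fully discrete problem $$\int_0^T\left(\langle\boldsymbol U_{h,t},\boldsymbol V_h\rangle+\langle\mathcal A_h\boldsymbol U_h,\boldsymbol V_h\rangle\right)dt=\int_0^T\langle\boldsymbol F,\boldsymbol V_h\rangle\,dt\qquad\forall\,\boldsymbol V_h\in\mathcal P_0(\boldsymbol W_h),$$ where $\boldsymbol F=(0,f,0)^{\intercal}$. Assume $f\in W^{1,1}((0,T),L^2\Lambda)$. Then $$\max_{0\le i\le N}\|\mathcal A_h\boldsymbol U_h^i\|\le\|\mathcal A_h\boldsymbol U_h^0\|+4\|\boldsymbol F\|_{L^\infty(L^2)}+2\int_0^T\|\boldsymbol F_t\|\,dt.$$ When $\boldsymbol F=0$, the inequality becomes an equality and there is energy conservation: $\|\mathcal A_h\boldsymbol U_h^i\|=\|\mathcal A_h\boldsymbol U_h^0\|$ for all $1\le i\le N$.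
   Context: Let $n\ge2$, let $\Omega\subset\mathbb R^n$ be a bounded domain homeomorphic to a ball with piecewise smooth Lipschitz boundary, $T>0$ finite, and fix $0\le k\le n$. $L^2\Lambda^j$ is the space of $L^2$ differential $j$-forms on $\Omega$ with inner product $\langle\cdot,\cdot\rangle$ and norm $\|\cdot\|$ (product inner products and norms for triples); $\|\boldsymbol F\|_{L^\infty(L^2)}=\operatorname{ess\,sup}_{0\le t\le T}\|\boldsymbol F(\cdot,t)\|$. $d$ is the exterior derivative, $H\Lambda^j=\{\omega\in L^2\Lambda^j:d\omega\in L^2\Lambda^{j+1}\}$, and $H_0\Lambda^j=\{\omega\in H\Lambda^j:\mathrm{tr}\,\omega=0\text{ on }\partial\Omega\}$. Superscripts $-$, none, $+$ refer to form degrees $k-1,k,k+1$; spaces of forms of degree $-1$ or $n+1$ are $\{0\}$. Subscript $t$ denotes the time derivative. Finite element spaces: $\mathcal T_h$ is a shape regular triangulation of $\Omega$. $\mathcal P_s\Lambda^j$ denotes polynomial $j$-forms with coefficients of degree $\le s$, $\mathcal H_s\Lambda^j$ those with homogeneous coefficients of degree $s$, and $\mathcal P_s^-\Lambda^j=\mathcal P_{s-1}\Lambda^j+\kappa\mathcal H_{s-1}\Lambda^{j+1}$, where $(\kappa\omega)_x(v_1,\dots,v_{j})=\omega_x(x,v_1,\dots,v_{j})$ for a $(j+1)$-form $\omega$. $V_h^j$ is the space of forms in $H_0\Lambda^j$ whose restriction to each simplex $K\in\mathcal T_h$ lies in $\mathcal P_s\Lambda^j(K)$ (degree $s$ decreasing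 by one as $j$ increases by one) or, alternatively, in $\mathcal P_s^-\Lambda^j(K)$ (same $s$ for all $j$), so that $V_h^-\to V_h\to V_h^+$ is a subcomplex of $H_0\Lambda^-\to H_0\Lambda\to H_0\Lambda^+$; $\boldsymbol W_h=V_h^-\times V_h\times V_h^+$. The discrete coderivative $\delta_h:V_h\to V_h^-$ is defined by $\langle\delta_h\omega_h,v_h\rangle=\langle\omega_h,d^-v_h\rangle$ for all $v_h\in V_h^-$; $\delta_h^+:V_h^+\to V_h$ is its analogue in degree $k+1$. On $\boldsymbol W_h$, $$\mathcal A_h=\begin{pmatrix}0&-\delta_h&0\\ d^-&0&\delta_h^+\\ 0&-d&0\end{pmatrix}.$$ Time discretization: $\Delta t=T/N$, $t_i=i\Delta t$ for $0\le i\le N$, and $v^i=v(t_i)$. $\mathcal P_1(\boldsymbol W_h)$ is the set of $\boldsymbol W_h$-valued functions on $[0,T]$ that are continuous and piecewise linear in $t$ with respect to the intervals $(t_{i-1},t_i)$; $\mathcal P_0(\boldsymbol W_h)$ is the set of $\boldsymbol W_h$-valued functions piecewise constant in $t$ on these intervals. The initial value $\boldsymbol U_h^0\in\boldsymbol W_h$ is given. *)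

theory Defs
  imports
    "HOL-Analysis.Analysis"
    "HOL-Probability.Essential_Supremum"
    "HOL-Library.Function_Algebras"
begin

section \<open>Pointwise vector space structure on functions\<close>

instantiation "fun" :: (type, real_vector) real_vector
begin

definition scaleR_fun :: "real \<Rightarrow> ('a \<Rightarrow> 'b) \<Rightarrow> 'a \<Rightarrow> 'b"
  where "scaleR_fun c f = (\<lambda>x. c *\<^sub>R f x)"

instance
  by standard (auto simp: scaleR_fun_def plus_fun_def scaleR_add_right scaleR_add_left)

end


section \<open>Smooth functions\<close>

definition dir_deriv :: "'a::real_normed_vector \<Rightarrow> ('a \<Rightarrow> real) \<Rightarrow> 'a \<Rightarrow> real"
  where "dir_deriv v f = (\<lambda>x. frechet_derivative f (at x) v)"

text \<open>Infinite differentiability: every iterated directional derivative is differentiable.\<close>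

definition smooth :: "('a::real_normed_vector \<Rightarrow> real) \<Rightarrow> bool"
  where "smooth f \<longleftrightarrow> (\<forall>vs. foldr dir_deriv vs f differentiable_on UNIV)"


section \<open>The domain and its triangulation\<close>

text \<open>Near each boundary point \<open>p\<close> the domain is, in the direction of some unit vector \<open>e\<close>, the
  strict epigraph of a Lipschitz function \<open>\<gamma>\<close> of the component orthogonal to \<open>e\<close>.
  Piecewise smoothness: \<open>\<gamma>\<close> is a continuous selection of finitely many smooth functions.\<close>

definition piecewise_smooth_lipschitz_boundary :: "(real^'n) set \<Rightarrow> bool"
  where "piecewise_smooth_lipschitz_boundary \<Omega> \<longleftrightarrow>
    (\<forall>p\<in>frontier \<Omega>. \<exists>r e L (\<gamma> :: real^'n \<Rightarrow> real) G.
        r > 0 \<and> norm e = 1 \<and> L-lipschitz_on UNIV \<gamma> \<and>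
        finite G \<and> (\<forall>g\<in>G. smooth g) \<and>
        (\<forall>x\<in>ball p r. \<exists>g\<in>G. \<gamma> (x - (x \<bullet> e) *\<^sub>R e) = g (x - (x \<bullet> e) *\<^sub>R e)) \<and>
        (\<forall>x\<in>ball p r. x \<in> \<Omega> \<longleftrightarrow> x \<bullet> e > \<gamma> (x - (x \<bullet> e) *\<^sub>R e)))"

text \<open>Each simplex contains a ball whose radius is at least its diameter divided by the shape
  regularity constant \<open>c\<close>.\<close>

definition shape_regular_triangulation :: "real \<Rightarrow> (real^'n) set set \<Rightarrow> (real^'n) set \<Rightarrow> bool"
  where "shape_regular_triangulation c \<T> \<Omega> \<longleftrightarrow>
    triangulation \<T> \<and> (\<forall>K\<in>\<T>. int CARD('n) simplex K) \<and> \<Union>\<T> = closure \<Omega> \<and>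
    (\<forall>K\<in>\<T>. \<exists>x \<rho>. \<rho> > 0 \<and> cball x \<rho> \<subseteq> K \<and> diameter K \<le> c * \<rho>)"


section \<open>Alternating forms and differential forms\<close>

text \<open>A \<open>j\<close>-linear form on \<open>\<real>\<^sup>n\<close> is encoded as a function on lists of vectors which vanishes on
  lists of length other than \<open>j\<close>. Degrees are integers; for \<open>j = -1\<close> and
  \<open>j = n + 1\<close> the only alternating form is \<open>0\<close>.\<close>

type_synonym 'n alt_form = "(real^'n) list \<Rightarrow> real"
type_synonym 'n form = "real^'n \<Rightarrow> 'n alt_form"

definition alternating :: "int \<Rightarrow> 'n::finite alt_form \<Rightarrow> bool"
  where "alternating j \<alpha> \<longleftrightarrow>
    (\<forall>vs. int (length vs) \<noteq> j \<longrightarrow> \<alpha> vs = 0) \<and>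
    (\<forall>us ws. int (length us + length ws) + 1 = j \<longrightarrow> linear (\<lambda>v. \<alpha> (us @ v # ws))) \<and>
    (\<forall>vs. \<not> distinct vs \<longrightarrow> \<alpha> vs = 0)"

text \<open>Every increasing index tuple occurs \<open>j!\<close> times, up to order, in the sum over all tuples, so
  \<open>dx\<^sub>I\<close> for increasing \<open>I\<close> is an orthonormal basis.\<close>

definition alt_inner :: "int \<Rightarrow> 'n::finite alt_form \<Rightarrow> 'n alt_form \<Rightarrow> real"
  where "alt_inner j \<alpha> \<beta> =
    (\<Sum>bs\<in>{bs. set bs \<subseteq> Basis \<and> int (length bs) = j}. \<alpha> bs * \<beta> bs) / fact (nat j)"

text \<open>Square integrable forms are represented by functions, and equality in \<open>L\<^sup>2\<close> is
  \<open>form_eq\<close> below; the values of a representative outside \<open>\<Omega>\<close> are irrelevant.\<close>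

definition L2_form :: "(real^'n) set \<Rightarrow> int \<Rightarrow> 'n::finite form set"
  where "L2_form \<Omega> j = {\<omega>. (\<forall>x\<in>\<Omega>. alternating j (\<omega> x)) \<and>
    (\<forall>vs. (\<lambda>x. \<omega> x vs) \<in> borel_measurable (lebesgue_on \<Omega>) \<and>
          integrable (lebesgue_on \<Omega>) (\<lambda>x. (\<omega> x vs)\<^sup>2))}"

definition form_eq :: "(real^'n) set \<Rightarrow> 'n::finite form \<Rightarrow> 'n form \<Rightarrow> bool"
  where "form_eq \<Omega> \<omega> \<eta> \<longleftrightarrow> (AE x in lebesgue_on \<Omega>. \<omega> x = \<eta> x)"

definition form_inner :: "(real^'n) set \<Rightarrow> int \<Rightarrow> 'n::finite form \<Rightarrow> 'n form \<Rightarrow> real"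
  where "form_inner \<Omega> j \<omega> \<eta> = (LINT x|lebesgue_on \<Omega>. alt_inner j (\<omega> x) (\<eta> x))"

definition form_norm :: "(real^'n) set \<Rightarrow> int \<Rightarrow> 'n::finite form \<Rightarrow> real"
  where "form_norm \<Omega> j \<omega> = sqrt (form_inner \<Omega> j \<omega> \<omega>)"


section \<open>Exterior derivative and traces\<close>

definition smooth_form :: "int \<Rightarrow> 'n::finite form set"
  where "smooth_form j = {\<phi>. (\<forall>x. alternating j (\<phi> x)) \<and> (\<forall>vs. smooth (\<lambda>x. \<phi> x vs))}"

definition test_form :: "(real^'n) set \<Rightarrow> int \<Rightarrow> 'n::finite form set"
  where "test_form \<Omega> j =
    {\<phi>\<in>smooth_form j. \<exists>K. compact K \<and> K \<subseteq> \<Omega> \<and> (\<forall>x. x \<notin> K \<longrightarrow> \<phi> x = 0)}"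

text \<open>The formal adjoint of the exterior derivative,
  \<open>(\<delta>\<phi>)\<^sub>x(v\<^sub>1,\<dots>,v\<^sub>j) = - \<Sum>\<^sub>b (\<partial>\<^sub>b\<phi>)\<^sub>x(b,v\<^sub>1,\<dots>,v\<^sub>j)\<close>.\<close>

definition codiff :: "'n::finite form \<Rightarrow> 'n form"
  where "codiff \<phi> = (\<lambda>x vs. - (\<Sum>b\<in>Basis. dir_deriv b (\<lambda>y. \<phi> y (b # vs)) x))"

definition weak_ext_deriv ::
    "(real^'n) set \<Rightarrow> int \<Rightarrow> 'n::finite form \<Rightarrow> 'n form \<Rightarrow> bool"
  where "weak_ext_deriv \<Omega> j \<omega> \<eta> \<longleftrightarrow> \<eta> \<in> L2_form \<Omega> (j + 1) \<and>
    (\<forall>\<phi>\<in>test_form \<Omega> (j + 1). form_inner \<Omega> (j + 1) \<eta> \<phi> = form_inner \<Omega> j \<omega> (codiff \<phi>))"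

definition H_form :: "(real^'n) set \<Rightarrow> int \<Rightarrow> 'n::finite form set"
  where "H_form \<Omega> j = {\<omega>\<in>L2_form \<Omega> j. \<exists>\<eta>. weak_ext_deriv \<Omega> j \<omega> \<eta>}"

text \<open>The exterior derivative on \<open>H_form\<close>; it is unique up to \<open>form_eq\<close>.\<close>

definition ext_deriv :: "(real^'n) set \<Rightarrow> int \<Rightarrow> 'n::finite form \<Rightarrow> 'n form"
  where "ext_deriv \<Omega> j \<omega> = (SOME \<eta>. weak_ext_deriv \<Omega> j \<omega> \<eta>)"

text \<open>A form that is merely in \<open>H_form\<close> has a trace only as a functional on \<open>\<partial>\<Omega>\<close>, given by
  Green's formula \<open>\<integral>\<^bsub>\<partial>\<Omega>\<^esub> tr \<omega> \<and> tr \<star>\<eta> = \<langle>d\<omega>, \<eta>\<rangle> - \<langle>\<omega>, \<delta>\<eta>\<rangle>\<close>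
  for forms \<open>\<eta>\<close> that are smooth up to the boundary.\<close>

definition form_trace :: "(real^'n) set \<Rightarrow> int \<Rightarrow> 'n::finite form \<Rightarrow> 'n form \<Rightarrow> real"
  where "form_trace \<Omega> j \<omega> \<eta> =
    form_inner \<Omega> (j + 1) (ext_deriv \<Omega> j \<omega>) \<eta> - form_inner \<Omega> j \<omega> (codiff \<eta>)"

definition H0_form :: "(real^'n) set \<Rightarrow> int \<Rightarrow> 'n::finite form set"
  where "H0_form \<Omega> j = {\<omega>\<in>H_form \<Omega> j. \<forall>\<eta>\<in>smooth_form (j + 1). form_trace \<Omega> j \<omega> \<eta> = 0}"


section \<open>Finite element spaces\<close>

definition monomial :: "('n::finite \<Rightarrow> nat) \<Rightarrow> real^'n \<Rightarrow> real"
  where "monomial a = (\<lambda>x. \<Prod>i\<in>UNIV. (x $ i) ^ a i)"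

text \<open>For a negative degree \<open>s\<close> both spaces are \<open>{0}\<close>.\<close>

definition poly_form :: "int \<Rightarrow> int \<Rightarrow> 'n::finite form set"
  where "poly_form s j = {p. (\<forall>x. alternating j (p x)) \<and>
    (\<forall>vs. (\<lambda>x. p x vs) \<in> span (monomial ` {a. int (sum a UNIV) \<le> s}))}"

definition homogeneous_form :: "int \<Rightarrow> int \<Rightarrow> 'n::finite form set"
  where "homogeneous_form s j = {p. (\<forall>x. alternating j (p x)) \<and>
    (\<forall>vs. (\<lambda>x. p x vs) \<in> span (monomial ` {a. int (sum a UNIV) = s}))}"

definition koszul :: "'n::finite form \<Rightarrow> 'n form"
  where "koszul \<omega> = (\<lambda>x vs. \<omega> x (x # vs))"

definition trimmed_form :: "int \<Rightarrow> int \<Rightarrow> 'n::finite form set"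
  where "trimmed_form s j =
    {p + koszul q | p q. p \<in> poly_form (s - 1) j \<and> q \<in> homogeneous_form (s - 1) (j + 1)}"

text \<open>\<open>s\<close> is the polynomial degree for forms of degree \<open>k\<close>: for the full family the polynomial
  degrees in form degrees \<open>k - 1\<close>, \<open>k\<close>, \<open>k + 1\<close> are \<open>s + 1\<close>, \<open>s\<close>, \<open>s - 1\<close>.\<close>

datatype family = Full | Trimmed

fun local_space :: "family \<Rightarrow> nat \<Rightarrow> nat \<Rightarrow> int \<Rightarrow> 'n::finite form set"
  where
    "local_space Full k s j = poly_form (int s - (j - int k)) j"
  | "local_space Trimmed k s j = trimmed_form (int s) j"

definition fe_space ::
    "(real^'n) set \<Rightarrow> (real^'n) set set \<Rightarrow> family \<Rightarrow> nat \<Rightarrow> nat \<Rightarrow> int \<Rightarrow> 'n::finite form set"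
  where "fe_space \<Omega> \<T> fam k s j =
    {\<omega>\<in>H0_form \<Omega> j. \<forall>K\<in>\<T>. \<exists>p\<in>local_space fam k s j. form_eq K \<omega> p}"

type_synonym 'n triple = "'n form \<times> 'n form \<times> 'n form"

definition fe_triple ::
    "(real^'n) set \<Rightarrow> (real^'n) set set \<Rightarrow> family \<Rightarrow> nat \<Rightarrow> nat \<Rightarrow> 'n::finite triple set"
  where "fe_triple \<Omega> \<T> fam k s =
    fe_space \<Omega> \<T> fam k s (int k - 1) \<times> fe_space \<Omega> \<T> fam k s (int k) \<times>
    fe_space \<Omega> \<T> fam k s (int k + 1)"

definition L2_triple :: "(real^'n) set \<Rightarrow> nat \<Rightarrow> 'n::finite triple set"
  where "L2_triple \<Omega> k =
    L2_form \<Omega> (int k - 1) \<times> L2_form \<Omega> (int k) \<times> L2_form \<Omega> (int k + 1)"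

fun triple_eq :: "(real^'n) set \<Rightarrow> 'n::finite triple \<Rightarrow> 'n triple \<Rightarrow> bool"
  where "triple_eq \<Omega> (\<sigma>, \<mu>, \<omega>) (\<sigma>', \<mu>', \<omega>') \<longleftrightarrow>
    form_eq \<Omega> \<sigma> \<sigma>' \<and> form_eq \<Omega> \<mu> \<mu>' \<and> form_eq \<Omega> \<omega> \<omega>'"

fun triple_inner :: "(real^'n) set \<Rightarrow> nat \<Rightarrow> 'n::finite triple \<Rightarrow> 'n triple \<Rightarrow> real"
  where "triple_inner \<Omega> k (\<sigma>, \<mu>, \<omega>) (\<sigma>', \<mu>', \<omega>') =
    form_inner \<Omega> (int k - 1) \<sigma> \<sigma>' + form_inner \<Omega> (int k) \<mu> \<mu>' + form_inner \<Omega> (int k + 1) \<omega> \<omega>'"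

definition triple_norm :: "(real^'n) set \<Rightarrow> nat \<Rightarrow> 'n::finite triple \<Rightarrow> real"
  where "triple_norm \<Omega> k X = sqrt (triple_inner \<Omega> k X X)"

text \<open>The discrete coderivative from form degree \<open>j\<close> to form degree \<open>j - 1\<close>.\<close>

definition discrete_coderiv ::
    "(real^'n) set \<Rightarrow> (real^'n) set set \<Rightarrow> family \<Rightarrow> nat \<Rightarrow> nat \<Rightarrow> int \<Rightarrow>
      'n::finite form \<Rightarrow> 'n form"
  where "discrete_coderiv \<Omega> \<T> fam k s j \<omega> =
    (SOME \<sigma>. \<sigma> \<in> fe_space \<Omega> \<T> fam k s (j - 1) \<and>
      (\<forall>v\<in>fe_space \<Omega> \<T> fam k s (j - 1).
         form_inner \<Omega> (j - 1) \<sigma> v = form_inner \<Omega> j \<omega> (ext_deriv \<Omega> (j - 1) v)))"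

fun A_h ::
    "(real^'n) set \<Rightarrow> (real^'n) set set \<Rightarrow> family \<Rightarrow> nat \<Rightarrow> nat \<Rightarrow>
      'n::finite triple \<Rightarrow> 'n triple"
  where "A_h \<Omega> \<T> fam k s (\<sigma>, \<mu>, \<omega>) =
    (- discrete_coderiv \<Omega> \<T> fam k s (int k) \<mu>,
     ext_deriv \<Omega> (int k - 1) \<sigma> + discrete_coderiv \<Omega> \<T> fam k s (int k + 1) \<omega>,
     - ext_deriv \<Omega> (int k) \<mu>)"


section \<open>Functions of time with values in finite element spaces\<close>

definition node :: "real \<Rightarrow> nat \<Rightarrow> nat \<Rightarrow> real"
  where "node T N i = real i * (T / real N)"

definition P1_time ::
    "real \<Rightarrow> nat \<Rightarrow> (real^'n) set \<Rightarrow> nat \<Rightarrow> 'n::finite triple set \<Rightarrow> (real \<Rightarrow> 'n triple) set"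
  where "P1_time T N \<Omega> k W = {U.
    (\<forall>t\<in>{0..T}. U t \<in> W) \<and>
    (\<forall>t\<in>{0..T}. ((\<lambda>r. triple_norm \<Omega> k (U r - U t)) \<longlongrightarrow> 0) (at t within {0..T})) \<and>
    (\<forall>i\<in>{1..N}. \<exists>X\<in>W. \<exists>Y\<in>W. \<forall>t\<in>{node T N (i - 1)<..<node T N i}.
       triple_eq \<Omega> (U t) (X + t *\<^sub>R Y))}"

definition P0_time ::
    "real \<Rightarrow> nat \<Rightarrow> (real^'n) set \<Rightarrow> 'n::finite triple set \<Rightarrow> (real \<Rightarrow> 'n triple) set"
  where "P0_time T N \<Omega> W = {V.
    (\<forall>t\<in>{0..T}. V t \<in> W) \<and>
    (\<forall>i\<in>{1..N}. \<exists>X\<in>W. \<forall>t\<in>{node T N (i - 1)<..<node T N i}. triple_eq \<Omega> (V t) X)}"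

text \<open>The time derivative as limit of difference quotients in \<open>L\<^sup>2\<close>; for functions in
  \<open>P1_time\<close> it exists (and is unique up to \<open>triple_eq\<close>) away from the nodes.\<close>

definition time_deriv ::
    "(real^'n) set \<Rightarrow> nat \<Rightarrow> (real \<Rightarrow> 'n::finite triple) \<Rightarrow> real \<Rightarrow> 'n triple"
  where "time_deriv \<Omega> k U t = (SOME D. D \<in> L2_triple \<Omega> k \<and>
    ((\<lambda>r. triple_norm \<Omega> k ((1 / (r - t)) *\<^sub>R (U r - U t) - D)) \<longlongrightarrow> 0) (at t))"


section \<open>Bochner spaces of form-valued functions of time\<close>

text \<open>The class-based Bochner integral needs a Banach space as a type, so its definition is
  spelled out for values in \<open>L2_form\<close>.\<close>

definition simple_L2 ::
    "real measure \<Rightarrow> (real^'n) set \<Rightarrow> int \<Rightarrow> (real \<Rightarrow> 'n::finite form) \<Rightarrow> bool"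
  where "simple_L2 M \<Omega> j u \<longleftrightarrow> simple_function M u \<and> (\<forall>t\<in>space M. u t \<in> L2_form \<Omega> j)"

definition strongly_measurable ::
    "real measure \<Rightarrow> (real^'n) set \<Rightarrow> int \<Rightarrow> (real \<Rightarrow> 'n::finite form) \<Rightarrow> bool"
  where "strongly_measurable M \<Omega> j f \<longleftrightarrow> (\<exists>u. (\<forall>m. simple_L2 M \<Omega> j (u m)) \<and>
    (AE t in M. (\<lambda>m. form_norm \<Omega> j (u m t - f t)) \<longlonglongrightarrow> 0))"

definition simple_L2_integral :: "real measure \<Rightarrow> (real \<Rightarrow> 'n::finite form) \<Rightarrow> 'n form"
  where "simple_L2_integral M u =
    (\<Sum>\<omega>\<in>u ` space M. measure M {t\<in>space M. u t = \<omega>} *\<^sub>R \<omega>)"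

text \<open>Only used for finite measures \<open>M\<close>, where all simple functions are integrable.\<close>

definition has_L2_integral ::
    "real measure \<Rightarrow> (real^'n) set \<Rightarrow> int \<Rightarrow> (real \<Rightarrow> 'n::finite form) \<Rightarrow> 'n form \<Rightarrow> bool"
  where "has_L2_integral M \<Omega> j f I \<longleftrightarrow> I \<in> L2_form \<Omega> j \<and> strongly_measurable M \<Omega> j f \<and>
    (\<exists>u. (\<forall>m. simple_L2 M \<Omega> j (u m)) \<and>
       (\<lambda>m. \<integral>\<^sup>+t. ennreal (form_norm \<Omega> j (f t - u m t)) \<partial>M) \<longlonglongrightarrow> 0 \<and>
       (\<lambda>m. form_norm \<Omega> j (simple_L2_integral M (u m) - I)) \<longlonglongrightarrow> 0)"

definition Bochner_L1 ::
    "real \<Rightarrow> (real^'n) set \<Rightarrow> int \<Rightarrow> (real \<Rightarrow> 'n::finite form) set"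
  where "Bochner_L1 T \<Omega> j = {f.
    (\<forall>t\<in>{0<..<T}. f t \<in> L2_form \<Omega> j) \<and>
    strongly_measurable (lebesgue_on {0<..<T}) \<Omega> j f \<and>
    integrable (lebesgue_on {0<..<T}) (\<lambda>t. form_norm \<Omega> j (f t))}"

definition has_weak_time_deriv ::
    "real \<Rightarrow> (real^'n) set \<Rightarrow> int \<Rightarrow> (real \<Rightarrow> 'n::finite form) \<Rightarrow> (real \<Rightarrow> 'n form) \<Rightarrow> bool"
  where "has_weak_time_deriv T \<Omega> j f g \<longleftrightarrow> g \<in> Bochner_L1 T \<Omega> j \<and>
    (\<forall>\<phi>::real \<Rightarrow> real. smooth \<phi> \<and> (\<exists>K. compact K \<and> K \<subseteq> {0<..<T} \<and> (\<forall>t. t \<notin> K \<longrightarrow> \<phi> t = 0)) \<longrightarrow>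
       (\<exists>I. has_L2_integral (lebesgue_on {0<..<T}) \<Omega> j (\<lambda>t. deriv \<phi> t *\<^sub>R f t) I \<and>
            has_L2_integral (lebesgue_on {0<..<T}) \<Omega> j (\<lambda>t. \<phi> t *\<^sub>R g t) (- I)))"

definition W11 :: "real \<Rightarrow> (real^'n) set \<Rightarrow> int \<Rightarrow> (real \<Rightarrow> 'n::finite form) set"
  where "W11 T \<Omega> j = {f\<in>Bochner_L1 T \<Omega> j. \<exists>g. has_weak_time_deriv T \<Omega> j f g}"

definition weak_time_deriv ::
    "real \<Rightarrow> (real^'n) set \<Rightarrow> int \<Rightarrow> (real \<Rightarrow> 'n::finite form) \<Rightarrow> real \<Rightarrow> 'n form"
  where "weak_time_deriv T \<Omega> j f = (SOME g. has_weak_time_deriv T \<Omega> j f g)"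

text \<open>The right-hand side \<open>(0, f, 0)\<close>; it is also applied to the time derivative of \<open>f\<close>.\<close>

definition load :: "(real \<Rightarrow> 'n::finite form) \<Rightarrow> real \<Rightarrow> 'n triple"
  where "load f = (\<lambda>t. (0, f t, 0))"

text \<open>The essential supremum is kept extended-real-valued, so that it needs no finiteness
  convention.\<close>

definition Linf_L2_norm ::
    "real \<Rightarrow> (real^'n) set \<Rightarrow> nat \<Rightarrow> (real \<Rightarrow> 'n::finite triple) \<Rightarrow> ereal"
  where "Linf_L2_norm T \<Omega> k F =
    esssup (lebesgue_on {0..T}) (\<lambda>t. ereal (triple_norm \<Omega> k (F t)))"

end

theory Submission
  imports Defs "HOL-Real_Asymp.Real_Asymp"
begin

text \<open>
  On \<open>W\<close> the operator \<open>A\<close> is skew-symmetric, and it maps \<open>W\<close> to itself because the finite element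
  spaces form a complex and the discrete coderivatives exist. Testing the scheme on the \<open>i\<close>-th time
  interval with the constant \<open>A (U\<^sup>i - U\<^sup>i\<^sup>-\<^sup>1)\<close> therefore removes the time derivative and leaves
  \<open>\<parallel>A U\<^sup>i\<parallel>\<^sup>2 - \<parallel>A U\<^sup>i\<^sup>-\<^sup>1\<parallel>\<^sup>2 = 2 \<langle>F\<^sup>i, A U\<^sup>i - A U\<^sup>i\<^sup>-\<^sup>1\<rangle>\<close>, where \<open>F\<^sup>i\<close> is the mean of \<open>F\<close> over the
  interval; for \<open>F = 0\<close> this is energy conservation. In general, sum up to the index \<open>m\<close> where
  \<open>\<parallel>A U\<^sup>m\<parallel>\<close> is maximal and sum by parts. The boundary terms are bounded by
  \<open>4 \<parallel>F\<parallel> \<parallel>A U\<^sup>m\<parallel>\<close>. The jumps \<open>F\<^sup>i\<^sup>+\<^sup>1 - F\<^sup>i\<close> are the integrals of \<open>F\<^sub>t\<close> against the hat function at the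
  \<open>i\<close>-th node, and the hat functions sum to at most one. Dividing by \<open>\<parallel>A U\<^sup>m\<parallel>\<close> gives the estimate.
  Since forms are represented by functions, all identities between values of \<open>A\<close> and of the exterior
  derivative hold only up to forms of norm zero.
\<close>

section \<open>Semi-inner products\<close>

text \<open>The operators \<open>ext_deriv\<close>, \<open>discrete_coderiv\<close>,
  \<open>time_deriv\<close> and \<open>weak_time_deriv\<close> are choices, and the pairings are
  only semidefinite. Cauchy-Schwarz makes a pairing blind to null vectors, so every choice is
  handled through its inner products; in particular \<open>A\<close> is never expanded on a sum or
  difference but moved to the other factor by skew-symmetry.

  Two steps of the energy argument carry the analytic weight. For \<open>A\<close> to map
  \<open>W\<close> into itself, the weak derivative of a piecewise polynomial form must be
  recognised on each simplex, which rests on the fundamental lemma and on integration by parts, and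
  the interiors of the simplices must fill \<Omega> up to a null set, which the Lipschitz boundary
  provides. For the jumps of the load, \<open>f\<close> has only a weak time derivative with Bochner
  integrals: pairing with a fixed form makes the problem scalar, and the hat function, which is not
  an admissible test function, is approached by smooth ones of compact support.

  The equality for vanishing load also requires the integral of \<open>F_t\<close> to vanish; this
  comes from strong measurability, which confines almost all values of the derivative to the closure
  of a countable set.\<close>

locale semi_inner =
  fixes L :: "'a::real_vector set" and B :: "'a \<Rightarrow> 'a \<Rightarrow> real"
  assumes L_subspace: "subspace L"
    and add_left: "\<lbrakk>x \<in> L; y \<in> L; z \<in> L\<rbrakk> \<Longrightarrow> B (x + y) z = B x z + B y z"
    and scale_left: "\<lbrakk>x \<in> L; z \<in> L\<rbrakk> \<Longrightarrow> B (c *\<^sub>R x) z = c * B x z"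
    and sym: "B x y = B y x"
    and nonneg: "x \<in> L \<Longrightarrow> 0 \<le> B x x"
begin

abbreviation N :: "'a \<Rightarrow> real" where "N x \<equiv> sqrt (B x x)"

lemma L_closed [intro, simp]:
  "0 \<in> L" "\<lbrakk>x \<in> L; y \<in> L\<rbrakk> \<Longrightarrow> x + y \<in> L" "\<lbrakk>x \<in> L; y \<in> L\<rbrakk> \<Longrightarrow> x - y \<in> L"
  "x \<in> L \<Longrightarrow> c *\<^sub>R x \<in> L" "x \<in> L \<Longrightarrow> - x \<in> L"
  using L_subspace
  by (auto simp: subspace_0 subspace_add subspace_diff subspace_scale subspace_neg)

lemma L_sum [intro]: "(\<And>i. i \<in> I \<Longrightarrow> f i \<in> L) \<Longrightarrow> sum f I \<in> L"
  using L_subspace by (rule subspace_sum)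

lemma zero_left [simp]: "z \<in> L \<Longrightarrow> B 0 z = 0"
  using scale_left[of 0 z 0] by simp

lemma minus_left: "\<lbrakk>x \<in> L; z \<in> L\<rbrakk> \<Longrightarrow> B (- x) z = - B x z"
  using scale_left[of x z "- 1"] by simp

lemma diff_left: "\<lbrakk>x \<in> L; y \<in> L; z \<in> L\<rbrakk> \<Longrightarrow> B (x - y) z = B x z - B y z"
  using add_left[of x "- y" z] minus_left[of y z] by simp

lemma sum_left:
  "\<lbrakk>\<And>i. i \<in> I \<Longrightarrow> f i \<in> L; z \<in> L\<rbrakk> \<Longrightarrow> B (sum f I) z = (\<Sum>i\<in>I. B (f i) z)"
  by (induction I rule: infinite_finite_induct) (auto simp: add_left L_sum)

lemma zero_right [simp]: "z \<in> L \<Longrightarrow> B z 0 = 0"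
  and add_right: "\<lbrakk>x \<in> L; y \<in> L; z \<in> L\<rbrakk> \<Longrightarrow> B z (x + y) = B z x + B z y"
  and scale_right: "\<lbrakk>x \<in> L; z \<in> L\<rbrakk> \<Longrightarrow> B z (c *\<^sub>R x) = c * B z x"
  and minus_right: "\<lbrakk>x \<in> L; z \<in> L\<rbrakk> \<Longrightarrow> B z (- x) = - B z x"
  and diff_right: "\<lbrakk>x \<in> L; y \<in> L; z \<in> L\<rbrakk> \<Longrightarrow> B z (x - y) = B z x - B z y"
  by (simp_all add: sym[of z] add_left scale_left minus_left diff_left)

lemmas bilin = add_left scale_left minus_left diff_left add_right scale_right minus_right diff_right

lemma square_left_diff:
  assumes "x \<in> L" "y \<in> L"
  shows "B (x - c *\<^sub>R y) (x - c *\<^sub>R y) = B x x - 2 * c * B x y + c\<^sup>2 * B y y"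
  using assms by (simp add: bilin sym[of y x] power2_eq_square algebra_simps)

lemma Cauchy_Schwarz:
  assumes "x \<in> L" "y \<in> L"
  shows "(B x y)\<^sup>2 \<le> B x x * B y y"
proof (cases "B y y = 0")
  case False
  with nonneg[OF assms(2)] have pos: "B y y > 0" by simp
  have "0 \<le> B x x - 2 * (B x y / B y y) * B x y + (B x y / B y y)\<^sup>2 * B y y"
    using nonneg[of "x - (B x y / B y y) *\<^sub>R y"] square_left_diff[OF assms] assms by simp
  also have "\<dots> = B x x - (B x y)\<^sup>2 / B y y"
    using pos by (simp add: power2_eq_square field_simps)
  finally show ?thesis using pos by (simp add: field_simps)
next
  case True
  have "B x y = 0"
  proof (rule ccontr)
    assume nz: "B x y \<noteq> 0"
    \<comment> \<open>For null \<open>y\<close> the quadratic in \<open>c\<close> degenerates to an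
      affine function; this \<open>c\<close> gives it the value -1.\<close>
    define c where "c = (B x x + 1) / (2 * B x y)"
    have "0 \<le> B x x - 2 * c * B x y"
      using nonneg[of "x - c *\<^sub>R y"] square_left_diff[OF assms, of c] assms True by simp
    then show False using nz by (simp add: c_def)
  qed
  then show ?thesis using True by simp
qed

lemma abs_le: "\<lbrakk>x \<in> L; y \<in> L\<rbrakk> \<Longrightarrow> \<bar>B x y\<bar> \<le> N x * N y"
  using Cauchy_Schwarz[of x y] by (metis real_sqrt_abs real_sqrt_le_iff real_sqrt_mult)

lemma N_nonneg [simp]: "x \<in> L \<Longrightarrow> 0 \<le> N x"
  using nonneg by simp

lemma N_power2: "x \<in> L \<Longrightarrow> (N x)\<^sup>2 = B x x"
  using nonneg by simp

lemma null_left: "\<lbrakk>x \<in> L; y \<in> L; B x x = 0\<rbrakk> \<Longrightarrow> B x y = 0"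
  and null_right: "\<lbrakk>x \<in> L; y \<in> L; B x x = 0\<rbrakk> \<Longrightarrow> B y x = 0"
  using Cauchy_Schwarz[of x y] by (simp_all add: sym)

text \<open>Together with \<open>cong_norm\<close> this stands in for the quotient by null vectors:
  representatives may be exchanged inside a pairing.\<close>

lemma cong_left: "\<lbrakk>x \<in> L; x' \<in> L; y \<in> L; B (x - x') (x - x') = 0\<rbrakk> \<Longrightarrow> B x y = B x' y"
  using null_left[of "x - x'" y] by (simp add: diff_left)

lemma cong_norm:
  assumes "x \<in> L" "x' \<in> L" "B (x - x') (x - x') = 0"
  shows "B x x = B x' x'"
  using cong_left[of x x' x] cong_left[of x x' x'] assms by (simp add: sym)

lemma N_scale: "x \<in> L \<Longrightarrow> N (c *\<^sub>R x) = \<bar>c\<bar> * N x"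
  by (simp add: bilin real_sqrt_mult flip: power2_eq_square mult.assoc)

lemma N_triangle:
  assumes "x \<in> L" "y \<in> L"
  shows "N (x + y) \<le> N x + N y"
proof (rule power2_le_imp_le)
  have "(N (x + y))\<^sup>2 = B x x + 2 * B x y + B y y"
    using assms N_power2[of "x + y"] by (simp add: bilin sym[of y x] del: real_sqrt_pow2_iff)
  also have "\<dots> \<le> B x x + 2 * (N x * N y) + B y y"
    using abs_le[OF assms] by simp
  also have "\<dots> = (N x + N y)\<^sup>2"
    using assms N_power2[of x] N_power2[of y] by (simp add: power2_sum)
  finally show "(N (x + y))\<^sup>2 \<le> (N x + N y)\<^sup>2" .
qed (use assms N_nonneg[of x] N_nonneg[of y] in linarith)

lemma N_minus: "x \<in> L \<Longrightarrow> N (- x) = N x"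
  by (simp add: bilin)

lemma N_diff_commute: "\<lbrakk>x \<in> L; y \<in> L\<rbrakk> \<Longrightarrow> N (x - y) = N (y - x)"
  using N_minus[of "x - y"] by simp

lemma N_triangle3:
  "\<lbrakk>x \<in> L; y \<in> L; z \<in> L\<rbrakk> \<Longrightarrow> N (x - z) \<le> N (x - y) + N (y - z)"
  using N_triangle[of "x - y" "y - z"] by simp

lemma null_add:
  assumes "x \<in> L" "y \<in> L" "B x x = 0" "B y y = 0"
  shows "B (x + y) (x + y) = 0"
  using assms null_left[of x y] null_left[of y x] by (simp add: bilin)

lemma null_scale: "\<lbrakk>x \<in> L; B x x = 0\<rbrakk> \<Longrightarrow> B (c *\<^sub>R x) (c *\<^sub>R x) = 0"
  by (simp add: bilin)

section \<open>Orthonormal sets and Riesz representation\<close>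

definition orthonormal :: "'a set \<Rightarrow> bool"
  where "orthonormal S \<longleftrightarrow> S \<subseteq> L \<and> (\<forall>x\<in>S. \<forall>y\<in>S. B x y = (if x = y then 1 else 0))"

lemma orthonormal_independent:
  assumes "orthonormal S"
  shows "independent S"
proof -
  have "u v = 0" if T: "finite T" "T \<subseteq> S" "(\<Sum>x\<in>T. u x *\<^sub>R x) = 0" "v \<in> T" for T u v
  proof -
    have S: "x \<in> L" if "x \<in> T" for x using that T assms by (auto simp: orthonormal_def)
    have "0 = B (\<Sum>x\<in>T. u x *\<^sub>R x) v" using T S by simp
    also have "\<dots> = (\<Sum>x\<in>T. u x * B x v)"
      using S T by (subst sum_left) (auto simp: scale_left)
    also have "\<dots> = (\<Sum>x\<in>T. if x = v then u x else 0)"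
      using T assms by (intro sum.cong) (auto simp: orthonormal_def subset_iff)
    also have "\<dots> = u v" using T by simp
    finally show ?thesis by simp
  qed
  then show ?thesis unfolding independent_explicit_module by blast
qed

text \<open>A maximal orthonormal subset of \<open>V\<close> exists because the orthogonality relations survive the
  replacement of its elements by equivalent elements of \<open>span E\<close>, where orthonormal sets are
  linearly independent.\<close>

lemma Riesz_finite:
  assumes V: "subspace V" "V \<subseteq> L" and E: "finite E" "E \<subseteq> L"
    and approx: "\<And>v. v \<in> V \<Longrightarrow> \<exists>e\<in>span E. B (v - e) (v - e) = 0"
    and add: "\<And>v w. \<lbrakk>v \<in> V; w \<in> V\<rbrakk> \<Longrightarrow> l (v + w) = l v + l w"
    and scale: "\<And>c v. v \<in> V \<Longrightarrow> l (c *\<^sub>R v) = c * (l v :: real)"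
    and null: "\<And>v. \<lbrakk>v \<in> V; B v v = 0\<rbrakk> \<Longrightarrow> l v = 0"
  shows "\<exists>u\<in>V. \<forall>v\<in>V. B u v = l v"
proof -
  have spanE: "span E \<subseteq> L" using E L_subspace by (simp add: span_minimal)
  have bound: "finite S \<and> card S \<le> card E" if S: "orthonormal S" "S \<subseteq> V" for S
  proof -
    from approx S obtain r where r: "\<And>v. v \<in> S \<Longrightarrow> r v \<in> span E \<and> B (v - r v) (v - r v) = 0"
      by (meson subsetD)
    have eq: "B (r v) (r w) = B v w" if "v \<in> S" "w \<in> S" for v w
    proof -
      have "v \<in> L" "w \<in> L" "r v \<in> L" "r w \<in> L" using that r spanE S V by auto
      then show ?thesis using r[OF that(1)] r[OF that(2)] cong_left[of v "r v"] cong_left[of w "r w"]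
        by (metis sym)
    qed
    have inj: "inj_on r S"
    proof
      fix v w assume vw: "v \<in> S" "w \<in> S" "r v = r w"
      then show "v = w" using eq[of v w] eq[of v v] S(1) by (auto simp: orthonormal_def split: if_splits)
    qed
    have "orthonormal (r ` S)"
      unfolding orthonormal_def using r spanE eq S inj
      by (auto simp: orthonormal_def inj_on_eq_iff)
    then have "independent (r ` S)" by (rule orthonormal_independent)
    moreover have "r ` S \<subseteq> span E" using r by auto
    ultimately have "finite (r ` S) \<and> card (r ` S) \<le> card E"
      using E(1) by (intro independent_span_bound)
    then show ?thesis using inj by (simp add: card_image finite_image_iff)
  qed
  define P where "P n \<longleftrightarrow> (\<exists>S. orthonormal S \<and> S \<subseteq> V \<and> card S = n)" for n
  \<comment> \<open>The empty set shows that the search is not vacuous and \<open>card E\<close>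
    bounds it, so a largest cardinality exists.\<close>
  have "P 0" unfolding P_def by (rule exI[of _ "{}"]) (auto simp: orthonormal_def)
  moreover have "\<forall>m. P m \<longrightarrow> m \<le> card E" unfolding P_def using bound by blast
  ultimately have "P (Greatest P)" "m \<le> Greatest P" if "P m" for m
    using that by (blast intro: GreatestI_nat Greatest_le_nat)+
  then obtain n where "P n" and max: "\<And>m. P m \<Longrightarrow> m \<le> n"
    using \<open>P 0\<close> by metis
  then obtain S where S: "orthonormal S" "S \<subseteq> V" "card S = n" unfolding P_def by auto
  have fin: "finite S" using bound S by blast
  have SL: "x \<in> L" "x \<in> V" if "x \<in> S" for x using that S V by auto
  have Bs: "B x y = (if x = y then 1 else 0)" if "x \<in> S" "y \<in> S" for x y
    using S(1) that by (auto simp: orthonormal_def)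
  \<comment> \<open>A residual of nonzero norm could be normalised to \<open>z\<close> and inserted
    into \<open>S\<close>, against the maximality of \<open>n\<close>.\<close>
  have expand: "B (v - (\<Sum>u\<in>S. B v u *\<^sub>R u)) (v - (\<Sum>u\<in>S. B v u *\<^sub>R u)) = 0" if v: "v \<in> V" for v
  proof (rule ccontr)
    let ?p = "\<Sum>u\<in>S. B v u *\<^sub>R u"
    let ?w = "v - ?p"
    assume nz: "B ?w ?w \<noteq> 0"
    have pV: "?p \<in> V" using SL V by (intro subspace_sum subspace_scale) auto
    have wV: "?w \<in> V" using pV v V by (simp add: subspace_diff)
    have wL: "?w \<in> L" "v \<in> L" "?p \<in> L" using wV v pV V by auto
    have orth: "B ?w u = 0" if u: "u \<in> S" for u
    proof -
      have "B ?p u = (\<Sum>x\<in>S. B v x * B x u)"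
        using SL u by (subst sum_left) (auto simp: scale_left)
      also have "\<dots> = (\<Sum>x\<in>S. if x = u then B v x else 0)"
        using Bs u by (intro sum.cong) auto
      also have "\<dots> = B v u" using fin u by simp
      finally show ?thesis using wL u SL by (simp add: diff_left)
    qed
    define z where "z = (1 / N ?w) *\<^sub>R ?w"
    have z: "z \<in> V" "z \<in> L" using wV wL V by (auto simp: z_def subspace_scale)
    have "B z z = (1 / N ?w)\<^sup>2 * B ?w ?w"
      unfolding z_def using wL(1)
      by (simp only: scale_left scale_right L_closed power2_eq_square mult.assoc)
    then have zz: "B z z = 1"
      using nz nonneg[OF wL(1)] by (simp add: power_divide)
    have zu: "B z u = 0" "B u z = 0" if "u \<in> S" for u
      using orth[OF that] wL SL[OF that] sym[of u z] by (simp_all only: z_def scale_left mult_zero_right)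
    have "z \<notin> S" using zu(1)[of z] zz by auto
    have "B x y = (if x = y then 1 else 0)" if "x \<in> insert z S" "y \<in> insert z S" for x y
      using that \<open>z \<notin> S\<close> zz zu[of x] zu[of y] Bs[of x y] by (cases "x = z"; cases "y = z"; simp)
    moreover have "insert z S \<subseteq> L" "insert z S \<subseteq> V" using z SL by auto
    ultimately have "P (card (insert z S))"
      unfolding P_def orthonormal_def by (intro exI[of _ "insert z S"]) simp
    then have "card (insert z S) \<le> n" by (rule max)
    then show False using fin S(3) \<open>z \<notin> S\<close> by simp
  qed
  \<comment> \<open>The usual representative with coefficients \<open>l x\<close>. It works for all
    of \<open>V\<close> because \<open>l\<close> vanishes on the null residuals in
    \<open>expand\<close>.\<close>
  define u where "u = (\<Sum>x\<in>S. l x *\<^sub>R x)"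
  have lsum: "l (sum f I) = (\<Sum>i\<in>I. l (f i))" if "finite I" "\<And>i. i \<in> I \<Longrightarrow> f i \<in> V" for f and I :: "'a set"
    using that
  proof (induction I rule: finite_induct)
    case empty
    show ?case using scale[of 0 0] subspace_0[OF V(1)] by simp
  next
    case (insert x F)
    have "sum f F \<in> V" using insert V by (intro subspace_sum) auto
    then show ?case using insert add[of "f x" "sum f F"] by simp
  qed
  have "u \<in> V" unfolding u_def using SL V by (intro subspace_sum subspace_scale) auto
  moreover have "B u v = l v" if v: "v \<in> V" for v
  proof -
    let ?p = "\<Sum>u\<in>S. B v u *\<^sub>R u"
    have pV: "?p \<in> V" using SL V by (intro subspace_sum subspace_scale) auto
    have "l v = l (?p + (v - ?p))" by simp
    also have "\<dots> = l ?p + l (v - ?p)" using pV v V by (intro add) (auto simp: subspace_diff)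
    also have "l (v - ?p) = 0" using expand[OF v] pV v V by (intro null) (auto simp: subspace_diff)
    also have "l ?p = (\<Sum>x\<in>S. B v x * l x)"
      using fin SL V by (subst lsum) (auto simp: subspace_scale scale)
    also have "(\<Sum>x\<in>S. B v x * l x) = B u v"
      unfolding u_def using SL v V by (subst sum_left) (auto simp: scale_left sym[of v] mult.commute)
    finally show ?thesis by simp
  qed
  ultimately show ?thesis by blast
qed

end

section \<open>Smooth functions\<close>

lemma smooth_differentiable: "smooth f \<Longrightarrow> f differentiable (at x)"
  unfolding smooth_def differentiable_on_def
  by (metis UNIV_I foldr_Nil id_apply)

lemma smooth_dir_deriv: "smooth f \<Longrightarrow> smooth (dir_deriv v f)"
  unfolding smooth_def
proof
  fix vs assume *: "\<forall>vs. foldr dir_deriv vs f differentiable_on UNIV"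
  show "foldr dir_deriv vs (dir_deriv v f) differentiable_on UNIV"
    using spec[OF *, of "vs @ [v]"] by simp
qed

text \<open>All iterated derivatives of \<open>f\<close> stay in \<open>S\<close>. A suitable
  invariant class thus certifies smoothness without formulas for higher derivatives.\<close>

lemma smooth_coinduct:
  assumes f: "f \<in> S"
    and diff: "\<And>g x. g \<in> S \<Longrightarrow> g differentiable (at x)"
    and step: "\<And>g v. g \<in> S \<Longrightarrow> dir_deriv v g \<in> S"
  shows "smooth f"
proof -
  have "foldr dir_deriv vs f \<in> S" for vs by (induction vs) (auto simp: f step)
  then show ?thesis using diff by (auto simp: smooth_def differentiable_on_def)
qed

lemma smooth_step:
  assumes "\<And>x. f differentiable (at x)" and "\<And>v. smooth (dir_deriv v f)"
  shows "smooth f"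
  by (rule smooth_coinduct[of f "insert f {g. smooth g}"])
    (auto simp: assms smooth_differentiable smooth_dir_deriv)

lemma dir_deriv_eqI: "(f has_derivative f') (at x) \<Longrightarrow> dir_deriv v f x = f' v"
  by (simp add: dir_deriv_def frechet_derivative_at[symmetric])

lemma has_derivative_dir_deriv:
  "f differentiable (at x) \<Longrightarrow> (f has_derivative (\<lambda>v. dir_deriv v f x)) (at x)"
  by (simp add: dir_deriv_def frechet_derivative_works)

lemma dir_deriv_const [simp]: "dir_deriv v (\<lambda>x. c) = (\<lambda>x. 0)"
  by (rule ext, rule dir_deriv_eqI[where f' = "\<lambda>_. 0"]) simp

lemma dir_deriv_add:
  "\<lbrakk>f differentiable (at x); g differentiable (at x)\<rbrakk> \<Longrightarrow>
    dir_deriv v (\<lambda>x. f x + g x) x = dir_deriv v f x + dir_deriv v g x"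
  by (rule dir_deriv_eqI[where f' = "\<lambda>v. dir_deriv v f x + dir_deriv v g x"])
    (auto intro!: derivative_intros has_derivative_dir_deriv)

lemma dir_deriv_mult:
  "\<lbrakk>f differentiable (at x); g differentiable (at x)\<rbrakk> \<Longrightarrow>
    dir_deriv v (\<lambda>x. f x * g x) x = f x * dir_deriv v g x + dir_deriv v f x * g x"
  by (rule dir_deriv_eqI[where f' = "\<lambda>v. f x * dir_deriv v g x + dir_deriv v f x * g x"])
    (auto intro!: derivative_intros has_derivative_dir_deriv)

lemma dir_deriv_cmult:
  "f differentiable (at x) \<Longrightarrow> dir_deriv v (\<lambda>x. c * f x) x = c * dir_deriv v f x"
  by (rule dir_deriv_eqI[where f' = "\<lambda>v. c * dir_deriv v f x"])
    (auto intro!: derivative_intros has_derivative_dir_deriv)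

lemma dir_deriv_minus:
  "f differentiable (at x) \<Longrightarrow> dir_deriv v (\<lambda>x. - f x) x = - dir_deriv v f x"
  by (rule dir_deriv_eqI[where f' = "\<lambda>v. - dir_deriv v f x"])
    (auto intro!: derivative_intros has_derivative_dir_deriv)

lemma dir_deriv_sum:
  "(\<And>i. i \<in> I \<Longrightarrow> f i differentiable (at x)) \<Longrightarrow>
    dir_deriv v (\<lambda>x. \<Sum>i\<in>I. f i x) x = (\<Sum>i\<in>I. dir_deriv v (f i) x)"
  by (rule dir_deriv_eqI[where f' = "\<lambda>v. \<Sum>i\<in>I. dir_deriv v (f i) x"])
    (auto intro!: derivative_intros has_derivative_dir_deriv)

lemma linear_dir_deriv: "f differentiable (at x) \<Longrightarrow> linear (\<lambda>v. dir_deriv v f x)"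
  using has_derivative_dir_deriv has_derivative_linear by blast

lemma dir_deriv_cong_open:
  assumes "open S" "x \<in> S" "\<And>y. y \<in> S \<Longrightarrow> f y = g y"
  shows "dir_deriv v f x = dir_deriv v g x"
proof -
  have "(f has_derivative D) (at x) \<longleftrightarrow> (g has_derivative D) (at x)" for D
    using assms by (metis has_derivative_transform_within_open)
  then show ?thesis by (simp add: dir_deriv_def frechet_derivative_def)
qed

lemma dir_deriv_zero_outside:
  assumes "closed K" "\<And>x. x \<notin> K \<Longrightarrow> f x = 0" "x \<notin> K"
  shows "dir_deriv v f x = 0"
  using dir_deriv_cong_open[of "- K" x f "\<lambda>_. 0" v] assms by auto

text \<open>The product rule turns the derivative of one product into a sum of two. Closing the
  smooth functions under both operations in advance gives an invariant class for
  \<open>smooth_coinduct\<close>.\<close>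

inductive_set smooth_alg :: "('a::real_normed_vector \<Rightarrow> real) set" where
  base: "smooth f \<Longrightarrow> f \<in> smooth_alg"
| const: "(\<lambda>x. c) \<in> smooth_alg"
| add: "\<lbrakk>f \<in> smooth_alg; g \<in> smooth_alg\<rbrakk> \<Longrightarrow> (\<lambda>x. f x + g x) \<in> smooth_alg"
| mult: "\<lbrakk>f \<in> smooth_alg; g \<in> smooth_alg\<rbrakk> \<Longrightarrow> (\<lambda>x. f x * g x) \<in> smooth_alg"

lemma smooth_alg_step:
  assumes "f \<in> smooth_alg"
  shows "(\<forall>x. f differentiable (at x)) \<and> dir_deriv v f \<in> smooth_alg"
  using assms
proof (induction rule: smooth_alg.induct)
  case (base f)
  then show ?case by (auto intro: smooth_alg.base smooth_dir_deriv smooth_differentiable)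
next
  case (const c)
  then show ?case by (auto intro: smooth_alg.const)
next
  case (add f g)
  have "dir_deriv v (\<lambda>x. f x + g x) = (\<lambda>x. dir_deriv v f x + dir_deriv v g x)"
    by (rule ext, rule dir_deriv_add) (use add in auto)
  then show ?case using add by (auto intro!: smooth_alg.add derivative_intros)
next
  case (mult f g)
  have "dir_deriv v (\<lambda>x. f x * g x) = (\<lambda>x. f x * dir_deriv v g x + dir_deriv v f x * g x)"
    by (rule ext, rule dir_deriv_mult) (use mult in auto)
  then show ?case using mult by (auto intro!: smooth_alg.add smooth_alg.mult derivative_intros)
qed

lemma smooth_alg_smooth: "f \<in> smooth_alg \<Longrightarrow> smooth f"
  by (rule smooth_coinduct[of f smooth_alg]) (auto simp: smooth_alg_step)

lemma smooth_const [simp, intro]: "smooth (\<lambda>x. c)"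
  and smooth_add [intro]: "\<lbrakk>smooth f; smooth g\<rbrakk> \<Longrightarrow> smooth (\<lambda>x. f x + g x)"
  and smooth_mult [intro]: "\<lbrakk>smooth f; smooth g\<rbrakk> \<Longrightarrow> smooth (\<lambda>x. f x * g x)"
  by (auto intro!: smooth_alg_smooth intro: smooth_alg.intros)

lemma smooth_minus [intro]: "smooth f \<Longrightarrow> smooth (\<lambda>x. - f x)"
  using smooth_mult[OF smooth_const[of "- 1"], of f] by simp

lemma smooth_diff [intro]: "\<lbrakk>smooth f; smooth g\<rbrakk> \<Longrightarrow> smooth (\<lambda>x. f x - g x)"
  using smooth_add[OF _ smooth_minus, of f g] by simp

lemma smooth_sum [intro]: "(\<And>i. i \<in> I \<Longrightarrow> smooth (f i)) \<Longrightarrow> smooth (\<lambda>x. \<Sum>i\<in>I. f i x)"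
  by (induction I rule: infinite_finite_induct) auto

lemma smooth_prod [intro]: "(\<And>i. i \<in> I \<Longrightarrow> smooth (f i)) \<Longrightarrow> smooth (\<lambda>x. \<Prod>i\<in>I. f i x)"
  by (induction I rule: infinite_finite_induct) auto

lemma smooth_power [intro]: "smooth f \<Longrightarrow> smooth (\<lambda>x. f x ^ m)"
  by (induction m) auto

lemma smooth_bounded_linear: "bounded_linear f \<Longrightarrow> smooth f"
proof (rule smooth_step)
  assume "bounded_linear f"
  then have d: "(f has_derivative f) (at x)" for x by (rule bounded_linear_imp_has_derivative)
  then show "f differentiable (at x)" for x by (auto simp: differentiable_def)
  have "dir_deriv v f = (\<lambda>x. f v)" for v using d by (auto intro!: dir_deriv_eqI)
  then show "smooth (dir_deriv v f)" for v by simp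
qed

lemma smooth_continuous: "smooth f \<Longrightarrow> continuous_on S f"
  by (meson continuous_at_imp_continuous_on differentiable_imp_continuous_within smooth_differentiable)

lemma smooth_compose_affine:
  fixes g :: "real \<Rightarrow> real" and l :: "'a::real_normed_vector \<Rightarrow> real"
  assumes g: "smooth g" and l: "bounded_linear l"
  shows "smooth (\<lambda>x. g (l x + d))"
\<comment> \<open>The scalar \<open>r\<close> absorbs the factors \<open>l v\<close> that the chain
  rule produces at each differentiation.\<close>
proof (rule smooth_coinduct[of _ "{\<lambda>x. r * g (l x + d) | r g. smooth g}"])
  show "(\<lambda>x. g (l x + d)) \<in> {\<lambda>x. r * g (l x + d) | r g. smooth g}"
    using g by (auto intro!: exI[of _ 1] exI[of _ g])
  have D: "((\<lambda>x. r * g (l x + d)) has_derivative (\<lambda>v. r * (l v * dir_deriv 1 g (l x + d)))) (at x)"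
    if g: "smooth g" for r g x
  proof -
    have lin: "linear (\<lambda>v. dir_deriv v g (l x + d))"
      using g by (intro linear_dir_deriv smooth_differentiable)
    have "((\<lambda>x. g (l x + d)) has_derivative (\<lambda>v. dir_deriv (l v) g (l x + d))) (at x)"
      using l g by (intro has_derivative_compose[of "\<lambda>x. l x + d" l x UNIV g, simplified]
          has_derivative_dir_deriv smooth_differentiable)
        (auto intro!: derivative_eq_intros bounded_linear_imp_has_derivative)
    moreover have "dir_deriv (l v) g (l x + d) = l v * dir_deriv 1 g (l x + d)" for v
      using linear_scale[OF lin, of "l v" 1] by simp
    ultimately show ?thesis by (auto intro!: derivative_eq_intros)
  qed
  fix k v x assume "k \<in> {\<lambda>x. r * g (l x + d) | r g. smooth g}"
  then obtain r g where k: "k = (\<lambda>x. r * g (l x + d))" "smooth g" by auto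
  show "k differentiable (at x)" using D[OF k(2)] k(1) by (auto simp: differentiable_def)
  have "dir_deriv v k = (\<lambda>x. (r * l v) * dir_deriv 1 g (l x + d))"
    unfolding k(1) by (rule ext, rule trans[OF dir_deriv_eqI[OF D[OF k(2)]]]) simp
  then show "dir_deriv v k \<in> {\<lambda>x. r * g (l x + d) | r g. smooth g}"
    using smooth_dir_deriv[OF k(2), of 1] by blast
qed

section \<open>Flat functions and bump functions\<close>

definition flat :: "real poly \<Rightarrow> real \<Rightarrow> real"
  where "flat p x = (if x > 0 then poly p (1 / x) * exp (- 1 / x) else 0)"

lemma poly_exp_tendsto_0: "((\<lambda>y. poly p y * exp (- y)) \<longlongrightarrow> (0::real)) at_top"
proof -
  have "((\<lambda>y. \<Sum>i\<le>degree p. coeff p i * (y ^ i / exp y)) \<longlongrightarrow> (\<Sum>i\<le>degree p. coeff p i * 0)) at_top"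
    by (intro tendsto_intros tendsto_power_div_exp_0)
  then show ?thesis
    by (simp add: poly_altdef exp_minus divide_inverse sum_distrib_right mult.assoc)
qed

lemma flat_tendsto_0: "(flat p \<longlongrightarrow> 0) (at_right 0)"
proof -
  have "((\<lambda>x. poly p (inverse x) * exp (- inverse x)) \<longlongrightarrow> 0) (at_right (0::real))"
    by (rule filterlim_compose[OF poly_exp_tendsto_0 filterlim_inverse_at_top_right])
  then show ?thesis
    by (rule Lim_transform_eventually)
      (auto simp: flat_def eventually_at_filter divide_inverse intro!: always_eventually)
qed

text \<open>Differentiating \<open>poly p (1 / x)\<close> and \<open>exp (- 1 / x)\<close> each
  brings out a factor \<open>1 / x^2\<close>, hence \<open>monom 1 2\<close>; the exponential beats
  every power of \<open>1 / x\<close>, so the formula persists at 0. Thus \<open>range flat\<close>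
  is closed under differentiation.\<close>

lemma flat_has_real_derivative:
  "(flat p has_real_derivative flat (monom 1 2 * (p - pderiv p)) x) (at x)"
proof -
  consider "x > 0" | "x < 0" | "x = 0" by linarith
  then show ?thesis
  proof cases
    case 1
    have "((\<lambda>x. poly p (1 / x) * exp (- 1 / x)) has_real_derivative
        poly (monom 1 2 * (p - pderiv p)) (1 / x) * exp (- 1 / x)) (at x)"
      using 1 by (auto intro!: derivative_eq_intros simp: poly_monom power2_eq_square field_simps)
    then show ?thesis
      using 1 by (auto simp: flat_def intro: has_field_derivative_transform_within_open[of _ _ _ "{0<..}"])
  next
    case 2
    have "((\<lambda>x. 0) has_real_derivative 0) (at x)" by simp
    then have "(flat p has_real_derivative 0) (at x)"
      by (rule has_field_derivative_transform_within_open[of _ _ _ "{..<0}"]) (use 2 in \<open>auto simp: flat_def\<close>)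
    then show ?thesis using 2 by (simp add: flat_def)
  next
    case 3
    have "((\<lambda>h. (flat p h - flat p 0) / (h - 0)) \<longlongrightarrow> 0) (at 0)"
    proof (rule filterlim_split_at)
      show "((\<lambda>h. (flat p h - flat p 0) / (h - 0)) \<longlongrightarrow> 0) (at_left 0)"
        by (rule Lim_transform_eventually[OF tendsto_const])
          (auto simp: flat_def eventually_at_filter intro!: always_eventually)
      \<comment> \<open>Dividing by \<open>h\<close> multiplies the polynomial by its variable, so
        the difference quotient from the right is again a flat function and tends to 0.\<close>
      have "eventually (\<lambda>h. flat (pCons 0 p) h = (flat p h - flat p 0) / (h - 0)) (at_right 0)"
        by (auto simp: flat_def eventually_at_filter intro!: always_eventually)
      then show "((\<lambda>h. (flat p h - flat p 0) / (h - 0)) \<longlongrightarrow> 0) (at_right 0)"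
        using flat_tendsto_0 by (rule Lim_transform_eventually[rotated])
    qed
    then show ?thesis using 3 by (simp add: has_field_derivative_iff flat_def)
  qed
qed

lemma smooth_flat: "smooth (flat p)"
proof (rule smooth_coinduct[of _ "range flat"])
  fix g v x assume "g \<in> range flat"
  then obtain p where g: "g = flat p" by auto
  have D: "(g has_derivative (\<lambda>v. flat (monom 1 2 * (p - pderiv p)) x * v)) (at x)" for x
    using flat_has_real_derivative[of p x] g by (simp add: has_field_derivative_def)
  then show "g differentiable (at x)" by (auto simp: differentiable_def)
  have "dir_deriv v g = flat (smult v (monom 1 2 * (p - pderiv p)))"
    by (rule ext, subst dir_deriv_eqI[OF D]) (auto simp: flat_def)
  then show "dir_deriv v g \<in> range flat" by auto
qed auto

text \<open>The shift by -1 keeps the support at distance \<open>1 / n\<close> from the faces of the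
  box, hence compact inside it. For growing \<open>n\<close> the argument of \<open>flat 1\<close>
  tends to infinity inside the box, where \<open>flat 1\<close> tends to 1, so the bumps converge to
  the indicator. For \<open>n = 0\<close> the bump is 0.\<close>

definition bump :: "nat \<Rightarrow> 'a::euclidean_space \<Rightarrow> 'a \<Rightarrow> 'a \<Rightarrow> real"
  where "bump n a b x = (\<Prod>i\<in>Basis. flat 1 (real n * ((x - a) \<bullet> i) - 1) * flat 1 (real n * ((b - x) \<bullet> i) - 1))"

lemma flat_1_bounds: "0 \<le> flat 1 x" "flat 1 x \<le> 1" "x \<le> 0 \<Longrightarrow> flat 1 x = 0"
  by (auto simp: flat_def)

lemma smooth_bump: "smooth (bump n a b)"
proof -
  have 1: "smooth (\<lambda>x::'a. flat 1 (real n * ((x - a) \<bullet> i) - 1))" for i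
    using smooth_compose_affine[OF smooth_flat[of 1], of "\<lambda>x. real n * (x \<bullet> i)" "- real n * (a \<bullet> i) - 1"]
    by (simp add: bounded_linear_const_mult bounded_linear_inner_left algebra_simps)
  have 2: "smooth (\<lambda>x::'a. flat 1 (real n * ((b - x) \<bullet> i) - 1))" for i
    using smooth_compose_affine[OF smooth_flat[of 1], of "\<lambda>x. (- real n) * (x \<bullet> i)" "real n * (b \<bullet> i) - 1"]
    by (simp add: bounded_linear_minus bounded_linear_const_mult bounded_linear_inner_left algebra_simps)
  show ?thesis unfolding bump_def by (intro smooth_prod smooth_mult 1 2)
qed

lemma bump_nonneg: "0 \<le> bump n a b x"
  unfolding bump_def by (intro prod_nonneg mult_nonneg_nonneg flat_1_bounds ballI)

lemma bump_le_1: "bump n a b x \<le> 1"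
  unfolding bump_def
  by (intro prod_le_1 conjI mult_nonneg_nonneg mult_le_one flat_1_bounds)

lemma bump_support:
  assumes "bump n a b x \<noteq> 0"
  shows "n > 0" "x \<in> cbox (a + (\<Sum>i\<in>Basis. (1 / real n) *\<^sub>R i)) (b - (\<Sum>i\<in>Basis. (1 / real n) *\<^sub>R i))"
    "cbox (a + (\<Sum>i\<in>Basis. (1 / real n) *\<^sub>R i)) (b - (\<Sum>i\<in>Basis. (1 / real n) *\<^sub>R i)) \<subseteq> box a b"
proof -
  have pos: "real n * ((x - a) \<bullet> i) > 1" "real n * ((b - x) \<bullet> i) > 1" if "i \<in> Basis" for i
  proof -
    have "flat 1 (real n * ((x - a) \<bullet> i) - 1) * flat 1 (real n * ((b - x) \<bullet> i) - 1) \<noteq> 0"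
      using assms that by (auto simp: bump_def)
    then show "real n * ((x - a) \<bullet> i) > 1" "real n * ((b - x) \<bullet> i) > 1"
      using flat_1_bounds(3)[of "real n * ((x - a) \<bullet> i) - 1"] flat_1_bounds(3)[of "real n * ((b - x) \<bullet> i) - 1"]
      by (force simp: not_le[symmetric])+
  qed
  then show n: "n > 0" using nonempty_Basis
    by (metis bot_nat_0.not_eq_extremum ex_in_conv less_numeral_extra(2) mult_zero_left not_less_iff_gr_or_eq of_nat_0)
  show "x \<in> cbox (a + (\<Sum>i\<in>Basis. (1 / real n) *\<^sub>R i)) (b - (\<Sum>i\<in>Basis. (1 / real n) *\<^sub>R i))"
    using pos n unfolding mem_box
    by (auto simp: inner_left_distrib inner_diff_left inner_sum_left_Basis inner_Basis field_simps less_imp_le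
      if_distrib sum.delta inner_sum_left cong: if_cong)
  show "cbox (a + (\<Sum>i\<in>Basis. (1 / real n) *\<^sub>R i)) (b - (\<Sum>i\<in>Basis. (1 / real n) *\<^sub>R i)) \<subseteq> box a b"
  proof
    fix y assume y: "y \<in> cbox (a + (\<Sum>i\<in>Basis. (1 / real n) *\<^sub>R i)) (b - (\<Sum>i\<in>Basis. (1 / real n) *\<^sub>R i))"
    have "0 < 1 / real n" using n by simp
    moreover have "a \<bullet> i + 1 / real n \<le> y \<bullet> i \<and> y \<bullet> i \<le> b \<bullet> i - 1 / real n" if "i \<in> Basis" for i
      using y that unfolding mem_box
      by (auto simp: inner_left_distrib inner_diff_left inner_sum_left_Basis inner_sum_left inner_Basis if_distrib sum.delta cong: if_cong)
    ultimately show "y \<in> box a b" unfolding mem_box by (smt (verit))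
  qed
qed

lemma bump_compact_support:
  assumes "box a b \<subseteq> S"
  shows "\<exists>K. compact K \<and> K \<subseteq> S \<and> (\<forall>x. x \<notin> K \<longrightarrow> bump n a b x = 0)"
proof (cases "\<exists>x. bump n a b x \<noteq> 0")
  case True
  then obtain x where x: "bump n a b x \<noteq> 0" by blast
  let ?K = "cbox (a + (\<Sum>i\<in>Basis. (1 / real n) *\<^sub>R i)) (b - (\<Sum>i\<in>Basis. (1 / real n) *\<^sub>R i))"
  have "compact ?K" by (rule compact_cbox)
  moreover have "?K \<subseteq> S" using bump_support(3)[OF x] assms by (rule order_trans)
  moreover have "\<forall>y. y \<notin> ?K \<longrightarrow> bump n a b y = 0" using bump_support(2)[of n a b] by blast
  ultimately show ?thesis by blast
qed (auto intro: exI[of _ "{}"])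

lemma bump_tendsto: "(\<lambda>n. bump n a b x) \<longlonglongrightarrow> indicator (box a b) x"
proof (cases "x \<in> box a b")
  case True
  have lim: "(\<lambda>n. flat 1 (real n * r - 1)) \<longlonglongrightarrow> 1" if r: "r > 0" for r
  proof -
    have top: "filterlim (\<lambda>n. real n * r - 1) at_top sequentially"
      using r by real_asymp
    have "((\<lambda>y. exp (- 1 / y)) \<longlongrightarrow> exp (0::real)) at_top" by real_asymp
    then have "(flat 1 \<longlongrightarrow> exp 0) at_top"
      by (rule Lim_transform_eventually) (use eventually_gt_at_top[of 0] in eventually_elim, simp add: flat_def)
    from filterlim_compose[OF this top] show ?thesis by simp
  qed
  have "(\<lambda>n. bump n a b x) \<longlonglongrightarrow> (\<Prod>i\<in>(Basis::'a set). 1 * 1)"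
    unfolding bump_def using True
    by (intro tendsto_prod tendsto_mult lim) (auto simp: mem_box inner_diff_left)
  then show ?thesis using True by simp
next
  case False
  then have "bump n a b x = 0" for n using bump_support by blast
  then show ?thesis using False by simp
qed

section \<open>Symmetry of second derivatives\<close>

lemma smooth_line_deriv:
  "smooth f \<Longrightarrow> ((\<lambda>s. f (x + s *\<^sub>R u)) has_real_derivative dir_deriv u f (x + s *\<^sub>R u)) (at s)"
proof -
  assume f: "smooth f"
  have "linear (\<lambda>v. dir_deriv v f (x + s *\<^sub>R u))"
    by (intro linear_dir_deriv smooth_differentiable f)
  from linear_scale[OF this] have *: "dir_deriv (h *\<^sub>R u) f (x + s *\<^sub>R u) = dir_deriv u f (x + s *\<^sub>R u) * h" for h
    by simp
  have "((\<lambda>s. x + s *\<^sub>R u) has_derivative (\<lambda>h. h *\<^sub>R u)) (at s)"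
    by (auto intro!: derivative_eq_intros)
  then have "((\<lambda>s. f (x + s *\<^sub>R u)) has_derivative (\<lambda>h. dir_deriv (h *\<^sub>R u) f (x + s *\<^sub>R u))) (at s)"
    using has_derivative_compose[of "\<lambda>s. x + s *\<^sub>R u" "\<lambda>h. h *\<^sub>R u" s UNIV f
        "\<lambda>v. dir_deriv v f (x + s *\<^sub>R u)"] has_derivative_dir_deriv[OF smooth_differentiable[OF f]]
    by simp
  then show ?thesis by (simp add: has_field_derivative_def *)
qed

text \<open>The mean value theorem is applied twice: along \<open>u\<close> to the increment of
  \<open>f\<close> in direction \<open>v\<close>, then along \<open>v\<close> to the derivative in
  direction \<open>u\<close>.\<close>

lemma second_difference:
  assumes f: "smooth f" and h: "h > 0"
  shows "\<exists>\<xi> \<eta>. 0 < \<xi> \<and> \<xi> < h \<and> 0 < \<eta> \<and> \<eta> < h \<and>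
    f (x + h *\<^sub>R u + h *\<^sub>R v) - f (x + h *\<^sub>R u) - f (x + h *\<^sub>R v) + f x =
      h\<^sup>2 * dir_deriv v (dir_deriv u f) (x + \<xi> *\<^sub>R u + \<eta> *\<^sub>R v)"
proof -
  let ?\<phi> = "\<lambda>s. f ((x + h *\<^sub>R v) + s *\<^sub>R u) - f (x + s *\<^sub>R u)"
  have "\<exists>\<xi>. 0 < \<xi> \<and> \<xi> < h \<and> ?\<phi> h - ?\<phi> 0 =
      (h - 0) * (dir_deriv u f ((x + h *\<^sub>R v) + \<xi> *\<^sub>R u) - dir_deriv u f (x + \<xi> *\<^sub>R u))"
    using h by (intro MVT2) (auto intro!: DERIV_diff smooth_line_deriv f)
  then obtain \<xi> where \<xi>: "0 < \<xi>" "\<xi> < h" and 1: "?\<phi> h - ?\<phi> 0 =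
      h * (dir_deriv u f ((x + h *\<^sub>R v) + \<xi> *\<^sub>R u) - dir_deriv u f (x + \<xi> *\<^sub>R u))" by auto
  have "\<exists>\<eta>. 0 < \<eta> \<and> \<eta> < h \<and> dir_deriv u f ((x + \<xi> *\<^sub>R u) + h *\<^sub>R v) - dir_deriv u f ((x + \<xi> *\<^sub>R u) + 0 *\<^sub>R v) =
      (h - 0) * dir_deriv v (dir_deriv u f) ((x + \<xi> *\<^sub>R u) + \<eta> *\<^sub>R v)"
    using h by (intro MVT2) (auto intro!: smooth_line_deriv smooth_dir_deriv f)
  then obtain \<eta> where \<eta>: "0 < \<eta>" "\<eta> < h" and 2: "dir_deriv u f ((x + \<xi> *\<^sub>R u) + h *\<^sub>R v) - dir_deriv u f (x + \<xi> *\<^sub>R u) =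
      h * dir_deriv v (dir_deriv u f) ((x + \<xi> *\<^sub>R u) + \<eta> *\<^sub>R v)" by auto
  have "f (x + h *\<^sub>R u + h *\<^sub>R v) - f (x + h *\<^sub>R u) - f (x + h *\<^sub>R v) + f x = ?\<phi> h - ?\<phi> 0"
    by (simp add: algebra_simps)
  also have "\<dots> = h * (dir_deriv u f ((x + \<xi> *\<^sub>R u) + h *\<^sub>R v) - dir_deriv u f (x + \<xi> *\<^sub>R u))"
    unfolding 1 by (simp add: algebra_simps)
  also have "\<dots> = h\<^sup>2 * dir_deriv v (dir_deriv u f) (x + \<xi> *\<^sub>R u + \<eta> *\<^sub>R v)"
    unfolding 2 by (simp add: power2_eq_square)
  finally show ?thesis using \<xi> \<eta> by blast
qed

text \<open>The second difference is symmetric in \<open>u\<close> and \<open>v\<close>, while its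
  quotient by \<open>h^2\<close> tends to either of the mixed derivatives, depending on the order in
  which the mean value theorem is applied.\<close>

lemma dir_deriv_commute:
  assumes f: "smooth f"
  shows "dir_deriv u (dir_deriv v f) x = dir_deriv v (dir_deriv u f) x"
proof -
  define h :: "nat \<Rightarrow> real" where "h n = 1 / real (Suc n)" for n
  have h: "h n > 0" "h \<longlonglongrightarrow> 0" for n
    unfolding h_def using LIMSEQ_inverse_real_of_nat by (auto simp: inverse_eq_divide)
  have lim: "(\<lambda>n. (f (x + h n *\<^sub>R u + h n *\<^sub>R v) - f (x + h n *\<^sub>R u) - f (x + h n *\<^sub>R v) + f x) / (h n)\<^sup>2)
      \<longlonglongrightarrow> dir_deriv v (dir_deriv u f) x" for u v
  proof -
    let ?P = "\<lambda>n \<xi> \<eta>. 0 < \<xi> \<and> \<xi> < h n \<and> 0 < \<eta> \<and> \<eta> < h n \<and>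
        f (x + h n *\<^sub>R u + h n *\<^sub>R v) - f (x + h n *\<^sub>R u) - f (x + h n *\<^sub>R v) + f x =
          (h n)\<^sup>2 * dir_deriv v (dir_deriv u f) (x + \<xi> *\<^sub>R u + \<eta> *\<^sub>R v)"
    have "\<forall>n. \<exists>\<xi> \<eta>. ?P n \<xi> \<eta>" using second_difference[OF f h(1)] by blast
    from choice[OF this] obtain \<xi> where "\<forall>n. \<exists>\<eta>. ?P n (\<xi> n) \<eta>" by blast
    from choice[OF this] obtain \<eta> where *: "\<And>n. ?P n (\<xi> n) (\<eta> n)" by blast
    have "\<xi> \<longlonglongrightarrow> 0" "\<eta> \<longlonglongrightarrow> 0"
      using * by (auto intro!: tendsto_sandwich[OF _ _ tendsto_const h(2)] always_eventually less_imp_le)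
    then have "(\<lambda>n. x + \<xi> n *\<^sub>R u + \<eta> n *\<^sub>R v) \<longlonglongrightarrow> x + 0 *\<^sub>R u + 0 *\<^sub>R v"
      by (intro tendsto_intros)
    then have "(\<lambda>n. dir_deriv v (dir_deriv u f) (x + \<xi> n *\<^sub>R u + \<eta> n *\<^sub>R v)) \<longlonglongrightarrow> dir_deriv v (dir_deriv u f) x"
      using smooth_continuous[of "dir_deriv v (dir_deriv u f)" UNIV] f
      by (intro isCont_tendsto_compose[of _ "dir_deriv v (dir_deriv u f)"])
        (auto simp: continuous_on_eq_continuous_at smooth_dir_deriv)
    moreover have "dir_deriv v (dir_deriv u f) (x + \<xi> n *\<^sub>R u + \<eta> n *\<^sub>R v) =
        (f (x + h n *\<^sub>R u + h n *\<^sub>R v) - f (x + h n *\<^sub>R u) - f (x + h n *\<^sub>R v) + f x) / (h n)\<^sup>2" for n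
      using *[of n] h(1)[of n] by simp
    ultimately show ?thesis by simp
  qed
  have "f (x + h n *\<^sub>R v + h n *\<^sub>R u) - f (x + h n *\<^sub>R v) - f (x + h n *\<^sub>R u) + f x =
      f (x + h n *\<^sub>R u + h n *\<^sub>R v) - f (x + h n *\<^sub>R u) - f (x + h n *\<^sub>R v) + f x" for n
    by (simp add: algebra_simps)
  from lim[of v u, unfolded this] lim[of u v] show ?thesis by (rule LIMSEQ_unique)
qed

section \<open>Integration by parts with compact support\<close>

lemma compact_support_integrable:
  fixes g :: "'a::euclidean_space \<Rightarrow> real"
  assumes "continuous_on UNIV g" "compact K" "\<And>x. x \<notin> K \<Longrightarrow> g x = 0"
  shows "integrable lborel g"
proof -
  have "integrable lborel (\<lambda>x. indicator K x *\<^sub>R g x)"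
    using assms by (intro borel_integrable_compact) (auto intro: continuous_on_subset)
  moreover have "(\<lambda>x. indicator K x *\<^sub>R g x) = g"
    using assms(3) by (intro ext) (auto simp: indicator_def)
  ultimately show ?thesis by simp
qed

lemma lborel_translate:
  fixes g :: "'a::euclidean_space \<Rightarrow> real"
  assumes "integrable lborel g"
  shows "integrable lborel (\<lambda>x. g (c + x))" "(\<integral>x. g (c + x) \<partial>lborel) = (\<integral>x. g x \<partial>lborel)"
proof -
  have m: "g \<in> borel_measurable borel" using assms by (simp add: borel_measurable_integrable)
  show "integrable lborel (\<lambda>x. g (c + x))"
    using assms m integrable_distr_eq[of "(+) c" lborel borel g] by (simp add: lborel_distr_plus)
  show "(\<integral>x. g (c + x) \<partial>lborel) = (\<integral>x. g x \<partial>lborel)"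
    using m integral_distr[of "(+) c" lborel borel g] by (simp add: lborel_distr_plus)
qed

text \<open>Translation invariance makes the integral of each difference quotient \<open>s n\<close>
  vanish, and dominated convergence passes to the derivative. This avoids iterated
  integrals.\<close>

lemma integral_dir_deriv_eq_0:
  fixes g :: "'a::euclidean_space \<Rightarrow> real"
  assumes g: "smooth g" and K: "compact K" "\<And>x. x \<notin> K \<Longrightarrow> g x = 0"
  shows "(\<integral>x. dir_deriv u g x \<partial>lborel) = 0"
proof -
  obtain R where R: "\<And>x. x \<in> K \<Longrightarrow> norm x \<le> R"
    using compact_imp_bounded[OF K(1)] by (auto simp: bounded_iff)
  have cont: "continuous_on S (dir_deriv u g)" for S using g by (intro smooth_continuous smooth_dir_deriv)
  have "bounded (dir_deriv u g ` K)"
    using K(1) cont by (intro compact_imp_bounded compact_continuous_image)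
  then obtain C0 where "\<And>x. x \<in> K \<Longrightarrow> \<bar>dir_deriv u g x\<bar> \<le> C0" by (auto simp: bounded_iff)
  moreover have "dir_deriv u g x = 0" if "x \<notin> K" for x
    using that K by (intro dir_deriv_zero_outside[of K]) (auto intro: compact_imp_closed)
  ultimately have C: "\<bar>dir_deriv u g x\<bar> \<le> max C0 0" for x by (cases "x \<in> K") (force simp: max_def)+
  define C where "C = max C0 0"
  define s where "s n x = real (Suc n) * (g ((1 / real (Suc n)) *\<^sub>R u + x) - g x)" for n x
  have gi: "integrable lborel g"
    using compact_support_integrable[OF smooth_continuous[OF g] K] .
  have s: "integrable lborel (s n)" "(\<integral>x. s n x \<partial>lborel) = 0" for n
    using lborel_translate[OF gi, of "(1 / real (Suc n)) *\<^sub>R u"] gi unfolding s_def by auto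
  \<comment> \<open>Inside the ball the mean value theorem turns the quotient into a derivative.
    Outside, both values of \<open>g\<close> are 0, since the step has length at most
    \<open>norm u\<close>.\<close>
  have bound: "norm (s n x) \<le> C * indicator (cball (0::'a) (R + norm u)) x" for n x
  proof (cases "x \<in> cball 0 (R + norm u)")
    case True
    define h where "h = 1 / real (Suc n)"
    have h: "h > 0" "real (Suc n) = 1 / h" unfolding h_def by auto
    have "\<exists>z. 0 < z \<and> z < h \<and> g (x + h *\<^sub>R u) - g (x + 0 *\<^sub>R u) = (h - 0) * dir_deriv u g (x + z *\<^sub>R u)"
      using h by (intro MVT2) (auto intro!: smooth_line_deriv g)
    then obtain z where "g (x + h *\<^sub>R u) - g x = h * dir_deriv u g (x + z *\<^sub>R u)" by auto
    then have "s n x = dir_deriv u g (x + z *\<^sub>R u)"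
      using h unfolding s_def h_def[symmetric] h(2) by (simp add: add.commute)
    then show ?thesis using True C unfolding C_def by simp
  next
    case False
    have "g x = 0" using False R[of x] norm_ge_zero[of u] by (intro K(2)) (auto simp: not_le intro: add_increasing2)
    moreover have "g ((1 / real (Suc n)) *\<^sub>R u + x) = 0"
    proof (intro K(2) notI)
      assume "(1 / real (Suc n)) *\<^sub>R u + x \<in> K"
      then have "norm ((1 / real (Suc n)) *\<^sub>R u + x) \<le> R" by (rule R)
      moreover have "norm x \<le> norm ((1 / real (Suc n)) *\<^sub>R u + x) + norm ((1 / real (Suc n)) *\<^sub>R u)"
        using norm_triangle_ineq4[of "(1 / real (Suc n)) *\<^sub>R u + x" "(1 / real (Suc n)) *\<^sub>R u"] by simp
      moreover have "norm ((1 / real (Suc n)) *\<^sub>R u) \<le> norm u"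
        by (simp add: divide_le_eq mult_le_cancel_left1)
      ultimately show False using False by simp
    qed
    ultimately show ?thesis unfolding s_def by (simp add: C_def)
  qed
  have lim: "(\<lambda>n. s n x) \<longlonglongrightarrow> dir_deriv u g x" for x
  proof -
    have "((\<lambda>h. (g (x + h *\<^sub>R u) - g x) / h) \<longlongrightarrow> dir_deriv u g x) (at 0)"
      using smooth_line_deriv[OF g, of x u 0] by (simp add: DERIV_def)
    moreover have "filterlim (\<lambda>n. 1 / real (Suc n)) (at 0) sequentially"
      using LIMSEQ_inverse_real_of_nat by (intro filterlim_atI) (auto simp: inverse_eq_divide)
    ultimately have "(\<lambda>n. (g (x + (1 / real (Suc n)) *\<^sub>R u) - g x) / (1 / real (Suc n))) \<longlonglongrightarrow> dir_deriv u g x"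
      by (rule filterlim_compose)
    then show ?thesis by (simp add: s_def add.commute mult.commute)
  qed
  have "(\<lambda>n. \<integral>x. s n x \<partial>lborel) \<longlonglongrightarrow> (\<integral>x. dir_deriv u g x \<partial>lborel)"
  proof (rule integral_dominated_convergence[where w = "\<lambda>x. C * indicator (cball (0::'a) (R + norm u)) x"])
    show "dir_deriv u g \<in> borel_measurable lborel"
      using cont by (simp add: borel_measurable_continuous_onI)
    show "integrable lborel (\<lambda>x. C * indicator (cball (0::'a) (R + norm u)) x)"
      using emeasure_bounded_finite[of "cball (0::'a) (R + norm u)"] by (intro integrable_mult_right integrable_real_indicator) (auto simp: top.not_eq_extremum)
  qed (use s bound lim in auto)
  then show ?thesis by (simp add: s(2) LIMSEQ_const_iff)
qed

lemma integral_by_parts_compact: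
  fixes f g :: "'a::euclidean_space \<Rightarrow> real"
  assumes f: "smooth f" and g: "smooth g" and K: "compact K" "\<And>x. x \<notin> K \<Longrightarrow> g x = 0"
  shows "(\<integral>x. dir_deriv u f x * g x \<partial>lborel) = - (\<integral>x. f x * dir_deriv u g x \<partial>lborel)"
proof -
  have dg: "dir_deriv u g x = 0" if "x \<notin> K" for x
    using that K by (intro dir_deriv_zero_outside[of K]) (auto intro: compact_imp_closed)
  have i1: "integrable lborel (\<lambda>x. dir_deriv u f x * g x)"
    using f g K by (intro compact_support_integrable[of _ K] smooth_continuous smooth_mult smooth_dir_deriv) auto
  have i2: "integrable lborel (\<lambda>x. f x * dir_deriv u g x)"
    using f g K dg by (intro compact_support_integrable[of _ K] smooth_continuous smooth_mult smooth_dir_deriv) auto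
  have "0 = (\<integral>x. dir_deriv u (\<lambda>x. f x * g x) x \<partial>lborel)"
    using f g K by (intro integral_dir_deriv_eq_0[symmetric, of _ K]) auto
  also have "\<dots> = (\<integral>x. f x * dir_deriv u g x + dir_deriv u f x * g x \<partial>lborel)"
    using f g by (simp add: dir_deriv_mult smooth_differentiable)
  also have "\<dots> = (\<integral>x. f x * dir_deriv u g x \<partial>lborel) + (\<integral>x. dir_deriv u f x * g x \<partial>lborel)"
    using i1 i2 by simp
  finally show ?thesis by simp
qed

section \<open>The fundamental lemma of the calculus of variations\<close>

lemma zero_integral_boxes_imp_AE_zero:
  fixes f :: "'a::euclidean_space \<Rightarrow> real"
  assumes f: "integrable lborel f"
    and box: "\<And>a b. (\<integral>x. indicator (box a b) x * f x \<partial>lborel) = 0"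
  shows "AE x in lborel. f x = 0"
proof -
  have int: "integrable lborel (\<lambda>x. indicator A x * f x)" if "A \<in> sets borel" for A
    using integrable_mult_indicator[of A lborel f] that f by simp
  \<comment> \<open>The sets over which \<open>f\<close> integrates to 0 are to form a Dynkin system
    containing the intersection-stable generator of boxes. Its complement step needs the integral
    over the whole space, which growing boxes exhaust.\<close>
  have tot: "(\<integral>x. f x \<partial>lborel) = 0"
  proof -
    let ?B = "\<lambda>n::nat. box (- (\<Sum>i\<in>Basis. real n *\<^sub>R i)) (\<Sum>i\<in>Basis. real n *\<^sub>R i) :: 'a set"
    have "(\<lambda>n. \<integral>x. indicator (?B n) x * f x \<partial>lborel) \<longlonglongrightarrow> (\<integral>x. f x \<partial>lborel)"
    proof (rule integral_dominated_convergence[where w = "\<lambda>x. norm (f x)"])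
      show "AE x in lborel. (\<lambda>n. indicator (?B n) x * f x) \<longlonglongrightarrow> f x"
      proof (rule AE_I2)
        fix x :: 'a
        have "eventually (\<lambda>n. x \<in> ?B n) sequentially"
        proof -
          obtain m :: nat where m: "norm x < real m" using reals_Archimedean2 by blast
          have "x \<in> ?B n" if "n \<ge> m" for n
            unfolding mem_box
          proof
            fix i :: 'a assume i: "i \<in> Basis"
            have "\<bar>x \<bullet> i\<bar> < real n" using Basis_le_norm[OF i, of x] m that by simp
            moreover have "(\<Sum>j\<in>Basis. real n *\<^sub>R j) \<bullet> i = real n"
              using i by (simp add: inner_sum_left inner_Basis if_distrib cong: if_cong)
            ultimately show "- (\<Sum>i\<in>Basis. real n *\<^sub>R i) \<bullet> i < x \<bullet> i \<and> x \<bullet> i < (\<Sum>i\<in>Basis. real n *\<^sub>R i) \<bullet> i"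
              unfolding inner_minus_left by linarith
          qed
          then show ?thesis by (auto simp: eventually_sequentially)
        qed
        then show "(\<lambda>n. indicator (?B n) x * f x) \<longlonglongrightarrow> f x"
          by (intro tendsto_eventually) (rule eventually_mono, assumption, simp)
      qed
    qed (use f int in \<open>auto simp: indicator_def abs_mult\<close>)
    then show ?thesis using box LIMSEQ_unique[OF _ tendsto_const] by simp
  qed
  have "(\<integral>x. indicator A x * f x \<partial>lborel) = 0" if "A \<in> sets borel" for A
  proof -
    have "Int_stable (range (\<lambda>(a, b). box a b :: 'a set))"
      by (auto simp: Int_stable_def box_Int_box)
    moreover have "range (\<lambda>(a, b). box a b :: 'a set) \<subseteq> Pow UNIV" by auto
    moreover have "A \<in> sigma_sets UNIV (range (\<lambda>(a, b). box a b :: 'a set))"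
      using that unfolding borel_eq_box by simp
    ultimately show ?thesis
    proof (induction rule: sigma_sets_induct_disjoint)
      case (basic A)
      then show ?case using box by auto
    next
      case empty
      show ?case by simp
    next
      case (compl A)
      then have A: "A \<in> sets borel" by (simp add: borel_eq_box)
      have "(\<integral>x. indicator (UNIV - A) x * f x \<partial>lborel) = (\<integral>x. f x - indicator A x * f x \<partial>lborel)"
        by (intro Bochner_Integration.integral_cong) (auto simp: indicator_def)
      then show ?case using f int[OF A] tot compl by simp
    next
      case (union F)
      then have F: "F i \<in> sets borel" for i by (auto simp: borel_eq_box subset_eq)
      have "(LINT x:(\<Union>i. F i)|lborel. f x) = (\<Sum>i. (LINT x:(F i)|lborel. f x))"
        using F union(1) int[of "\<Union>i. F i"]
        by (intro lebesgue_integral_countable_add)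
          (auto simp: disjoint_family_on_def set_integrable_def)
      then show ?case using union(3) by (simp add: set_lebesgue_integral_def)
    qed
  qed
  then have "AE x in lborel. f x = (\<lambda>_. 0) x"
    using f by (intro density_unique_real) (auto simp: set_lebesgue_integral_def)
  then show ?thesis by simp
qed

text \<open>Bumps are admissible only in boxes inside \<open>S\<close>, so the conclusion is local
  at first: the criterion for boxes is applied to the restriction of \<open>f\<close> to one such
  box, and countably many of them cover \<open>S\<close>. Since that criterion lives on Borel sets,
  \<open>f\<close> is first replaced by a Borel function \<open>g\<close> equal to it almost
  everywhere.\<close>

lemma bump_orthogonal_imp_AE_zero:
  fixes f :: "'a::euclidean_space \<Rightarrow> real"
  assumes S: "open S" and f: "integrable (lebesgue_on S) f"
    and orth: "\<And>n a b. box a b \<subseteq> S \<Longrightarrow> (\<integral>x. bump n a b x * f x \<partial>lebesgue_on S) = 0"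
  shows "AE x in lebesgue_on S. f x = 0"
proof -
  have Sl: "S \<in> sets lebesgue" using S by simp
  define F where "F = (\<lambda>x. indicator S x * f x)"
  have F: "integrable lebesgue F"
    using f integrable_restrict_space[of S lebesgue f] Sl by (simp add: F_def)
  then have "F \<in> borel_measurable lebesgue" by (rule borel_measurable_integrable)
  from completion_ex_borel_measurable_real[OF this]
  obtain g where g: "g \<in> borel_measurable lborel" "AE x in lborel. F x = g x" by blast
  have ae: "AE x in lebesgue. F x = g x" using g(2) by (rule AE_completion)
  have gl: "g \<in> borel_measurable lebesgue" using g(1) by (rule measurable_completion)
  have "integrable lebesgue g"
    using F gl ae integrable_cong_AE[of F lebesgue g] by (auto simp: borel_measurable_integrable)
  then have gi: "integrable lborel g" using g(1) by (simp add: integrable_completion)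
  have cont: "continuous_on UNIV (bump n a b)" for n and a b :: 'a
    using smooth_bump by (rule smooth_continuous)
  have bm: "bump n a b \<in> borel_measurable borel" for n and a b :: 'a
    using cont by (rule borel_measurable_continuous_onI)
  have bump: "(\<integral>x. bump n a b x * g x \<partial>lborel) = 0" if ab: "box a b \<subseteq> S" for n a b
  proof -
    have bl: "bump n a b \<in> borel_measurable lebesgue" using bm by (simp add: measurable_completion)
    have "(\<integral>x. bump n a b x * g x \<partial>lborel) = (\<integral>x. bump n a b x * g x \<partial>lebesgue)"
      using bm g(1) by (intro integral_completion[symmetric]) simp
    also have "\<dots> = (\<integral>x. bump n a b x * F x \<partial>lebesgue)"
      using bl gl F ae by (intro integral_cong_AE) (auto simp: borel_measurable_integrable)
    also have "\<dots> = (\<integral>x. bump n a b x * f x \<partial>lebesgue_on S)"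
      using Sl by (subst integral_restrict_space) (auto simp: F_def mult_ac)
    finally show ?thesis using orth[OF ab] by simp
  qed
  have zero: "(\<integral>x. indicator (box a b) x * g x \<partial>lborel) = 0" if ab: "box a b \<subseteq> S" for a b
  proof -
    have "(\<lambda>n. \<integral>x. bump n a b x * g x \<partial>lborel) \<longlonglongrightarrow> (\<integral>x. indicator (box a b) x * g x \<partial>lborel)"
    proof (rule integral_dominated_convergence[where w = "\<lambda>x. norm (g x)"])
      show "AE x in lborel. norm (bump n a b x * g x) \<le> norm (g x)" for n
        using bump_nonneg[of n a b] bump_le_1[of n a b] by (auto simp: abs_mult mult_left_le_one_le)
    qed (use gi g(1) bm in \<open>auto intro!: tendsto_mult bump_tendsto\<close>)
    then show ?thesis using bump[OF ab] LIMSEQ_unique[OF _ tendsto_const] by simp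
  qed
  have loc: "AE x in lborel. x \<in> box a b \<longrightarrow> g x = 0" if ab: "box a b \<subseteq> S" for a b
  proof -
    have "AE x in lborel. indicator (box a b) x * g x = 0"
    proof (rule zero_integral_boxes_imp_AE_zero)
      show "integrable lborel (\<lambda>x. indicator (box a b) x * g x)"
        using integrable_mult_indicator[of "box a b" lborel g] gi by simp
      fix c d
      obtain p q where pq: "box c d \<inter> box a b = box p q" by (rule that[OF box_Int_box])
      \<comment> \<open>Boxes are stable under intersection, so testing the localised function with
        a box is again a test with a box inside \<open>S\<close>.\<close>
      have *: "indicator (box c d) x * (indicator (box a b) x * g x) = indicator (box p q) x * g x" for x
        unfolding pq[symmetric] by (auto simp: indicator_def)
      have "box p q \<subseteq> S" using ab pq by auto
      then show "(\<integral>x. indicator (box c d) x * (indicator (box a b) x * g x) \<partial>lborel) = 0"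
        unfolding * by (rule zero)
    qed
    then show ?thesis by eventually_elim auto
  qed
  obtain D where D: "countable D" "\<And>X. X \<in> D \<Longrightarrow> X \<subseteq> S" "\<And>X. X \<in> D \<Longrightarrow> \<exists>a b. X = box a b" "\<Union>D = S"
    using open_countable_Union_open_box[OF S] by (metis Pow_iff subsetD)
  have "AE x in lborel. \<forall>X\<in>D. x \<in> X \<longrightarrow> g x = 0"
    using D(2,3) loc by (subst AE_ball_countable[OF D(1)]) metis
  moreover have "F x = f x" "\<exists>X\<in>D. x \<in> X" if "x \<in> S" for x
    using that D(4) by (auto simp: F_def)
  ultimately have "AE x in lborel. x \<in> S \<longrightarrow> f x = 0"
    using g(2) by (smt (verit, best) eventually_elim2)
  then have "AE x in lebesgue. x \<in> S \<longrightarrow> f x = 0" by (rule AE_completion)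
  then show ?thesis using Sl by (simp add: AE_restrict_space_iff)
qed

section \<open>Square integrable forms\<close>

definition blists :: "int \<Rightarrow> (real^'n::finite) list set"
  where "blists j = {bs. set bs \<subseteq> Basis \<and> int (length bs) = j}"

lemma finite_blists [simp]: "finite (blists j)"
proof -
  have "blists j \<subseteq> {bs. set bs \<subseteq> Basis \<and> length bs = nat j}" by (auto simp: blists_def)
  then show ?thesis by (rule finite_subset) (simp add: finite_lists_length_eq)
qed

lemma alt_inner_eq: "alt_inner j \<alpha> \<beta> = (\<Sum>bs\<in>blists j. \<alpha> bs * \<beta> bs) / fact (nat j)"
  by (simp add: alt_inner_def blists_def)

text \<open>The pairing reads coordinates only, so its algebra holds without alternation. The larger
  space also contains the piecewise functions \<open>cell_form\<close>, which live in a single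
  coordinate and are not alternating.\<close>

definition L2_coords :: "(real^'n) set \<Rightarrow> 'n::finite form set"
  where "L2_coords \<Omega> = {\<omega>. \<forall>vs. (\<lambda>x. \<omega> x vs) \<in> borel_measurable (lebesgue_on \<Omega>) \<and>
    integrable (lebesgue_on \<Omega>) (\<lambda>x. (\<omega> x vs)\<^sup>2)}"

lemma L2_form_eq: "L2_form \<Omega> j = L2_coords \<Omega> \<inter> {\<omega>. \<forall>x\<in>\<Omega>. alternating j (\<omega> x)}"
  by (auto simp: L2_form_def L2_coords_def)

lemma L2_form_coords: "\<omega> \<in> L2_form \<Omega> j \<Longrightarrow> \<omega> \<in> L2_coords \<Omega>"
  by (simp add: L2_form_eq)

lemmas fun_ops = plus_fun_def zero_fun_def scaleR_fun_def fun_Compl_def fun_diff_def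

lemma integrable_product:
  fixes f g :: "'a \<Rightarrow> real"
  assumes "f \<in> borel_measurable M" "g \<in> borel_measurable M"
    "integrable M (\<lambda>x. (f x)\<^sup>2)" "integrable M (\<lambda>x. (g x)\<^sup>2)"
  shows "integrable M (\<lambda>x. f x * g x)"
proof (rule Bochner_Integration.integrable_bound)
  show "integrable M (\<lambda>x. (f x)\<^sup>2 + (g x)\<^sup>2)" using assms by simp
  have "\<bar>u * v\<bar> \<le> u\<^sup>2 + v\<^sup>2" for u v :: real
    using zero_le_power2[of u] zero_le_power2[of v] zero_le_power2[of "u + v"] zero_le_power2[of "u - v"]
    unfolding power2_sum power2_diff abs_le_iff by linarith
  then show "AE x in M. norm (f x * g x) \<le> norm ((f x)\<^sup>2 + (g x)\<^sup>2)" by simp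
qed (use assms in simp)

lemma L2_coords_product:
  "\<lbrakk>\<omega> \<in> L2_coords \<Omega>; \<eta> \<in> L2_coords \<Omega>\<rbrakk> \<Longrightarrow> integrable (lebesgue_on \<Omega>) (\<lambda>x. \<omega> x vs * \<eta> x ws)"
  by (rule integrable_product) (auto simp: L2_coords_def)

lemma subspace_L2_coords: "subspace (L2_coords \<Omega>)"
proof (rule subspaceI)
  show "0 \<in> L2_coords \<Omega>" by (simp add: L2_coords_def fun_ops)
next
  fix \<omega> \<eta> :: "'a form" assume *: "\<omega> \<in> L2_coords \<Omega>" "\<eta> \<in> L2_coords \<Omega>"
  have "integrable (lebesgue_on \<Omega>) (\<lambda>x. (\<omega> x vs)\<^sup>2 + 2 * (\<omega> x vs * \<eta> x vs) + (\<eta> x vs)\<^sup>2)" for vs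
    using * L2_coords_product[OF *, of vs vs] by (auto simp: L2_coords_def)
  moreover have "(\<lambda>x. \<omega> x vs + \<eta> x vs) \<in> borel_measurable (lebesgue_on \<Omega>)" for vs
    using * by (intro borel_measurable_add) (auto simp: L2_coords_def)
  ultimately show "\<omega> + \<eta> \<in> L2_coords \<Omega>"
    by (auto simp: L2_coords_def fun_ops power2_sum algebra_simps)
next
  fix c and \<omega> :: "'a form" assume "\<omega> \<in> L2_coords \<Omega>"
  moreover have "(\<lambda>x. c * \<omega> x vs) \<in> borel_measurable (lebesgue_on \<Omega>)" for vs
    using \<open>\<omega> \<in> L2_coords \<Omega>\<close> by (intro borel_measurable_times) (auto simp: L2_coords_def)
  ultimately show "c *\<^sub>R \<omega> \<in> L2_coords \<Omega>" by (auto simp: L2_coords_def fun_ops power_mult_distrib)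
qed

lemma subspace_alternating: "subspace {\<alpha>. alternating j \<alpha>}"
proof (rule subspaceI)
  show "0 \<in> {\<alpha>. alternating j \<alpha>}" by (simp add: alternating_def fun_ops linear_iff)
next
  fix \<alpha> \<beta> :: "'a alt_form" assume "\<alpha> \<in> {\<alpha>. alternating j \<alpha>}" "\<beta> \<in> {\<alpha>. alternating j \<alpha>}"
  then show "\<alpha> + \<beta> \<in> {\<alpha>. alternating j \<alpha>}"
    by (auto simp: alternating_def fun_ops linear_compose_add)
next
  fix c and \<alpha> :: "'a alt_form" assume "\<alpha> \<in> {\<alpha>. alternating j \<alpha>}"
  moreover have "linear f \<Longrightarrow> linear (\<lambda>x. c * f x)" for f :: "real^'a \<Rightarrow> real"
    using linear_compose_scale_right[of f c] by simp
  ultimately show "c *\<^sub>R \<alpha> \<in> {\<alpha>. alternating j \<alpha>}"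
    by (auto simp: alternating_def fun_ops)
qed

lemma subspace_pointwise:
  assumes "subspace S"
  shows "subspace {f. \<forall>x\<in>X. f x \<in> S}"
  using assms by (auto simp: subspace_def fun_ops)

lemma subspace_L2_form: "subspace (L2_form \<Omega> j)"
  unfolding L2_form_eq
  using subspace_inter[OF subspace_L2_coords subspace_pointwise[OF subspace_alternating]] by simp

lemma integrable_alt_inner:
  "\<lbrakk>\<omega> \<in> L2_coords \<Omega>; \<eta> \<in> L2_coords \<Omega>\<rbrakk> \<Longrightarrow>
    integrable (lebesgue_on \<Omega>) (\<lambda>x. alt_inner j (\<omega> x) (\<eta> x))"
  unfolding alt_inner_eq by (intro Bochner_Integration.integrable_sum integrable_divide_zero L2_coords_product)

lemma alt_inner_add: "alt_inner j (\<alpha> + \<beta>) \<gamma> = alt_inner j \<alpha> \<gamma> + alt_inner j \<beta> \<gamma>"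
  by (simp add: alt_inner_eq fun_ops distrib_right sum.distrib add_divide_distrib)

lemma alt_inner_scale: "alt_inner j (c *\<^sub>R \<alpha>) \<gamma> = c * alt_inner j \<alpha> \<gamma>"
  by (simp add: alt_inner_eq fun_ops sum_distrib_left mult.assoc)

lemma alt_inner_sym: "alt_inner j \<alpha> \<beta> = alt_inner j \<beta> \<alpha>"
  by (simp add: alt_inner_eq mult.commute)

lemma alt_inner_nonneg: "0 \<le> alt_inner j \<alpha> \<alpha>"
  by (simp add: alt_inner_eq sum_nonneg)

lemma alt_inner_eq_0_iff: "alt_inner j \<alpha> \<alpha> = 0 \<longleftrightarrow> (\<forall>bs\<in>blists j. \<alpha> bs = 0)"
  by (simp add: alt_inner_eq sum_nonneg_eq_0_iff)

interpretation L2: semi_inner "L2_coords \<Omega>" "form_inner \<Omega> j" for \<Omega> :: "(real^'n) set" and j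
proof
  show "subspace (L2_coords \<Omega>)" by (rule subspace_L2_coords)
  fix \<omega> \<eta> \<zeta> :: "'n form" and c :: real
  show "form_inner \<Omega> j \<omega> \<eta> = form_inner \<Omega> j \<eta> \<omega>"
    by (simp add: form_inner_def alt_inner_sym)
  assume \<omega>: "\<omega> \<in> L2_coords \<Omega>"
  show "0 \<le> form_inner \<Omega> j \<omega> \<omega>"
    unfolding form_inner_def by (intro integral_nonneg_AE) (simp add: alt_inner_nonneg)
  assume \<zeta>: "\<zeta> \<in> L2_coords \<Omega>"
  show "form_inner \<Omega> j (c *\<^sub>R \<omega>) \<zeta> = c * form_inner \<Omega> j \<omega> \<zeta>"
    by (simp add: form_inner_def scaleR_fun_def[of c \<omega>] alt_inner_scale)
  assume "\<eta> \<in> L2_coords \<Omega>"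
  then show "form_inner \<Omega> j (\<omega> + \<eta>) \<zeta> = form_inner \<Omega> j \<omega> \<zeta> + form_inner \<Omega> j \<eta> \<zeta>"
    using \<omega> \<zeta> by (simp add: form_inner_def plus_fun_def[of \<omega> \<eta>] alt_inner_add integrable_alt_inner)
qed

lemma form_null_iff:
  assumes "\<omega> \<in> L2_coords \<Omega>"
  shows "form_inner \<Omega> j \<omega> \<omega> = 0 \<longleftrightarrow> (AE x in lebesgue_on \<Omega>. \<forall>bs\<in>blists j. \<omega> x bs = 0)"
  unfolding form_inner_def
  using integral_nonneg_eq_0_iff_AE[OF integrable_alt_inner[OF assms assms, of j]]
  by (simp add: alt_inner_nonneg alt_inner_eq_0_iff)

lemma form_eq_imp_null: "form_eq \<Omega> \<omega> \<eta> \<Longrightarrow> form_inner \<Omega> j (\<omega> - \<eta>) (\<omega> - \<eta>) = 0"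
  unfolding form_inner_def form_eq_def
  by (rule integral_eq_zero_AE) (auto elim!: eventually_mono simp: alt_inner_eq fun_ops)

text \<open>Multilinearity expands the slots one after the other; in the induction \<open>us\<close>
  holds the slots that already contain basis vectors and \<open>ws\<close> those still to be
  expanded.\<close>

lemma alternating_eqI:
  assumes \<alpha>: "alternating j \<alpha>" and 0: "\<And>bs. bs \<in> blists j \<Longrightarrow> \<alpha> bs = 0"
  shows "\<alpha> = 0"
proof
  fix vs
  have "\<alpha> (us @ ws) = 0" if "set us \<subseteq> Basis" "int (length us + length ws) = j" for us ws
    using that
  proof (induction ws arbitrary: us)
    case Nil
    then show ?case using 0[of us] by (simp add: blists_def)
  next
    case (Cons w ws)
    have lin: "linear (\<lambda>v. \<alpha> (us @ v # ws))"
      using \<alpha> Cons.prems by (auto simp: alternating_def)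
    have "\<alpha> (us @ w # ws) = \<alpha> (us @ (\<Sum>b\<in>Basis. (w \<bullet> b) *\<^sub>R b) # ws)" by (simp add: euclidean_representation)
    also have "\<dots> = (\<Sum>b\<in>Basis. (w \<bullet> b) * \<alpha> ((us @ [b]) @ ws))"
      using linear_sum[OF lin, of "\<lambda>b. (w \<bullet> b) *\<^sub>R b" Basis] linear_scale[OF lin] by simp
    also have "\<dots> = 0" using Cons by (intro sum.neutral ballI) (subst Cons.IH, auto)
    finally show ?case .
  qed
  from this[of "[]" vs] show "\<alpha> vs = 0 vs"
    using \<alpha> by (cases "int (length vs) = j") (auto simp: alternating_def fun_ops)
qed

abbreviation L2_coords3 :: "(real^'n) set \<Rightarrow> 'n::finite triple set"
  where "L2_coords3 \<Omega> \<equiv> L2_coords \<Omega> \<times> L2_coords \<Omega> \<times> L2_coords \<Omega>"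

interpretation L2t: semi_inner "L2_coords3 \<Omega>" "triple_inner \<Omega> k" for \<Omega> :: "(real^'n) set" and k
proof
  show "subspace (L2_coords3 \<Omega>)" by (intro subspace_Times subspace_L2_coords)
  fix x y z :: "'n triple" and c :: real
  obtain x1 x2 x3 y1 y2 y3 z1 z2 z3 where xyz: "x = (x1, x2, x3)" "y = (y1, y2, y3)" "z = (z1, z2, z3)"
    by (metis prod_cases3)
  show "triple_inner \<Omega> k x y = triple_inner \<Omega> k y x"
    by (simp add: xyz L2.sym[of _ _ y1] L2.sym[of _ _ y2] L2.sym[of _ _ y3])
  assume x: "x \<in> L2_coords3 \<Omega>"
  then show "0 \<le> triple_inner \<Omega> k x x" by (simp add: xyz L2.nonneg)
  assume z: "z \<in> L2_coords3 \<Omega>"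
  show "triple_inner \<Omega> k (c *\<^sub>R x) z = c * triple_inner \<Omega> k x z"
    using x z by (simp add: xyz L2.scale_left algebra_simps)
  assume "y \<in> L2_coords3 \<Omega>"
  then show "triple_inner \<Omega> k (x + y) z = triple_inner \<Omega> k x z + triple_inner \<Omega> k y z"
    using x z by (simp add: xyz L2.add_left)
qed

lemma triple_eq_imp_null:
  "triple_eq \<Omega> x y \<Longrightarrow> triple_inner \<Omega> k (x - y) (x - y) = 0"
  by (cases x; cases y) (simp add: form_eq_imp_null)

section \<open>Weak exterior derivatives\<close>

lemma bounded_open_finite_measure:
  "\<lbrakk>bounded S; open S\<rbrakk> \<Longrightarrow> finite_measure (lebesgue_on (S :: 'a::euclidean_space set))"
  by (intro finite_measure_lebesgue_on bounded_set_imp_lmeasurable) auto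

lemma continuous_L2_coords:
  fixes \<phi> :: "'n::finite form"
  assumes \<Omega>: "bounded \<Omega>" "open \<Omega>" and \<phi>: "\<And>vs. continuous_on UNIV (\<lambda>x. \<phi> x vs)"
  shows "\<phi> \<in> L2_coords \<Omega>"
  unfolding L2_coords_def
proof (intro CollectI allI conjI)
  fix vs
  have "\<Omega> \<in> sets lebesgue" using \<Omega> by simp
  then show m: "(\<lambda>x. \<phi> x vs) \<in> borel_measurable (lebesgue_on \<Omega>)"
    using \<phi> by (intro continuous_imp_measurable_on_sets_lebesgue) (auto intro: continuous_on_subset)
  have "compact ((\<lambda>x. \<phi> x vs) ` closure \<Omega>)"
    using \<Omega> \<phi> by (intro compact_continuous_image) (auto intro: continuous_on_subset)
  then obtain C where C: "\<forall>x\<in>closure \<Omega>. \<bar>\<phi> x vs\<bar> \<le> C"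
    by (auto dest!: compact_imp_bounded simp: bounded_iff)
  interpret finite_measure "lebesgue_on \<Omega>" using \<Omega> by (rule bounded_open_finite_measure)
  have "(\<phi> x vs)\<^sup>2 \<le> C\<^sup>2" if "x \<in> \<Omega>" for x
    using bspec[OF C, of x] that closure_subset by (metis abs_le_square_iff abs_of_nonneg abs_ge_zero order_trans subsetD)
  then show "integrable (lebesgue_on \<Omega>) (\<lambda>x. (\<phi> x vs)\<^sup>2)"
    using m by (intro integrable_const_bound[where B = "C\<^sup>2"]) auto
qed

lemma smooth_L2_coords:
  "\<lbrakk>bounded \<Omega>; open \<Omega>; \<And>vs. smooth (\<lambda>x. \<phi> x vs)\<rbrakk> \<Longrightarrow> \<phi> \<in> L2_coords \<Omega>"
  by (intro continuous_L2_coords smooth_continuous)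

lemma smooth_form_L2_coords: "\<lbrakk>bounded \<Omega>; open \<Omega>; \<phi> \<in> smooth_form j\<rbrakk> \<Longrightarrow> \<phi> \<in> L2_coords \<Omega>"
  by (intro smooth_L2_coords) (auto simp: smooth_form_def)

lemma smooth_codiff: "(\<And>vs. smooth (\<lambda>x. \<phi> x vs)) \<Longrightarrow> smooth (\<lambda>x. codiff \<phi> x vs)"
  unfolding codiff_def by (intro smooth_minus smooth_sum) (simp add: smooth_dir_deriv)

lemma codiff_L2_coords: "\<lbrakk>bounded \<Omega>; open \<Omega>; \<phi> \<in> smooth_form j\<rbrakk> \<Longrightarrow> codiff \<phi> \<in> L2_coords \<Omega>"
  by (intro smooth_L2_coords smooth_codiff) (auto simp: smooth_form_def)

lemma test_form_smooth: "\<phi> \<in> test_form \<Omega> j \<Longrightarrow> \<phi> \<in> smooth_form j"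
  by (simp add: test_form_def)

lemma bump_test_form:
  assumes "alternating j \<alpha>" "box a b \<subseteq> \<Omega>"
  shows "(\<lambda>x vs. bump n a b x * \<alpha> vs) \<in> test_form \<Omega> j"
proof -
  have "alternating j (\<lambda>vs. bump n a b x * \<alpha> vs)" for x
    using subspace_scale[OF subspace_alternating, of \<alpha> j "bump n a b x"] assms(1)
    by (simp add: scaleR_fun_def)
  then have 1: "(\<lambda>x vs. bump n a b x * \<alpha> vs) \<in> smooth_form j"
    unfolding smooth_form_def by (auto intro!: smooth_mult smooth_bump)
  obtain K where "compact K" "K \<subseteq> \<Omega>" "\<And>x. x \<notin> K \<Longrightarrow> bump n a b x = 0"
    using bump_compact_support[OF assms(2)] by metis
  then show ?thesis using 1 unfolding test_form_def by (auto simp: zero_fun_def intro!: exI[of _ K])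
qed

text \<open>The test forms \<open>bump n a b x * \<alpha>\<close> show that \<open>\<eta> x\<close> is orthogonal to \<open>\<alpha>\<close> for almost every \<open>x\<close>.
  It suffices to let \<open>\<alpha>\<close> run through finitely many values of \<open>\<eta>\<close> whose restrictions to basis tuples
  span those of all values, so no explicit basis of the alternating forms is needed.\<close>

lemma test_forms_dense:
  fixes \<eta> :: "'n::finite form"
  assumes \<Omega>: "bounded \<Omega>" "open \<Omega>" and \<eta>: "\<eta> \<in> L2_form \<Omega> j"
    and orth: "\<And>\<phi>. \<phi> \<in> test_form \<Omega> j \<Longrightarrow> form_inner \<Omega> j \<eta> \<phi> = 0"
  shows "AE x in lebesgue_on \<Omega>. \<eta> x = 0"
proof -
  have \<eta>L: "\<eta> \<in> L2_coords \<Omega>" using \<eta> by (rule L2_form_coords)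
  have alt: "alternating j (\<eta> x)" if "x \<in> \<Omega>" for x using \<eta> that by (simp add: L2_form_eq)
  have orth_const: "AE x in lebesgue_on \<Omega>. alt_inner j (\<eta> x) \<alpha> = 0" if \<alpha>: "alternating j \<alpha>" for \<alpha>
  proof (rule bump_orthogonal_imp_AE_zero[OF \<Omega>(2)])
    have "(\<lambda>x. \<alpha>) \<in> L2_coords \<Omega>" using \<Omega> by (intro continuous_L2_coords) auto
    then show "integrable (lebesgue_on \<Omega>) (\<lambda>x. alt_inner j (\<eta> x) \<alpha>)"
      using integrable_alt_inner[OF \<eta>L] by auto
    fix n a b assume "box a b \<subseteq> \<Omega>"
    from orth[OF bump_test_form[OF \<alpha> this, of n]]
    show "(\<integral>x. bump n a b x * alt_inner j (\<eta> x) \<alpha> \<partial>lebesgue_on \<Omega>) = 0"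
      by (simp add: form_inner_def alt_inner_eq sum_distrib_left mult_ac)
  qed
  \<comment> \<open>Truncation to basis tuples changes no inner product but lands in a
    finite-dimensional space of functions. The truncated values need not be alternating.\<close>
  define R :: "'n alt_form \<Rightarrow> 'n alt_form" where "R \<alpha> = (\<lambda>vs. if vs \<in> blists j then \<alpha> vs else 0)" for \<alpha>
  have R: "alt_inner j \<alpha> (R \<beta>) = alt_inner j \<alpha> \<beta>" for \<alpha> \<beta>
    by (simp add: alt_inner_eq R_def)
  define e :: "(real^'n) list \<Rightarrow> 'n alt_form" where "e bs = (\<lambda>vs. if vs = bs then 1 else 0)" for bs
  have "R \<alpha> = (\<Sum>bs\<in>blists j. \<alpha> bs *\<^sub>R e bs)" for \<alpha>
  proof
    fix vs
    have "(\<Sum>bs\<in>B. \<alpha> bs *\<^sub>R e bs) vs = (\<Sum>bs\<in>B. if vs = bs then \<alpha> bs else 0)" if "finite B" for B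
      using that by induction (auto simp: fun_ops e_def)
    then show "R \<alpha> vs = (\<Sum>bs\<in>blists j. \<alpha> bs *\<^sub>R e bs) vs" by (simp add: R_def)
  qed
  then have Rspan: "R \<alpha> \<in> span (e ` blists j)" for \<alpha>
    by (simp only:) (intro span_sum span_scale span_base imageI)
  obtain B where B: "B \<subseteq> (\<lambda>x. R (\<eta> x)) ` \<Omega>" "independent B" "(\<lambda>x. R (\<eta> x)) ` \<Omega> \<subseteq> span B"
    using maximal_independent_subset[of "(\<lambda>x. R (\<eta> x)) ` \<Omega>"] by blast
  have "B \<subseteq> span (e ` blists j)" using B(1) Rspan by auto
  then have fin: "finite B" using independent_span_bound[OF _ B(2), of "e ` blists j"] by simp
  have "AE x in lebesgue_on \<Omega>. \<forall>\<beta>\<in>B. alt_inner j (\<eta> x) \<beta> = 0"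
  proof (subst AE_ball_countable)
    show "\<forall>\<beta>\<in>B. AE x in lebesgue_on \<Omega>. alt_inner j (\<eta> x) \<beta> = 0"
      using B(1) alt orth_const by (auto simp: R)
  qed (use fin in \<open>simp add: countable_finite\<close>)
  moreover have "AE x in lebesgue_on \<Omega>. x \<in> \<Omega>" by (rule AE_I2) simp
  ultimately show ?thesis
  proof eventually_elim
    case (elim x)
    \<comment> \<open>The finitely many orthogonality relations extend linearly to
      \<open>span B\<close>, which contains \<open>R (\<eta> x)\<close>; hence \<eta> is orthogonal
      to itself at \<open>x\<close>.\<close>
    have "span B \<subseteq> {\<gamma>. alt_inner j (\<eta> x) \<gamma> = 0}"
      using elim(1) by (intro span_minimal)
        (auto simp: subspace_def alt_inner_sym[of _ "\<eta> x"] alt_inner_add alt_inner_scale, simp add: alt_inner_eq zero_fun_def)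
    moreover have "R (\<eta> x) \<in> span B" using B(3) elim(2) by auto
    ultimately have "alt_inner j (\<eta> x) (R (\<eta> x)) = 0" by blast
    then have "alt_inner j (\<eta> x) (\<eta> x) = 0" unfolding R .
    then show "\<eta> x = 0" using alternating_eqI[OF alt[OF elim(2)]] by (simp add: alt_inner_eq_0_iff)
  qed
qed

lemma ext_deriv_weak: "\<omega> \<in> H_form \<Omega> j \<Longrightarrow> weak_ext_deriv \<Omega> j \<omega> (ext_deriv \<Omega> j \<omega>)"
  unfolding H_form_def ext_deriv_def by (auto simp: some_eq_ex[of "weak_ext_deriv \<Omega> j \<omega>"])

lemma ext_deriv_L2: "\<omega> \<in> H_form \<Omega> j \<Longrightarrow> ext_deriv \<Omega> j \<omega> \<in> L2_form \<Omega> (j + 1)"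
  using ext_deriv_weak by (auto simp: weak_ext_deriv_def)

lemma H_form_L2: "\<omega> \<in> H_form \<Omega> j \<Longrightarrow> \<omega> \<in> L2_form \<Omega> j"
  by (simp add: H_form_def)

lemma H0_form_H: "\<omega> \<in> H0_form \<Omega> j \<Longrightarrow> \<omega> \<in> H_form \<Omega> j"
  by (simp add: H0_form_def)

section \<open>Linearity of the weak exterior derivative modulo null forms\<close>

locale bounded_domain =
  fixes \<Omega> :: "(real^'n::finite) set"
  assumes bounded: "bounded \<Omega>" and open_dom: "open \<Omega>"
begin

lemmas smooth_L2 = smooth_form_L2_coords[OF bounded open_dom]
  and codiff_L2 = codiff_L2_coords[OF bounded open_dom]

lemma weak_ext_deriv_add_scale:
  assumes "weak_ext_deriv \<Omega> j \<omega> \<eta>" "weak_ext_deriv \<Omega> j \<omega>' \<eta>'" "\<omega> \<in> L2_coords \<Omega>" "\<omega>' \<in> L2_coords \<Omega>"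
  shows "weak_ext_deriv \<Omega> j (\<omega> + c *\<^sub>R \<omega>') (\<eta> + c *\<^sub>R \<eta>')"
  unfolding weak_ext_deriv_def
proof (intro conjI ballI)
  show "\<eta> + c *\<^sub>R \<eta>' \<in> L2_form \<Omega> (j + 1)"
    using assms subspace_L2_form by (auto simp: weak_ext_deriv_def intro!: subspace_add subspace_scale)
  fix \<phi> :: "'n form" assume \<phi>: "\<phi> \<in> test_form \<Omega> (j + 1)"
  then have "\<phi> \<in> L2_coords \<Omega>" "codiff \<phi> \<in> L2_coords \<Omega>"
    using smooth_L2 codiff_L2 test_form_smooth by blast+
  moreover have "\<eta> \<in> L2_coords \<Omega>" "\<eta>' \<in> L2_coords \<Omega>"
    using assms by (auto simp: weak_ext_deriv_def L2_form_coords)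
  ultimately show "form_inner \<Omega> (j + 1) (\<eta> + c *\<^sub>R \<eta>') \<phi> = form_inner \<Omega> j (\<omega> + c *\<^sub>R \<omega>') (codiff \<phi>)"
    using assms \<phi> by (simp add: L2.bilin weak_ext_deriv_def)
qed

text \<open>Test forms see \<omega> only through inner products, hence only up to null forms, and
  they separate the candidates for the derivative. Assuming a null difference instead of equality
  makes this the source of all congruence rules for \<open>ext_deriv\<close>.\<close>

lemma weak_ext_deriv_unique:
  assumes w: "weak_ext_deriv \<Omega> j \<omega> \<eta>" "weak_ext_deriv \<Omega> j \<omega>' \<eta>'" "\<omega> \<in> L2_coords \<Omega>" "\<omega>' \<in> L2_coords \<Omega>"
    and null: "form_inner \<Omega> j (\<omega> - \<omega>') (\<omega> - \<omega>') = 0"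
  shows "AE x in lebesgue_on \<Omega>. \<eta> x = \<eta>' x"
    and "form_inner \<Omega> (j + 1) (\<eta> - \<eta>') (\<eta> - \<eta>') = 0"
proof -
  have "AE x in lebesgue_on \<Omega>. (\<eta> - \<eta>') x = 0"
  proof (rule test_forms_dense[OF bounded open_dom])
    show "\<eta> - \<eta>' \<in> L2_form \<Omega> (j + 1)"
      using w subspace_L2_form by (auto simp: weak_ext_deriv_def intro!: subspace_diff)
    fix \<phi> :: "'n form" assume \<phi>: "\<phi> \<in> test_form \<Omega> (j + 1)"
    then have L: "\<phi> \<in> L2_coords \<Omega>" "codiff \<phi> \<in> L2_coords \<Omega>"
      using smooth_L2 codiff_L2 test_form_smooth by blast+
    moreover have "\<eta> \<in> L2_coords \<Omega>" "\<eta>' \<in> L2_coords \<Omega>"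
      using w by (auto simp: weak_ext_deriv_def L2_form_coords)
    ultimately show "form_inner \<Omega> (j + 1) (\<eta> - \<eta>') \<phi> = 0"
      using w \<phi> L2.cong_left[OF w(3,4) L(2) null] by (simp add: L2.diff_left weak_ext_deriv_def)
  qed
  then show ae: "AE x in lebesgue_on \<Omega>. \<eta> x = \<eta>' x" 
    by eventually_elim (simp only: fun_diff_def[of \<eta>] right_minus_eq)
  then show "form_inner \<Omega> (j + 1) (\<eta> - \<eta>') (\<eta> - \<eta>') = 0"
    by (intro form_eq_imp_null) (simp add: form_eq_def)
qed

lemma subspace_H_form: "subspace (H_form \<Omega> j)"
proof (rule subspaceI)
  have "weak_ext_deriv \<Omega> j 0 0"
    unfolding weak_ext_deriv_def
    using subspace_0[OF subspace_L2_form[of \<Omega> "j + 1"]] L2.zero_left smooth_L2 codiff_L2 test_form_smooth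
    by metis
  then show "0 \<in> H_form \<Omega> j" using subspace_0[OF subspace_L2_form] by (auto simp: H_form_def)
next
  fix x y assume xy: "x \<in> H_form \<Omega> j" "y \<in> H_form \<Omega> j"
  then obtain \<eta> \<theta> where "weak_ext_deriv \<Omega> j x \<eta>" "weak_ext_deriv \<Omega> j y \<theta>" by (auto simp: H_form_def)
  then have "weak_ext_deriv \<Omega> j (x + 1 *\<^sub>R y) (\<eta> + 1 *\<^sub>R \<theta>)"
    using xy by (intro weak_ext_deriv_add_scale) (auto dest: H_form_L2 L2_form_coords)
  then show "x + y \<in> H_form \<Omega> j"
    using xy subspace_add[OF subspace_L2_form] by (auto simp: H_form_def)
next
  fix c x assume x: "x \<in> H_form \<Omega> j"
  then obtain \<eta> where "weak_ext_deriv \<Omega> j x \<eta>" by (auto simp: H_form_def)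
  \<comment> \<open>The multiple is written as \<open>x + (c - 1) *\<^sub>R x\<close>, so that the
    combined rule for sums and multiples applies.\<close>
  then have "weak_ext_deriv \<Omega> j (x + (c - 1) *\<^sub>R x) (\<eta> + (c - 1) *\<^sub>R \<eta>)"
    using x by (intro weak_ext_deriv_add_scale) (auto dest: H_form_L2 L2_form_coords)
  then show "c *\<^sub>R x \<in> H_form \<Omega> j"
    using x subspace_scale[OF subspace_L2_form] by (auto simp: H_form_def scaleR_left_diff_distrib)
qed

lemma ext_deriv_null:
  assumes "\<omega> \<in> H_form \<Omega> j" "weak_ext_deriv \<Omega> j \<omega>' \<eta>" "\<omega>' \<in> L2_coords \<Omega>" "form_inner \<Omega> j (\<omega> - \<omega>') (\<omega> - \<omega>') = 0"
  shows "form_inner \<Omega> (j + 1) (ext_deriv \<Omega> j \<omega> - \<eta>) (ext_deriv \<Omega> j \<omega> - \<eta>) = 0"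
  using assms weak_ext_deriv_unique(2)[OF ext_deriv_weak assms(2)] H_form_L2 L2_form_coords by blast

text \<open>The three values of \<open>ext_deriv\<close> are independent choices, so linearity can
  only be asserted up to a null form.\<close>

lemma ext_deriv_add_scale:
  fixes c :: real
  assumes "\<omega> \<in> H_form \<Omega> j" "\<omega>' \<in> H_form \<Omega> j"
  defines "e \<equiv> ext_deriv \<Omega> j (\<omega> + c *\<^sub>R \<omega>') - (ext_deriv \<Omega> j \<omega> + c *\<^sub>R ext_deriv \<Omega> j \<omega>')"
  shows "form_inner \<Omega> (j + 1) e e = 0"
  unfolding e_def
proof (rule ext_deriv_null)
  show "\<omega> + c *\<^sub>R \<omega>' \<in> H_form \<Omega> j"
    using assms subspace_H_form by (intro subspace_add subspace_scale)
  show "weak_ext_deriv \<Omega> j (\<omega> + c *\<^sub>R \<omega>') (ext_deriv \<Omega> j \<omega> + c *\<^sub>R ext_deriv \<Omega> j \<omega>')"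
    using assms by (intro weak_ext_deriv_add_scale ext_deriv_weak) (auto dest: H_form_L2 L2_form_coords)
  show "\<omega> + c *\<^sub>R \<omega>' \<in> L2_coords \<Omega>" using assms by (auto dest!: H_form_L2 L2_form_coords)
qed simp

lemma inner_ext_deriv_add_scale:
  assumes "\<omega> \<in> H_form \<Omega> j" "\<omega>' \<in> H_form \<Omega> j" "\<eta> \<in> L2_coords \<Omega>"
  shows "form_inner \<Omega> (j + 1) (ext_deriv \<Omega> j (\<omega> + c *\<^sub>R \<omega>')) \<eta> =
    form_inner \<Omega> (j + 1) (ext_deriv \<Omega> j \<omega>) \<eta> + c * form_inner \<Omega> (j + 1) (ext_deriv \<Omega> j \<omega>') \<eta>"
proof -
  have L: "ext_deriv \<Omega> j \<omega> \<in> L2_coords \<Omega>" "ext_deriv \<Omega> j \<omega>' \<in> L2_coords \<Omega>" "ext_deriv \<Omega> j (\<omega> + c *\<^sub>R \<omega>') \<in> L2_coords \<Omega>"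
    using assms subspace_H_form[of j] by (auto intro!: L2_form_coords ext_deriv_L2 subspace_add subspace_scale)
  from L2.cong_left[OF L(3) _ assms(3) ext_deriv_add_scale[OF assms(1,2)]] L assms(3)
  show ?thesis by (simp add: L2.bilin)
qed

lemma form_trace_add_scale:
  assumes "\<omega> \<in> H_form \<Omega> j" "\<omega>' \<in> H_form \<Omega> j" "\<eta> \<in> smooth_form (j + 1)"
  shows "form_trace \<Omega> j (\<omega> + c *\<^sub>R \<omega>') \<eta> = form_trace \<Omega> j \<omega> \<eta> + c * form_trace \<Omega> j \<omega>' \<eta>"
  using inner_ext_deriv_add_scale[OF assms(1,2) smooth_L2[OF assms(3)], of c] codiff_L2[OF assms(3)] assms(1,2)[THEN H_form_L2, THEN L2_form_coords]
  by (simp add: form_trace_def L2.bilin algebra_simps)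

lemma subspace_H0_form: "subspace (H0_form \<Omega> j)"
proof -
  have H0: "0 \<in> H_form \<Omega> j" by (rule subspace_0[OF subspace_H_form])
  have comb: "\<omega> + c *\<^sub>R \<omega>' \<in> H0_form \<Omega> j" if "\<omega> \<in> H0_form \<Omega> j" "\<omega>' \<in> H0_form \<Omega> j" for \<omega> \<omega>' c
    using that subspace_H_form[of j] by (auto simp: H0_form_def form_trace_add_scale intro!: subspace_add subspace_scale)
  have "0 \<in> H0_form \<Omega> j"
    \<comment> \<open>Additivity at 0 + 0 forces the trace of 0 to vanish, although
      \<open>ext_deriv\<close> of 0 is a choice that may differ from 0 on a null set.\<close>
    using form_trace_add_scale[OF H0 H0, of _ 1] H0 by (auto simp: H0_form_def)
  then show ?thesis
    using comb[of _ _ 1] comb[of 0] by (intro subspaceI) simp_all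
qed

end

section \<open>Alternating forms and classical exterior derivatives\<close>

lemma alternating_length: "\<lbrakk>alternating j \<alpha>; int (length vs) \<noteq> j\<rbrakk> \<Longrightarrow> \<alpha> vs = 0"
  by (simp add: alternating_def)

lemma alternating_linear:
  "\<lbrakk>alternating j \<alpha>; int (length us + length ws) + 1 = j\<rbrakk> \<Longrightarrow> linear (\<lambda>v. \<alpha> (us @ v # ws))"
  by (simp add: alternating_def)

lemma alternating_linear_any:
  assumes "alternating j \<alpha>"
  shows "linear (\<lambda>v. \<alpha> (us @ v # ws))"
proof (cases "int (length us + length ws) + 1 = j")
  case False
  then have "(\<lambda>v. \<alpha> (us @ v # ws)) = (\<lambda>v. 0)"
    by (intro ext alternating_length[OF assms]) auto
  then show ?thesis by (simp add: linear_iff)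
qed (use assms in \<open>rule alternating_linear\<close>)

lemma alternating_distinct: "\<lbrakk>alternating j \<alpha>; \<not> distinct vs\<rbrakk> \<Longrightarrow> \<alpha> vs = 0"
  by (simp add: alternating_def)

text \<open>Polarisation: the form vanishes when both slots contain \<open>v + w\<close>.\<close>

lemma alternating_swap:
  assumes \<alpha>: "alternating j \<alpha>"
  shows "\<alpha> (us @ v # w # ws) = - \<alpha> (us @ w # v # ws)"
proof -
  have l1: "\<alpha> (us @ (a + b) # ws') = \<alpha> (us @ a # ws') + \<alpha> (us @ b # ws')" for a b ws'
    using linear_add[OF alternating_linear_any[OF \<alpha>, of us ws']] .
  have l2: "\<alpha> (us @ a # (b + c) # ws) = \<alpha> (us @ a # b # ws) + \<alpha> (us @ a # c # ws)" for a b c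
    using linear_add[OF alternating_linear_any[OF \<alpha>, of "us @ [a]" ws]] by simp
  have z: "\<alpha> (us @ a # a # ws) = 0" for a
    by (rule alternating_distinct[OF \<alpha>]) simp
  have "0 = \<alpha> (us @ (v + w) # (v + w) # ws)" using z by simp
  also have "\<dots> = \<alpha> (us @ v # w # ws) + \<alpha> (us @ w # v # ws)"
    unfolding l1 l2 using z[of v] z[of w] by simp
  finally show ?thesis by simp
qed

lemma alternating_move:
  assumes \<alpha>: "alternating j \<alpha>"
  shows "\<alpha> (us @ v # ms @ ws) = (- 1) ^ length ms * \<alpha> (us @ ms @ v # ws)"
proof (induction ms arbitrary: us)
  case (Cons m ms)
  have "\<alpha> (us @ v # (m # ms) @ ws) = - \<alpha> ((us @ [m]) @ v # ms @ ws)"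
    using alternating_swap[OF \<alpha>, of us v m "ms @ ws"] by simp
  also have "\<dots> = (- 1) ^ length (m # ms) * \<alpha> (us @ (m # ms) @ v # ws)"
    unfolding Cons.IH by simp
  finally show ?case .
qed simp

lemma smooth_formD: "\<phi> \<in> smooth_form j \<Longrightarrow> alternating j (\<phi> x)" "\<phi> \<in> smooth_form j \<Longrightarrow> smooth (\<lambda>x. \<phi> x vs)"
  by (auto simp: smooth_form_def)

lemma linear_dir_deriv_slot:
  assumes \<phi>: "\<phi> \<in> smooth_form j"
  shows "linear (\<lambda>v. dir_deriv u (\<lambda>y. \<phi> y (us @ v # ws)) x)"
proof (rule linearI)
  have d: "(\<lambda>y. \<phi> y vs) differentiable (at x)" for vs x
    using smooth_formD(2)[OF \<phi>] by (rule smooth_differentiable)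
  have lin: "linear (\<lambda>v. \<phi> y (us @ v # ws))" for y
    using smooth_formD(1)[OF \<phi>] by (rule alternating_linear_any)
  show "dir_deriv u (\<lambda>y. \<phi> y (us @ (v + w) # ws)) x =
      dir_deriv u (\<lambda>y. \<phi> y (us @ v # ws)) x + dir_deriv u (\<lambda>y. \<phi> y (us @ w # ws)) x" for v w
    by (simp add: linear_add[OF lin] dir_deriv_add d)
  show "dir_deriv u (\<lambda>y. \<phi> y (us @ (c *\<^sub>R v) # ws)) x = c *\<^sub>R dir_deriv u (\<lambda>y. \<phi> y (us @ v # ws)) x" for c v
    by (simp add: linear_scale[OF lin] dir_deriv_cmult d)
qed

lemma linear_sum_fun: "(\<And>i. i \<in> I \<Longrightarrow> linear (f i)) \<Longrightarrow> linear (\<lambda>v. \<Sum>i\<in>I. f i v)"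
  by (rule linear_compose_sum) auto

lemma codiff_smooth_form:
  assumes \<phi>: "\<phi> \<in> smooth_form (j + 1)"
  shows "codiff \<phi> \<in> smooth_form j"
  unfolding smooth_form_def
proof (intro CollectI conjI allI)
  fix x
  show "alternating j (codiff \<phi> x)"
    unfolding alternating_def
  proof (intro conjI allI impI)
    fix vs :: "(real^'a) list" assume "int (length vs) \<noteq> j"
    then have "\<phi> y (b # vs) = 0" for y b
      using alternating_length[OF smooth_formD(1)[OF \<phi>], of "b # vs" y] by simp
    then show "codiff \<phi> x vs = 0" by (simp add: codiff_def)
  next
    fix us ws :: "(real^'a) list"
    have "linear (\<lambda>v. \<Sum>b\<in>Basis. dir_deriv b (\<lambda>y. \<phi> y ((b # us) @ v # ws)) x)"
      by (intro linear_sum_fun linear_dir_deriv_slot[OF \<phi>])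
    from linear_compose_neg[OF this] show "linear (\<lambda>v. codiff \<phi> x (us @ v # ws))" by (simp add: codiff_def)
  next
    fix vs :: "(real^'a) list" assume "\<not> distinct vs"
    then have "\<phi> y (b # vs) = 0" for y b
      using alternating_distinct[OF smooth_formD(1)[OF \<phi>], of "b # vs" y] by simp
    then show "codiff \<phi> x vs = 0" by (simp add: codiff_def)
  qed
next
  fix vs
  show "smooth (\<lambda>x. codiff \<phi> x vs)" unfolding codiff_def
    by (intro smooth_minus smooth_sum) (simp add: smooth_dir_deriv smooth_formD(2)[OF \<phi>])
qed

lemma codiff_zero_outside:
  assumes "closed K" "\<And>x. x \<notin> K \<Longrightarrow> \<phi> x = 0" "x \<notin> K"
  shows "codiff \<phi> x = 0"
proof -
  have "dir_deriv b (\<lambda>y. \<phi> y (b # vs)) x = 0" for b vs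
    using assms by (intro dir_deriv_zero_outside[of K]) (auto simp: zero_fun_def)
  then show ?thesis by (simp add: codiff_def zero_fun_def)
qed

lemma codiff_test_form:
  assumes "\<phi> \<in> test_form \<Omega> (j + 1)"
  shows "codiff \<phi> \<in> test_form \<Omega> j"
proof -
  from assms obtain K where K: "compact K" "K \<subseteq> \<Omega>" "\<And>x. x \<notin> K \<Longrightarrow> \<phi> x = 0" and \<phi>: "\<phi> \<in> smooth_form (j + 1)"
    by (auto simp: test_form_def)
  have "\<forall>x. x \<notin> K \<longrightarrow> codiff \<phi> x = 0"
    using K compact_imp_closed codiff_zero_outside by blast
  then show ?thesis using K codiff_smooth_form[OF \<phi>] by (auto simp: test_form_def)
qed

text \<open>The second derivatives commute while exchanging the two leading arguments flips the sign
  of the form, so \<open>G\<close> is antisymmetric and its double sum equals its own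
  negative.\<close>

lemma codiff_codiff:
  assumes \<phi>: "\<phi> \<in> smooth_form j"
  shows "codiff (codiff \<phi>) = 0"
proof (intro ext)
  fix x vs
  define G where "G b c = dir_deriv b (dir_deriv c (\<lambda>z. \<phi> z (c # b # vs))) x" for b c
  have sm: "smooth (\<lambda>z. \<phi> z ws)" for ws using smooth_formD(2)[OF \<phi>] .
  have anti: "G b c = - G c b" for b c
  proof -
    have "(\<lambda>z. \<phi> z (c # b # vs)) = (\<lambda>z. - \<phi> z (b # c # vs))"
      using alternating_swap[OF smooth_formD(1)[OF \<phi>], of _ "[]" c b vs] by auto
    moreover have "dir_deriv c (\<lambda>z. - \<phi> z (b # c # vs)) = (\<lambda>z. - dir_deriv c (\<lambda>z. \<phi> z (b # c # vs)) z)"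
      by (intro ext dir_deriv_minus smooth_differentiable sm)
    ultimately have "G b c = dir_deriv b (\<lambda>z. - dir_deriv c (\<lambda>z. \<phi> z (b # c # vs)) z) x"
      unfolding G_def by simp
    also have "\<dots> = - dir_deriv b (dir_deriv c (\<lambda>z. \<phi> z (b # c # vs))) x"
      by (intro dir_deriv_minus smooth_differentiable smooth_dir_deriv sm)
    also have "\<dots> = - G c b" unfolding G_def using dir_deriv_commute[OF sm] by simp
    finally show ?thesis .
  qed
  have "dir_deriv b (\<lambda>y. codiff \<phi> y (b # vs)) x = - (\<Sum>c\<in>Basis. G b c)" for b
    unfolding codiff_def G_def
    by (subst dir_deriv_minus, intro smooth_differentiable smooth_sum smooth_dir_deriv sm)
      (subst dir_deriv_sum, auto intro!: smooth_differentiable smooth_dir_deriv sm)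
  then have "codiff (codiff \<phi>) x vs = (\<Sum>b\<in>Basis. \<Sum>c\<in>Basis. G b c)"
    by (simp add: codiff_def[of "codiff \<phi>"] sum_negf)
  moreover have "(\<Sum>b\<in>Basis. \<Sum>c\<in>Basis. G b c) = 0"
  proof -
    have "(\<Sum>b\<in>Basis. \<Sum>c\<in>Basis. G b c) = (\<Sum>b\<in>Basis. \<Sum>c\<in>Basis. - G b c)"
      by (subst sum.swap, intro sum.cong refl anti)
    also have "\<dots> = - (\<Sum>b\<in>Basis. \<Sum>c\<in>Basis. G b c)"
      by (simp only: sum_negf)
    finally show ?thesis by linarith
  qed
  ultimately show "codiff (codiff \<phi>) x vs = 0 x vs" by (simp add: zero_fun_def)
qed

text \<open>The invariant formula for \<open>d\<close> on constant vector fields: the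
  \<open>i\<close>-th argument is removed from the list and becomes the direction of
  differentiation. No degree is recorded, since the list supplies it.\<close>

definition classical_ext_deriv :: "'n::finite form \<Rightarrow> 'n form"
  where "classical_ext_deriv p = (\<lambda>x vs. \<Sum>i<length vs. (- 1) ^ i *
    dir_deriv (vs ! i) (\<lambda>y. p y (take i vs @ drop (Suc i) vs)) x)"

text \<open>A term that removes neither copy of \<open>v\<close> still has a repeated argument and
  vanishes. The two remaining terms cancel: their signs differ by \<open>length ms + 1\<close>
  factors of -1, and moving \<open>v\<close> across \<open>ms\<close> costs \<open>length ms\<close>
  of them.\<close>

lemma classical_ext_deriv_repeated:
  assumes p: "p \<in> smooth_form j"
  shows "classical_ext_deriv p x (us @ v # ms @ v # ws) = 0"
proof -
  define vs where "vs = us @ v # ms @ v # ws"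
  define T where "T i = (- 1) ^ i * dir_deriv (vs ! i) (\<lambda>y. p y (take i vs @ drop (Suc i) vs)) x" for i :: nat
  define a b where "a = length us" and "b = Suc (length us + length ms)"
  have va: "take a vs @ drop (Suc a) vs = us @ ms @ v # ws" "vs ! a = v"
    by (simp_all add: vs_def a_def)
  have vb: "take b vs @ drop (Suc b) vs = us @ v # ms @ ws" "vs ! b = v"
    by (simp_all add: vs_def b_def nth_append)
  have zero: "T i = 0" if i: "i < length vs" "i \<noteq> a" "i \<noteq> b" for i
  proof -
    have ab: "a < b" "b < length vs" "vs ! a = vs ! b" using va vb by (auto simp: a_def b_def vs_def)
    have "\<not> distinct (take i vs @ drop (Suc i) vs)"
    proof
      let ?l = "take i vs @ drop (Suc i) vs"
      assume d: "distinct ?l"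
      \<comment> \<open>Removing entry \<open>i\<close> shifts the later positions down by one; the
        two copies of \<open>v\<close> stay at different positions.\<close>
      have nth: "?l ! (if m < i then m else m - 1) = vs ! m" "(if m < i then m else m - 1) < length ?l"
        if "m < length vs" "m \<noteq> i" for m
        using that i by (auto simp: nth_append)
      have "(if a < i then a else a - 1) = (if b < i then b else b - 1)"
        using nth_eq_iff_index_eq[OF d nth(2)[of a] nth(2)[of b]] nth(1)[of a] nth(1)[of b] ab i by simp
      then show False using ab i by (auto split: if_splits)
    qed
    then have "p y (take i vs @ drop (Suc i) vs) = 0" for y
      using alternating_distinct[OF smooth_formD(1)[OF p]] by blast
    then show ?thesis by (simp add: T_def)
  qed
  have "(\<Sum>i<length vs. T i) = (\<Sum>i\<in>{a, b}. T i)"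
    using zero by (intro sum.mono_neutral_right) (auto simp: a_def b_def vs_def)
  also have "\<dots> = T a + T b" by (simp add: a_def b_def)
  also have "T a = (- 1) ^ a * dir_deriv v (\<lambda>y. p y (us @ ms @ v # ws)) x" by (simp add: T_def va)
  also have "T b = (- 1) ^ b * dir_deriv v (\<lambda>y. p y (us @ v # ms @ ws)) x" by (simp add: T_def vb)
  also have "(\<lambda>y. p y (us @ v # ms @ ws)) = (\<lambda>y. (- 1) ^ length ms * p y (us @ ms @ v # ws))"
    using alternating_move[OF smooth_formD(1)[OF p]] by blast
  also have "dir_deriv v \<dots> x = (- 1) ^ length ms * dir_deriv v (\<lambda>y. p y (us @ ms @ v # ws)) x"
    by (intro dir_deriv_cmult smooth_differentiable smooth_formD(2)[OF p])
  finally show ?thesis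
    unfolding classical_ext_deriv_def vs_def[symmetric] T_def[symmetric]
    by (simp add: a_def b_def power_add flip: mult.assoc power_mult_distrib)
qed

lemma classical_ext_deriv_smooth_form:
  assumes p: "p \<in> smooth_form j"
  shows "classical_ext_deriv p \<in> smooth_form (j + 1)"
  unfolding smooth_form_def
proof (intro CollectI conjI allI)
  fix x
  show "alternating (j + 1) (classical_ext_deriv p x)"
    unfolding alternating_def
  proof (intro conjI allI impI)
    fix vs :: "(real^'a) list" assume *: "int (length vs) \<noteq> j + 1"
    have "p y (take i vs @ drop (Suc i) vs) = 0" if "i < length vs" for y i
      using that * by (intro alternating_length[OF smooth_formD(1)[OF p]]) auto
    then show "classical_ext_deriv p x vs = 0" by (simp add: classical_ext_deriv_def)
  next
    fix us ws :: "(real^'a) list"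
    have "linear (\<lambda>v. dir_deriv ((us @ v # ws) ! i) (\<lambda>y. p y (take i (us @ v # ws) @ drop (Suc i) (us @ v # ws))) x)"
      for i
    proof -
      consider "i < length us" | "i = length us" | "i > length us" by linarith
      then show ?thesis
      proof cases
        case 1
        then show ?thesis
          using linear_dir_deriv_slot[OF p, of "us ! i" "take i us @ drop (Suc i) us" ws x]
          by (simp add: nth_append)
      next
        case 2
        then show ?thesis by (simp add: linear_dir_deriv smooth_differentiable smooth_formD(2)[OF p])
      next
        case 3
        then obtain m where m: "i = Suc (length us + m)" by (metis add_Suc_right less_imp_Suc_add)
        then show ?thesis
          using linear_dir_deriv_slot[OF p, of "ws ! m" us "take m ws @ drop (Suc m) ws" x]
          by (simp add: nth_append)
      qed
    qed
    then have "linear (\<lambda>v. (- 1) ^ i *\<^sub>R dir_deriv ((us @ v # ws) ! i) (\<lambda>y. p y (take i (us @ v # ws) @ drop (Suc i) (us @ v # ws))) x)" for i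
      by (rule linear_compose_scale_right)
    then have "linear (\<lambda>v. \<Sum>i<length us + length (v # ws). (- 1) ^ i *\<^sub>R dir_deriv ((us @ v # ws) ! i) (\<lambda>y. p y (take i (us @ v # ws) @ drop (Suc i) (us @ v # ws))) x)"
      unfolding length_Cons by (intro linear_sum_fun)
    then show "linear (\<lambda>v. classical_ext_deriv p x (us @ v # ws))"
      unfolding classical_ext_deriv_def by (simp only: length_append real_scaleR_def)
  next
    fix vs :: "(real^'a) list" assume "\<not> distinct vs"
    then obtain us v ms ws where "vs = us @ v # ms @ v # ws"
      using not_distinct_decomp by force
    then show "classical_ext_deriv p x vs = 0" using classical_ext_deriv_repeated[OF p] by simp
  qed
next
  fix vs
  show "smooth (\<lambda>x. classical_ext_deriv p x vs)" unfolding classical_ext_deriv_def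
    by (intro smooth_sum smooth_mult smooth_const) (simp add: smooth_dir_deriv smooth_formD(2)[OF p])
qed

context bounded_domain
begin

text \<open>Everything follows from \<open>codiff_codiff\<close>. It makes 0 a weak derivative of
  \<open>ext_deriv \<Omega> j \<sigma>\<close>, and it reduces the trace of that form against \<eta>
  to the trace of \<sigma> against \<open>codiff \<eta>\<close>, which is 0.\<close>

lemma ext_deriv_H0:
  assumes \<sigma>: "\<sigma> \<in> H0_form \<Omega> j"
  shows "ext_deriv \<Omega> j \<sigma> \<in> H0_form \<Omega> (j + 1)"
proof -
  let ?d = "ext_deriv \<Omega> j \<sigma>"
  have \<sigma>H: "\<sigma> \<in> H_form \<Omega> j" using \<sigma> by (rule H0_form_H)
  then have \<sigma>L: "\<sigma> \<in> L2_coords \<Omega>" by (intro L2_form_coords H_form_L2)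
  have dL: "?d \<in> L2_form \<Omega> (j + 1)" using \<sigma>H by (rule ext_deriv_L2)
  then have dLc: "?d \<in> L2_coords \<Omega>" by (rule L2_form_coords)
  have cc0: "form_inner \<Omega> j \<sigma> (codiff (codiff \<phi>)) = 0" if "\<phi> \<in> smooth_form (j + 1 + 1)" for \<phi>
    using codiff_codiff[OF that] \<sigma>L by simp
  have w: "weak_ext_deriv \<Omega> (j + 1) ?d 0"
    unfolding weak_ext_deriv_def
  proof (intro conjI ballI)
    show "0 \<in> L2_form \<Omega> (j + 1 + 1)" by (rule subspace_0[OF subspace_L2_form])
    fix \<phi> :: "'n form" assume \<phi>: "\<phi> \<in> test_form \<Omega> (j + 1 + 1)"
    then have "codiff \<phi> \<in> test_form \<Omega> (j + 1)" by (rule codiff_test_form)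
    then have "form_inner \<Omega> (j + 1) ?d (codiff \<phi>) = form_inner \<Omega> j \<sigma> (codiff (codiff \<phi>))"
      using ext_deriv_weak[OF \<sigma>H] unfolding weak_ext_deriv_def by blast
    moreover have "form_inner \<Omega> (j + 1 + 1) 0 \<phi> = 0"
      using smooth_L2[OF test_form_smooth[OF \<phi>]] by (rule L2.zero_left)
    ultimately show "form_inner \<Omega> (j + 1 + 1) 0 \<phi> = form_inner \<Omega> (j + 1) ?d (codiff \<phi>)"
      using cc0[OF test_form_smooth[OF \<phi>]] by simp
  qed
  have dH: "?d \<in> H_form \<Omega> (j + 1)" using w dL by (auto simp: H_form_def)
  have "form_inner \<Omega> (j + 1 + 1) (ext_deriv \<Omega> (j + 1) ?d - 0) (ext_deriv \<Omega> (j + 1) ?d - 0) = 0"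
    using dH w dLc by (rule ext_deriv_null) simp
  then have null: "form_inner \<Omega> (j + 1 + 1) (ext_deriv \<Omega> (j + 1) ?d) (ext_deriv \<Omega> (j + 1) ?d) = 0"
    by simp
  have "form_trace \<Omega> (j + 1) ?d \<eta> = 0" if \<eta>: "\<eta> \<in> smooth_form (j + 1 + 1)" for \<eta>
  proof -
    have "form_inner \<Omega> (j + 1 + 1) (ext_deriv \<Omega> (j + 1) ?d) \<eta> = 0"
      using L2_form_coords[OF ext_deriv_L2[OF dH]] smooth_L2[OF \<eta>] null by (rule L2.null_left)
    moreover have "form_trace \<Omega> j \<sigma> (codiff \<eta>) = 0"
      using \<sigma> codiff_smooth_form[OF \<eta>] by (simp add: H0_form_def)
    ultimately show ?thesis using cc0[OF \<eta>] by (simp add: form_trace_def)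
  qed
  then show ?thesis using dH by (simp add: H0_form_def)
qed

end

section \<open>Green's formula for smooth forms\<close>

lemma lebesgue_on_integral_eq_lborel:
  fixes g :: "'a::euclidean_space \<Rightarrow> real"
  assumes "S \<in> sets lebesgue" "g \<in> borel_measurable borel" "\<And>x. x \<notin> S \<Longrightarrow> g x = 0"
  shows "(\<integral>x. g x \<partial>lebesgue_on S) = (\<integral>x. g x \<partial>lborel)"
proof -
  have "(\<integral>x. g x \<partial>lebesgue_on S) = (\<integral>x. indicator S x *\<^sub>R g x \<partial>lebesgue)"
    using assms(1) by (intro integral_restrict_space) simp
  also have "(\<lambda>x. indicator S x *\<^sub>R g x) = g"
    using assms(3) by (intro ext) (auto simp: indicator_def)
  also have "integral\<^sup>L lebesgue g = integral\<^sup>L lborel g"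
    using assms(2) by (intro integral_completion) simp
  finally show ?thesis .
qed

lemma sum_fun_apply: "(\<Sum>i\<in>I. f i) x = (\<Sum>i\<in>I. f i x)"
  by (induction I rule: infinite_finite_induct) (auto simp: fun_ops)

lemma zero_in_span: "(\<lambda>x. 0) \<in> span S"
  using span_zero[of S] by (simp add: zero_fun_def)

lemma sum_blists_Cons:
  fixes F :: "real^'n::finite \<Rightarrow> (real^'n) list \<Rightarrow> real"
  assumes "j \<ge> 0"
  shows "(\<Sum>ds\<in>blists (j + 1). F (hd ds) (tl ds)) = (\<Sum>b\<in>Basis. \<Sum>bs\<in>blists j. F b bs)"
proof -
  have "(\<Sum>b\<in>Basis. \<Sum>bs\<in>blists j. F b bs) = (\<Sum>(b, bs)\<in>Basis \<times> blists j. F b bs)"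
    by (rule sum.cartesian_product)
  also have "\<dots> = (\<Sum>ds\<in>blists (j + 1). F (hd ds) (tl ds))"
  proof (rule sum.reindex_bij_witness[where i = "\<lambda>ds. (hd ds, tl ds)" and j = "\<lambda>(b, bs). b # bs"])
    fix ds :: "(real^'n) list" assume ds: "ds \<in> blists (j + 1)"
    then obtain b bs where "ds = b # bs" using assms by (cases ds) (auto simp: blists_def)
    then show "(case (hd ds, tl ds) of (b, bs) \<Rightarrow> b # bs) = ds" "(hd ds, tl ds) \<in> Basis \<times> blists j"
      using ds by (auto simp: blists_def)
  qed (auto simp: blists_def)
  finally show ?thesis by simp
qed

text \<open>Moving the entry at a fixed position to the front permutes the index tuples.\<close>

lemma sum_blists_move:
  fixes F :: "real^'n::finite \<Rightarrow> (real^'n) list \<Rightarrow> real"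
  assumes i: "int i < j + 1"
  shows "(\<Sum>cs\<in>blists (j + 1). F (cs ! i) (take i cs @ drop (Suc i) cs)) =
    (\<Sum>ds\<in>blists (j + 1). F (hd ds) (tl ds))"
proof (rule sum.reindex_bij_witness[where j = "\<lambda>cs. cs ! i # take i cs @ drop (Suc i) cs"
      and i = "\<lambda>ds. take i (tl ds) @ hd ds # drop i (tl ds)"])
  fix cs :: "(real^'n) list" assume cs: "cs \<in> blists (j + 1)"
  then have len: "i < length cs" using i by (auto simp: blists_def)
  then have split: "take i cs @ cs ! i # drop (Suc i) cs = cs" by (rule id_take_nth_drop[symmetric])
  show "take i (tl (cs ! i # take i cs @ drop (Suc i) cs)) @
      hd (cs ! i # take i cs @ drop (Suc i) cs) # drop i (tl (cs ! i # take i cs @ drop (Suc i) cs)) = cs"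
    using len split by simp
  have "set (cs ! i # take i cs @ drop (Suc i) cs) = set (take i cs @ cs ! i # drop (Suc i) cs)" by auto
  moreover have "length (cs ! i # take i cs @ drop (Suc i) cs) = length cs" using len by simp
  ultimately show "cs ! i # take i cs @ drop (Suc i) cs \<in> blists (j + 1)"
    using cs unfolding split blists_def by simp
next
  fix ds :: "(real^'n) list" assume ds: "ds \<in> blists (j + 1)"
  then obtain b bs where b: "ds = b # bs" "i \<le> length bs" using i by (cases ds) (auto simp: blists_def)
  let ?cs = "take i (tl ds) @ hd ds # drop i (tl ds)"
  show "?cs ! i # take i ?cs @ drop (Suc i) ?cs = ds"
    using b by (simp add: nth_append)
  have "set ?cs = insert b (set (take i bs @ drop i bs))" using b by (simp del: append_take_drop_id)
  then have "set ?cs = insert b (set bs)" unfolding append_take_drop_id .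
  then show "?cs \<in> blists (j + 1)"
    using ds b by (simp add: blists_def)
qed simp

text \<open>Moving the differentiating argument to the front of \<phi> cancels the sign of its term.
  Each of the \<open>j + 1\<close> positions then contributes the same sum, and this factor turns
  \<open>1 / (j + 1)!\<close> into \<open>1 / j!\<close>.\<close>

lemma alt_inner_classical_ext_deriv:
  assumes j: "j \<ge> 0" and p: "p \<in> smooth_form j" and \<phi>: "alternating (j + 1) \<phi>"
  shows "alt_inner (j + 1) (classical_ext_deriv p x) \<phi> =
    (\<Sum>b\<in>Basis. \<Sum>bs\<in>blists j. dir_deriv b (\<lambda>y. p y bs) x * \<phi> (b # bs)) / fact (nat j)"
proof -
  define F where "F b bs = dir_deriv b (\<lambda>y. p y bs) x * \<phi> (b # bs)" for b bs
  have move: "(- 1) ^ i * \<phi> cs = \<phi> (cs ! i # take i cs @ drop (Suc i) cs)" if "i < length cs" for i cs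
  proof -
    have "\<phi> ([] @ cs ! i # take i cs @ drop (Suc i) cs) = (- 1) ^ i * \<phi> ([] @ take i cs @ cs ! i # drop (Suc i) cs)"
      using alternating_move[OF \<phi>, of "[]" "cs ! i" "take i cs" "drop (Suc i) cs"] that by simp
    then show ?thesis using id_take_nth_drop[OF that] by simp
  qed
  have "(\<Sum>cs\<in>blists (j + 1). classical_ext_deriv p x cs * \<phi> cs) =
      (\<Sum>cs\<in>blists (j + 1). \<Sum>i<nat j + 1. F (cs ! i) (take i cs @ drop (Suc i) cs))"
  proof (rule sum.cong[OF refl])
    fix cs :: "(real^'a) list" assume "cs \<in> blists (j + 1)"
    then have len: "length cs = nat j + 1" using j by (auto simp: blists_def)
    show "classical_ext_deriv p x cs * \<phi> cs = (\<Sum>i<nat j + 1. F (cs ! i) (take i cs @ drop (Suc i) cs))"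
      unfolding classical_ext_deriv_def sum_distrib_right len
    proof (rule sum.cong[OF refl])
      fix i assume "i \<in> {..<nat j + 1}"
      then show "(- 1) ^ i * dir_deriv (cs ! i) (\<lambda>y. p y (take i cs @ drop (Suc i) cs)) x * \<phi> cs =
          F (cs ! i) (take i cs @ drop (Suc i) cs)"
        using move[of i cs] len by (simp add: F_def mult.assoc mult.left_commute)
    qed
  qed
  also have "\<dots> = (\<Sum>i<nat j + 1. \<Sum>cs\<in>blists (j + 1). F (cs ! i) (take i cs @ drop (Suc i) cs))"
    by (rule sum.swap)
  also have "\<dots> = (\<Sum>i<nat j + 1. \<Sum>ds\<in>blists (j + 1). F (hd ds) (tl ds))"
    using j by (intro sum.cong[OF refl] sum_blists_move) auto
  also have "\<dots> = real (nat j + 1) * (\<Sum>b\<in>Basis. \<Sum>bs\<in>blists j. F b bs)"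
    using sum_blists_Cons[OF j, of F] by simp
  finally have "(\<Sum>cs\<in>blists (j + 1). classical_ext_deriv p x cs * \<phi> cs) =
    real (nat j + 1) * (\<Sum>b\<in>Basis. \<Sum>bs\<in>blists j. F b bs)" .
  moreover have "nat (j + 1) = Suc (nat j)" using j by simp
  ultimately show ?thesis by (simp add: alt_inner_eq F_def[symmetric] del: of_nat_Suc)
qed

text \<open>It identifies \<open>classical_ext_deriv p\<close> as a weak derivative of a smooth
  form. With inner products written in coordinates it is the scalar formula for each pair of a
  direction and an index tuple.\<close>

lemma form_integration_by_parts:
  fixes p :: "'n::finite form"
  assumes \<Omega>: "open \<Omega>" and p: "p \<in> smooth_form j" and \<phi>: "\<phi> \<in> test_form \<Omega> (j + 1)"
  shows "form_inner \<Omega> j p (codiff \<phi>) = form_inner \<Omega> (j + 1) (classical_ext_deriv p) \<phi>"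
proof (cases "j \<ge> 0")
  case False
  \<comment> \<open>In negative degree the left side is an empty sum. On the right only the empty
    tuple can occur, for \<open>j = -1\<close>, and there \<open>classical_ext_deriv\<close> is
    itself an empty sum.\<close>
  then have "int m \<noteq> j" "int m = j + 1 \<longleftrightarrow> m = 0 \<and> j = -1" for m by auto
  then have "blists j = ({} :: (real^'n) list set)" "blists (j + 1) \<subseteq> {[] :: (real^'n) list}"
    by (auto simp: blists_def)
  then have "alt_inner j \<alpha> \<beta> = 0" "alt_inner (j + 1) (classical_ext_deriv p x) \<beta> = 0" for \<alpha> \<beta> x
    by (auto simp: alt_inner_eq classical_ext_deriv_def intro!: sum.neutral)
  then show ?thesis by (simp add: form_inner_def)
next
  case True
  have sp: "smooth (\<lambda>x. p x bs)" for bs using p by (rule smooth_formD)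
  have \<phi>s: "\<phi> \<in> smooth_form (j + 1)" using \<phi> by (rule test_form_smooth)
  then have s\<phi>: "smooth (\<lambda>x. \<phi> x bs)" for bs by (rule smooth_formD)
  obtain K where K: "compact K" "K \<subseteq> \<Omega>" and out: "\<And>x bs. x \<notin> K \<Longrightarrow> \<phi> x bs = 0"
    using \<phi> unfolding test_form_def by (auto simp: zero_fun_def)
  have dout: "dir_deriv b (\<lambda>y. \<phi> y bs) x = 0" if "x \<notin> K" for b bs x
    using compact_imp_closed[OF K(1)] out that by (intro dir_deriv_zero_outside[of K])
  define G1 where "G1 x = (\<Sum>b\<in>Basis. \<Sum>bs\<in>blists j. - (p x bs * dir_deriv b (\<lambda>y. \<phi> y (b # bs)) x)) / fact (nat j)" for x
  define G2 where "G2 x = (\<Sum>b\<in>Basis. \<Sum>bs\<in>blists j. dir_deriv b (\<lambda>y. p y bs) x * \<phi> x (b # bs)) / fact (nat j)" for x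
  have G1: "alt_inner j (p x) (codiff \<phi> x) = G1 x" for x
    unfolding alt_inner_eq G1_def codiff_def
    by (subst sum.swap) (simp add: sum_distrib_left sum_negf)
  have G2: "alt_inner (j + 1) (classical_ext_deriv p x) (\<phi> x) = G2 x" for x
    unfolding G2_def using True p smooth_formD(1)[OF \<phi>s] by (rule alt_inner_classical_ext_deriv)
  have i1: "integrable lborel (\<lambda>x. p x bs * dir_deriv b (\<lambda>y. \<phi> y (b # bs)) x)" for b bs
    using dout by (intro compact_support_integrable[OF _ K(1)] smooth_continuous smooth_mult sp smooth_dir_deriv s\<phi>) simp
  have i2: "integrable lborel (\<lambda>x. dir_deriv b (\<lambda>y. p y bs) x * \<phi> x (b # bs))" for b bs
    using out by (intro compact_support_integrable[OF _ K(1)] smooth_continuous smooth_mult sp smooth_dir_deriv s\<phi>) simp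
  have m1: "G1 \<in> borel_measurable borel" and m2: "G2 \<in> borel_measurable borel"
    using i1[THEN borel_measurable_integrable] i2[THEN borel_measurable_integrable]
    unfolding G1_def[abs_def] G2_def[abs_def] by simp_all
  have \<Omega>l: "\<Omega> \<in> sets lebesgue" using \<Omega> by simp
  have G0: "G1 x = 0" "G2 x = 0" if "x \<notin> \<Omega>" for x
  proof -
    have "x \<notin> K" using that K(2) by auto
    then show "G1 x = 0" "G2 x = 0" by (simp_all add: G1_def G2_def dout out)
  qed
  have "form_inner \<Omega> j p (codiff \<phi>) = (\<integral>x. G1 x \<partial>lborel)"
    unfolding form_inner_def G1 by (intro lebesgue_on_integral_eq_lborel[OF \<Omega>l m1] G0)
  also have "\<dots> = (\<Sum>b\<in>Basis. \<Sum>bs\<in>blists j. - (\<integral>x. p x bs * dir_deriv b (\<lambda>y. \<phi> y (b # bs)) x \<partial>lborel)) / fact (nat j)"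
    unfolding G1_def using i1 by simp
  also have "\<dots> = (\<Sum>b\<in>Basis. \<Sum>bs\<in>blists j. (\<integral>x. dir_deriv b (\<lambda>y. p y bs) x * \<phi> x (b # bs) \<partial>lborel)) / fact (nat j)"
    using integral_by_parts_compact[OF sp s\<phi> K(1) out] by simp
  also have "\<dots> = (\<integral>x. G2 x \<partial>lborel)"
    unfolding G2_def using i2 by simp
  also have "\<dots> = form_inner \<Omega> (j + 1) (classical_ext_deriv p) \<phi>"
    unfolding form_inner_def G2 by (intro lebesgue_on_integral_eq_lborel[OF \<Omega>l m2, symmetric] G0)
  finally show ?thesis .
qed

section \<open>Polynomial forms\<close>

lemma smooth_monomial: "smooth (monomial a)"
  unfolding monomial_def
  by (intro smooth_prod smooth_power smooth_bounded_linear bounded_linear_vec_nth)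

lemma span_smooth:
  assumes "\<And>f. f \<in> M \<Longrightarrow> smooth f" "g \<in> span M"
  shows "smooth g"
proof -
  have "subspace {f :: 'a \<Rightarrow> real. smooth f}"
    unfolding subspace_def by (auto simp: fun_ops)
  then have "span M \<subseteq> {f. smooth f}" using assms(1) by (intro span_minimal) auto
  then show ?thesis using assms(2) by auto
qed

lemma poly_form_smooth: "p \<in> poly_form s j \<Longrightarrow> p \<in> smooth_form j"
  unfolding poly_form_def smooth_form_def
  by (auto intro!: span_smooth[where M = "monomial ` _"] smooth_monomial)

lemma dir_deriv_monomial:
  "dir_deriv v (monomial a) = (\<Sum>i\<in>UNIV. (v $ i * real (a i)) *\<^sub>R monomial (a(i := a i - 1)))"
proof
  fix x
  have D: "((\<lambda>x. (x $ i) ^ a i) has_derivative (\<lambda>v. v $ i * (real (a i) * (x $ i) ^ (a i - 1)))) (at x)" for i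
    by (rule has_derivative_eq_rhs[OF has_derivative_power[OF bounded_linear_imp_has_derivative[OF bounded_linear_vec_nth]]])
      (auto simp: mult_ac)
  have "(monomial a has_derivative
      (\<lambda>v. \<Sum>i\<in>UNIV. v $ i * (real (a i) * (x $ i) ^ (a i - 1)) * (\<Prod>l\<in>UNIV - {i}. (x $ l) ^ a l))) (at x)"
    unfolding monomial_def by (rule has_derivative_prod) (rule D)
  then have "dir_deriv v (monomial a) x =
      (\<Sum>i\<in>UNIV. v $ i * (real (a i) * (x $ i) ^ (a i - 1)) * (\<Prod>l\<in>UNIV - {i}. (x $ l) ^ a l))"
    by (rule dir_deriv_eqI)
  also have "\<dots> = (\<Sum>i\<in>UNIV. (v $ i * real (a i)) * monomial (a(i := a i - 1)) x)"
  proof (rule sum.cong[OF refl])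
    fix i
    have "monomial (a(i := a i - 1)) x = (x $ i) ^ (a i - 1) * (\<Prod>l\<in>UNIV - {i}. (x $ l) ^ a l)"
      unfolding monomial_def by (subst prod.remove[of UNIV i]) auto
    then show "v $ i * (real (a i) * (x $ i) ^ (a i - 1)) * (\<Prod>l\<in>UNIV - {i}. (x $ l) ^ a l) =
        (v $ i * real (a i)) * monomial (a(i := a i - 1)) x" by simp
  qed
  also have "\<dots> = (\<Sum>i\<in>UNIV. (v $ i * real (a i)) *\<^sub>R monomial (a(i := a i - 1))) x"
    by (simp add: sum_fun_apply fun_ops)
  finally show "dir_deriv v (monomial a) x = (\<Sum>i\<in>UNIV. (v $ i * real (a i)) *\<^sub>R monomial (a(i := a i - 1))) x" .
qed

abbreviation polys :: "int \<Rightarrow> (real^'n::finite \<Rightarrow> real) set"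
  where "polys s \<equiv> span (monomial ` {a. int (sum a UNIV) \<le> s})"

lemma dir_deriv_polys:
  assumes "f \<in> polys s"
  shows "dir_deriv v f \<in> polys (s - 1)"
proof -
  let ?S = "{f. smooth f \<and> dir_deriv v f \<in> polys (s - 1)}"
  have "subspace ?S"
  proof (rule subspaceI)
    show "0 \<in> ?S" by (simp add: zero_fun_def zero_in_span)
  next
    fix f g assume fg: "f \<in> ?S" "g \<in> ?S"
    have "dir_deriv v (f + g) = dir_deriv v f + dir_deriv v g"
      using fg by (intro ext) (simp add: plus_fun_def dir_deriv_add smooth_differentiable)
    then show "f + g \<in> ?S" using fg by (auto simp: span_add) (auto simp: plus_fun_def)
  next
    fix c f assume f: "f \<in> ?S"
    have "dir_deriv v (c *\<^sub>R f) = c *\<^sub>R dir_deriv v f"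
      using f by (intro ext) (simp add: scaleR_fun_def dir_deriv_cmult smooth_differentiable)
    then show "c *\<^sub>R f \<in> ?S" using f by (auto simp: span_scale) (auto simp: scaleR_fun_def)
  qed
  moreover have "monomial a \<in> ?S" if a: "int (sum a UNIV) \<le> s" for a
  proof -
    \<comment> \<open>For \<open>a i = 0\<close> the truncated subtraction leaves the degree
      unchanged, but then the coefficient is 0.\<close>
    have "(v $ i * real (a i)) *\<^sub>R monomial (a(i := a i - 1)) \<in> polys (s - 1)" for i
    proof (cases "a i = 0")
      case False
      have "sum a UNIV = a i + sum a (UNIV - {i})" by (rule sum.remove) auto
      moreover have "sum (a(i := a i - 1)) UNIV = (a i - 1) + sum a (UNIV - {i})"
        by (subst sum.remove[of UNIV i]) auto
      ultimately have "int (sum (a(i := a i - 1)) UNIV) \<le> s - 1" using False a by linarith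
      then show ?thesis by (intro span_scale span_base) blast
    qed (simp add: span_zero)
    then show ?thesis by (simp add: smooth_monomial dir_deriv_monomial span_sum)
  qed
  ultimately have "polys s \<subseteq> ?S" by (intro span_minimal) auto
  then show ?thesis using assms by auto
qed

lemma classical_ext_deriv_poly_form:
  assumes p: "p \<in> poly_form s j"
  shows "classical_ext_deriv p \<in> poly_form (s - 1) (j + 1)"
  unfolding poly_form_def
proof (intro CollectI conjI allI)
  show "alternating (j + 1) (classical_ext_deriv p x)" for x
    using classical_ext_deriv_smooth_form[OF poly_form_smooth[OF p]] by (rule smooth_formD)
  fix vs
  have "(\<lambda>x. classical_ext_deriv p x vs) =
      (\<Sum>i<length vs. (- 1) ^ i *\<^sub>R dir_deriv (vs ! i) (\<lambda>y. p y (take i vs @ drop (Suc i) vs)))"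
    by (intro ext) (simp add: classical_ext_deriv_def sum_fun_apply scaleR_fun_def)
  also have "\<dots> \<in> polys (s - 1)"
    using p by (intro span_sum span_scale dir_deriv_polys) (simp add: poly_form_def)
  finally show "(\<lambda>x. classical_ext_deriv p x vs) \<in> polys (s - 1)" .
qed

lemma times_coordinate_polys:
  assumes "f \<in> span (monomial ` {a. int (sum a UNIV) = s})"
  shows "(\<lambda>x. x $ i * f x) \<in> polys (s + 1)"
proof -
  let ?S = "{f. (\<lambda>x. x $ i * f x) \<in> polys (s + 1)}"
  have "subspace ?S"
  proof (rule subspaceI)
    show "0 \<in> ?S" by (simp add: zero_fun_def zero_in_span)
  next
    fix f g assume "f \<in> ?S" "g \<in> ?S"
    then show "f + g \<in> ?S" using span_add[of "\<lambda>x. x $ i * f x" _ "\<lambda>x. x $ i * g x"]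
      by (simp add: plus_fun_def distrib_left)
  next
    fix c f assume "f \<in> ?S"
    then show "c *\<^sub>R f \<in> ?S" using span_scale[of "\<lambda>x. x $ i * f x" _ c]
      by (simp add: scaleR_fun_def mult.left_commute)
  qed
  moreover have "monomial a \<in> ?S" if a: "int (sum a UNIV) = s" for a
  proof -
    have *: "(\<lambda>x. x $ i * monomial a x) = monomial (a(i := Suc (a i)))"
      unfolding monomial_def by (intro ext) (subst (1 2) prod.remove[of UNIV i], auto)
    have "sum (a(i := Suc (a i))) UNIV = Suc (sum a UNIV)"
      by (subst (1 2) sum.remove[of UNIV i]) auto
    then have "int (sum (a(i := Suc (a i))) UNIV) \<le> s + 1"
      using a by linarith
    then show ?thesis unfolding mem_Collect_eq * by (blast intro: span_base)
  qed
  ultimately have "span (monomial ` {a. int (sum a UNIV) = s}) \<subseteq> ?S" by (intro span_minimal) auto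
  then show ?thesis using assms by auto
qed

lemma poly_form_mono: "s \<le> s' \<Longrightarrow> poly_form s j \<subseteq> poly_form s' j"
proof -
  assume "s \<le> s'"
  then have "polys s \<subseteq> (polys s' :: (real^'b \<Rightarrow> real) set)" by (intro span_mono image_mono) auto
  then show ?thesis unfolding poly_form_def by blast
qed

lemma subspace_poly_form: "subspace (poly_form s j)"
proof -
  have eq: "poly_form s j = {p. \<forall>x\<in>UNIV. p x \<in> {\<alpha>. alternating j \<alpha>}} \<inter> {p. \<forall>vs. (\<lambda>x. p x vs) \<in> polys s}"
    by (auto simp: poly_form_def)
  have "subspace {p :: 'a form. \<forall>vs. (\<lambda>x. p x vs) \<in> polys s}"
  proof (rule subspaceI)
    show "0 \<in> {p :: 'a form. \<forall>vs. (\<lambda>x. p x vs) \<in> polys s}"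
      by (simp add: zero_fun_def zero_in_span)
  next
    fix p q :: "'a form" assume "p \<in> {p. \<forall>vs. (\<lambda>x. p x vs) \<in> polys s}" "q \<in> {p. \<forall>vs. (\<lambda>x. p x vs) \<in> polys s}"
    then show "p + q \<in> {p. \<forall>vs. (\<lambda>x. p x vs) \<in> polys s}"
      using span_add[of "\<lambda>x. p x _" _ "\<lambda>x. q x _"] by (simp add: plus_fun_def)
  next
    fix c and p :: "'a form" assume "p \<in> {p. \<forall>vs. (\<lambda>x. p x vs) \<in> polys s}"
    then show "c *\<^sub>R p \<in> {p. \<forall>vs. (\<lambda>x. p x vs) \<in> polys s}"
      using span_scale[of "\<lambda>x. p x _" _ c] by (simp add: scaleR_fun_def)
  qed
  then show ?thesis unfolding eq
    by (intro subspace_inter subspace_pointwise subspace_alternating)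
qed

lemma koszul_poly_form:
  assumes q: "q \<in> homogeneous_form s (j + 1)"
  shows "koszul q \<in> poly_form (s + 1) j"
  unfolding poly_form_def
proof (intro CollectI conjI allI)
  have qa: "alternating (j + 1) (q x)" and qs: "(\<lambda>x. q x vs) \<in> span (monomial ` {a. int (sum a UNIV) = s})" for x vs
    using q by (auto simp: homogeneous_form_def)
  fix x
  show "alternating j (koszul q x)"
    unfolding alternating_def koszul_def
  proof (intro conjI allI impI)
    fix vs :: "(real^'a) list" assume "int (length vs) \<noteq> j"
    then show "q x (x # vs) = 0" by (intro alternating_length[OF qa]) simp
  next
    fix us ws :: "(real^'a) list"
    show "linear (\<lambda>v. q x (x # us @ v # ws))"
      using alternating_linear_any[OF qa, of x "x # us" ws] by simp
  next
    fix vs :: "(real^'a) list" assume "\<not> distinct vs"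
    then show "q x (x # vs) = 0" by (intro alternating_distinct[OF qa]) simp
  qed
  fix vs
  have "q x (x # vs) = (\<Sum>i\<in>UNIV. x $ i * q x (axis i 1 # vs))" for x
  proof -
    have lin: "linear (\<lambda>v. q x (v # vs))" using alternating_linear_any[OF qa, of x "[]" vs] by simp
    have "x = (\<Sum>i\<in>UNIV. x $ i *\<^sub>R axis i 1)"
      using basis_expansion[of x] by (simp add: scalar_mult_eq_scaleR)
    then have "q x (x # vs) = q x ((\<Sum>i\<in>UNIV. x $ i *\<^sub>R axis i 1) # vs)" by simp
    also have "\<dots> = (\<Sum>i\<in>UNIV. q x ((x $ i *\<^sub>R axis i 1) # vs))" by (rule linear_sum[OF lin])
    also have "\<dots> = (\<Sum>i\<in>UNIV. x $ i * q x (axis i 1 # vs))" by (simp add: linear_scale[OF lin])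
    finally show ?thesis .
  qed
  then have "(\<lambda>x. koszul q x vs) = (\<Sum>i\<in>UNIV. (\<lambda>x. x $ i * q x (axis i 1 # vs)))"
    by (intro ext) (simp add: koszul_def sum_fun_apply)
  also have "\<dots> \<in> polys (s + 1)" by (intro span_sum times_coordinate_polys qs)
  finally show "(\<lambda>x. koszul q x vs) \<in> polys (s + 1)" .
qed

lemma trimmed_form_poly_form: "trimmed_form s j \<subseteq> poly_form s j"
proof
  fix r :: "'a form" assume "r \<in> trimmed_form s j"
  then obtain p q where r: "r = p + koszul q" and p: "p \<in> poly_form (s - 1) j" and q: "q \<in> homogeneous_form (s - 1) (j + 1)"
    by (auto simp: trimmed_form_def)
  have "p \<in> poly_form s j" using p poly_form_mono[of "s - 1" s j] by auto
  moreover have "koszul q \<in> poly_form s j" using koszul_poly_form[OF q] by simp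
  ultimately show "r \<in> poly_form s j" unfolding r by (rule subspace_add[OF subspace_poly_form])
qed

lemma poly_form_trimmed_form: "poly_form (s - 1) j \<subseteq> trimmed_form s j"
proof
  fix p :: "'a form" assume p: "p \<in> poly_form (s - 1) j"
  have "(0 :: 'a form) \<in> homogeneous_form (s - 1) (j + 1)"
    using subspace_0[OF subspace_alternating] by (auto simp: homogeneous_form_def zero_fun_def zero_in_span)
  moreover have "p = p + koszul 0" by (intro ext) (simp add: koszul_def fun_ops)
  ultimately show "p \<in> trimmed_form s j" using p unfolding trimmed_form_def by blast
qed

text \<open>In the full family the coupling of polynomial and form degree is exactly the degree lost
  by differentiation. A trimmed space lies between the full spaces of degree \<open>s - 1\<close>
  and \<open>s\<close>, so \<open>d\<close> maps it through the full space of degree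
  \<open>s\<close> into the full space of degree \<open>s - 1\<close>, which is contained in the
  next trimmed space.\<close>

lemma local_space_classical_ext_deriv:
  "p \<in> local_space fam k s j \<Longrightarrow> classical_ext_deriv p \<in> local_space fam k s (j + 1)"
proof (cases fam)
  case Full
  assume "p \<in> local_space fam k s j"
  then show ?thesis using classical_ext_deriv_poly_form[of p "int s - (j - int k)" j] Full
    by (simp add: algebra_simps)
next
  case Trimmed
  assume "p \<in> local_space fam k s j"
  then have "p \<in> poly_form (int s) j" using Trimmed trimmed_form_poly_form by auto
  then have "classical_ext_deriv p \<in> poly_form (int s - 1) (j + 1)" by (rule classical_ext_deriv_poly_form)
  then show ?thesis using Trimmed poly_form_trimmed_form by auto
qed

lemma local_space_poly_form: "\<exists>d. local_space fam k s j \<subseteq> poly_form d j"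
  using trimmed_form_poly_form by (cases fam) auto

section \<open>Finite element spaces\<close>

text \<open>Near each boundary point the frontier lies on the graph of \<gamma>, a Lipschitz image
  of the hyperplane orthogonal to \<open>e\<close> and hence a null set. Compactness of the frontier
  leaves finitely many such pieces.\<close>

lemma negligible_frontier_lipschitz:
  fixes \<Omega> :: "(real^'n::finite) set"
  assumes \<Omega>: "open \<Omega>" "bounded \<Omega>" and lip: "piecewise_smooth_lipschitz_boundary \<Omega>"
  shows "negligible (frontier \<Omega>)"
proof -
  have loc: "\<exists>r>0. negligible (frontier \<Omega> \<inter> ball p r)" if p: "p \<in> frontier \<Omega>" for p
  proof -
    obtain r e L and \<gamma> :: "real^'n \<Rightarrow> real" where r: "r > 0" and e: "norm e = 1" and \<gamma>: "L-lipschitz_on UNIV \<gamma>"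
      and epi: "\<forall>x\<in>ball p r. x \<in> \<Omega> \<longleftrightarrow> x \<bullet> e > \<gamma> (x - (x \<bullet> e) *\<^sub>R e)"
      using lip[unfolded piecewise_smooth_lipschitz_boundary_def, rule_format, OF p] by metis
    have c\<gamma>: "continuous_on UNIV \<gamma>" using \<gamma> by (rule lipschitz_on_continuous_on)
    let ?\<Gamma> = "\<lambda>y. y + \<gamma> y *\<^sub>R e"
    have neg: "negligible (?\<Gamma> ` {y. e \<bullet> y = 0})"
    proof (rule negligible_locally_Lipschitz_image)
      show "negligible {y. e \<bullet> y = 0}" using e by (intro negligible_hyperplane) auto
      fix x
      have "norm (?\<Gamma> y - ?\<Gamma> x) \<le> (1 + L) * norm (y - x)" for y
      proof -
        have "?\<Gamma> y - ?\<Gamma> x = (y - x) + (\<gamma> y - \<gamma> x) *\<^sub>R e" by (simp add: algebra_simps)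
        then have "norm (?\<Gamma> y - ?\<Gamma> x) \<le> norm (y - x) + norm ((\<gamma> y - \<gamma> x) *\<^sub>R e)"
          using norm_triangle_ineq by metis
        also have "norm ((\<gamma> y - \<gamma> x) *\<^sub>R e) \<le> L * norm (y - x)"
          using lipschitz_onD[OF \<gamma>, of y x] e by (simp add: dist_norm)
        finally show ?thesis by (simp add: algebra_simps)
      qed
      then show "\<exists>T B. open T \<and> x \<in> T \<and> (\<forall>y\<in>{y. e \<bullet> y = 0} \<inter> T. norm (?\<Gamma> y - ?\<Gamma> x) \<le> B * norm (y - x))"
        by (intro exI[of _ UNIV] exI[of _ "1 + L"]) auto
    qed simp
    have "frontier \<Omega> \<inter> ball p r \<subseteq> ?\<Gamma> ` {y. e \<bullet> y = 0}"
    proof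
      fix x assume x: "x \<in> frontier \<Omega> \<inter> ball p r"
      define y where "y = x - (x \<bullet> e) *\<^sub>R e"
      have "e \<bullet> y = 0" using e by (simp add: y_def inner_diff_right inner_commute norm_eq_1)
      moreover have "x \<bullet> e = \<gamma> y"
      proof (rule antisym)
        have "x \<notin> \<Omega>" using x \<Omega>(1) by (simp add: frontier_def interior_open)
        then show "x \<bullet> e \<le> \<gamma> y" using epi x by (auto simp: y_def)
        show "\<gamma> y \<le> x \<bullet> e"
        proof (rule ccontr)
          assume "\<not> \<gamma> y \<le> x \<bullet> e"
          \<comment> \<open>Points strictly below the graph form an open set disjoint from \<Omega>,
            so they cannot belong to its closure. This is where continuity of \<gamma>
            enters.\<close>
          let ?S = "ball p r \<inter> {z. z \<bullet> e < \<gamma> (z - (z \<bullet> e) *\<^sub>R e)}"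
          have "open {z. z \<bullet> e < \<gamma> (z - (z \<bullet> e) *\<^sub>R e)}"
            by (intro open_Collect_less continuous_intros continuous_on_compose2[OF c\<gamma>]) auto
          then have "open ?S" by auto
          moreover have "?S \<inter> \<Omega> = {}" using epi by force
          ultimately have "?S \<inter> closure \<Omega> = {}" by (simp only: open_Int_closure_eq_empty)
          moreover have "x \<in> closure \<Omega>" using x by (simp add: frontier_def)
          moreover have "x \<in> ?S" using x \<open>\<not> \<gamma> y \<le> x \<bullet> e\<close> by (simp add: y_def)
          ultimately show False by blast
        qed
      qed
      then have "x = ?\<Gamma> y" by (simp add: y_def)
      with \<open>e \<bullet> y = 0\<close> show "x \<in> ?\<Gamma> ` {y. e \<bullet> y = 0}" by blast
    qed
    then show ?thesis using neg negligible_subset r by blast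
  qed
  then obtain r where r: "\<And>p. p \<in> frontier \<Omega> \<Longrightarrow> r p > 0 \<and> negligible (frontier \<Omega> \<inter> ball p (r p))" by metis
  have "compact (frontier \<Omega>)" using \<Omega>(2) by (rule compact_frontier_bounded)
  then obtain D where D: "D \<subseteq> frontier \<Omega>" "finite D" "frontier \<Omega> \<subseteq> (\<Union>p\<in>D. ball p (r p))"
    by (rule compactE_image[of _ "frontier \<Omega>" "\<lambda>p. ball p (r p)"]) (use r in auto)
  have "negligible (\<Union>p\<in>D. frontier \<Omega> \<inter> ball p (r p))" using D r by (intro negligible_Union) auto
  then show ?thesis by (rule negligible_subset) (use D in auto)
qed

lemma L2_coords_subset:
  assumes "S \<subseteq> \<Omega>" "S \<in> sets lebesgue" "\<Omega> \<in> sets lebesgue" "\<omega> \<in> L2_coords \<Omega>"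
  shows "\<omega> \<in> L2_coords S"
  unfolding L2_coords_def
proof (intro CollectI allI conjI)
  fix vs
  have *: "(\<lambda>x. \<omega> x vs) \<in> borel_measurable (lebesgue_on \<Omega>)" "integrable (lebesgue_on \<Omega>) (\<lambda>x. (\<omega> x vs)\<^sup>2)"
    using assms(4) by (auto simp: L2_coords_def)
  then show "(\<lambda>x. \<omega> x vs) \<in> borel_measurable (lebesgue_on S)"
    using measurable_restrict_mono[OF _ assms(1)] by blast
  have "integrable lebesgue (\<lambda>x. indicator \<Omega> x *\<^sub>R (\<omega> x vs)\<^sup>2)"
    using *(2) assms(3) integrable_restrict_space[of \<Omega> lebesgue "\<lambda>x. (\<omega> x vs)\<^sup>2"] by simp
  then have "integrable lebesgue (\<lambda>x. indicator S x *\<^sub>R (indicator \<Omega> x *\<^sub>R (\<omega> x vs)\<^sup>2))"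
    by (rule integrable_mult_indicator[OF assms(2)])
  also have "(\<lambda>x. indicator S x *\<^sub>R (indicator \<Omega> x *\<^sub>R (\<omega> x vs)\<^sup>2)) = (\<lambda>x. indicator S x *\<^sub>R (\<omega> x vs)\<^sup>2)"
    using assms(1) by (intro ext) (auto simp: indicator_def)
  finally show "integrable (lebesgue_on S) (\<lambda>x. (\<omega> x vs)\<^sup>2)"
    using assms(2) integrable_restrict_space[of S lebesgue "\<lambda>x. (\<omega> x vs)\<^sup>2"] by simp
qed

lemma form_inner_restrict:
  assumes "S \<subseteq> \<Omega>" "S \<in> sets lebesgue" "\<Omega> \<in> sets lebesgue" "\<And>x. x \<notin> S \<Longrightarrow> \<phi> x = 0"
  shows "form_inner S j \<omega> \<phi> = form_inner \<Omega> j \<omega> \<phi>"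
proof -
  have "indicator S x *\<^sub>R alt_inner j (\<omega> x) (\<phi> x) = indicator \<Omega> x *\<^sub>R alt_inner j (\<omega> x) (\<phi> x)" for x
    using assms(1) assms(4)[of x] by (auto simp: indicator_def alt_inner_eq zero_fun_def)
  then have "(\<integral>x. indicator S x *\<^sub>R alt_inner j (\<omega> x) (\<phi> x) \<partial>lebesgue) =
      (\<integral>x. indicator \<Omega> x *\<^sub>R alt_inner j (\<omega> x) (\<phi> x) \<partial>lebesgue)" by (simp only:)
  then show ?thesis
    using assms(2,3) unfolding form_inner_def by (simp add: integral_restrict_space)
qed

lemma test_form_outside: "\<lbrakk>\<phi> \<in> test_form S j; x \<notin> S\<rbrakk> \<Longrightarrow> \<phi> x = 0"
  unfolding test_form_def by auto

lemma test_form_mono: "S \<subseteq> S' \<Longrightarrow> test_form S j \<subseteq> test_form S' j"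
  unfolding test_form_def by blast

lemma subspace_local_space: "subspace (local_space fam k s j :: 'n::finite form set)"
proof (cases fam)
  case Full
  then show ?thesis by (simp add: subspace_poly_form)
next
  case Trimmed
  have "subspace (trimmed_form (int s) j :: 'n form set)"
  proof (rule subspaceI)
    show "0 \<in> trimmed_form (int s) j"
      using poly_form_trimmed_form[of "int s" j] subspace_0[OF subspace_poly_form] by auto
  next
    fix x y :: "'n form" assume "x \<in> trimmed_form (int s) j" "y \<in> trimmed_form (int s) j"
    then obtain p q p' q' where x: "x = p + koszul q" "p \<in> poly_form (int s - 1) j" "q \<in> homogeneous_form (int s - 1) (j + 1)"
      and y: "y = p' + koszul q'" "p' \<in> poly_form (int s - 1) j" "q' \<in> homogeneous_form (int s - 1) (j + 1)"
      by (auto simp: trimmed_form_def)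
    have "x + y = (p + p') + koszul (q + q')" using x y by (intro ext) (simp add: koszul_def fun_ops)
    moreover have "p + p' \<in> poly_form (int s - 1) j" using x y by (intro subspace_add[OF subspace_poly_form])
    moreover have "q + q' \<in> homogeneous_form (int s - 1) (j + 1)"
    proof -
      have "alternating (j + 1) ((q + q') x)" for x
        using x y subspace_add[OF subspace_alternating, of "q x" _ "q' x"] by (simp add: homogeneous_form_def plus_fun_def[of q])
      moreover have "(\<lambda>x. (q + q') x vs) \<in> span (monomial ` {a. int (sum a UNIV) = int s - 1})" for vs
        using x y span_add[of "\<lambda>x. q x vs" _ "\<lambda>x. q' x vs"] unfolding homogeneous_form_def plus_fun_def by blast
      ultimately show ?thesis unfolding homogeneous_form_def by blast
    qed
    ultimately show "x + y \<in> trimmed_form (int s) j" unfolding trimmed_form_def by blast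
  next
    fix c and x :: "'n form" assume "x \<in> trimmed_form (int s) j"
    then obtain p q where x: "x = p + koszul q" "p \<in> poly_form (int s - 1) j" "q \<in> homogeneous_form (int s - 1) (j + 1)"
      by (auto simp: trimmed_form_def)
    have "c *\<^sub>R x = c *\<^sub>R p + koszul (c *\<^sub>R q)" using x by (intro ext) (simp add: koszul_def fun_ops algebra_simps)
    moreover have "c *\<^sub>R p \<in> poly_form (int s - 1) j" using x by (intro subspace_scale[OF subspace_poly_form])
    moreover have "c *\<^sub>R q \<in> homogeneous_form (int s - 1) (j + 1)"
    proof -
      have "alternating (j + 1) ((c *\<^sub>R q) x)" for x
        using x subspace_scale[OF subspace_alternating, of "q x" _ c] by (simp add: homogeneous_form_def scaleR_fun_def[of c q])
      moreover have "(\<lambda>x. (c *\<^sub>R q) x vs) \<in> span (monomial ` {a. int (sum a UNIV) = int s - 1})" for vs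
        using x span_scale[of "\<lambda>x. q x vs" _ c] unfolding homogeneous_form_def scaleR_fun_def by blast
      ultimately show ?thesis unfolding homogeneous_form_def by blast
    qed
    ultimately show "c *\<^sub>R x \<in> trimmed_form (int s) j" unfolding trimmed_form_def by blast
  qed
  then show ?thesis using Trimmed by simp
qed

lemma finite_monomial_degrees: "finite {a :: 'n::finite \<Rightarrow> nat. int (sum a UNIV) \<le> d}"
proof -
  have "a x \<le> nat d" if "int (sum a UNIV) \<le> d" for a :: "'n \<Rightarrow> nat" and x
  proof -
    have "a x \<le> sum a UNIV" by (intro member_le_sum) auto
    then show ?thesis using that by linarith
  qed
  then have "{a :: 'n \<Rightarrow> nat. int (sum a UNIV) \<le> d} \<subseteq> {f. \<forall>x. (x \<in> UNIV \<longrightarrow> f x \<in> {..nat d}) \<and> (x \<notin> UNIV \<longrightarrow> f x = 0)}"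
    by auto
  then show ?thesis by (rule finite_subset) (intro finite_set_of_finite_funs, auto)
qed

text \<open>The geometry enters as measure theory: frontiers of convex sets are null sets, so
  together with the null frontier of \<Omega> the simplices are filled by their interiors inside
  \<Omega> up to null sets.\<close>

locale fe_setting = bounded_domain \<Omega> for \<Omega> :: "(real^'n::finite) set" +
  fixes \<T> :: "(real^'n) set set" and fam :: family and k s :: nat
  assumes frontier: "negligible (frontier \<Omega>)"
    and finite_T: "finite \<T>"
    and convex_T: "K \<in> \<T> \<Longrightarrow> convex K" and closed_T: "K \<in> \<T> \<Longrightarrow> closed K"
    and union_T: "\<Union>\<T> = closure \<Omega>"
begin

abbreviation V :: "int \<Rightarrow> 'n form set" where "V j \<equiv> fe_space \<Omega> \<T> fam k s j"

lemma V_H0: "\<omega> \<in> V j \<Longrightarrow> \<omega> \<in> H0_form \<Omega> j"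
  by (simp add: fe_space_def)

lemma V_H: "\<omega> \<in> V j \<Longrightarrow> \<omega> \<in> H_form \<Omega> j"
  by (intro H0_form_H V_H0)

lemma V_L2: "\<omega> \<in> V j \<Longrightarrow> \<omega> \<in> L2_coords \<Omega>"
  by (intro L2_form_coords H_form_L2 V_H)

lemma d_L2: "\<omega> \<in> V j \<Longrightarrow> ext_deriv \<Omega> j \<omega> \<in> L2_coords \<Omega>"
  by (rule L2_form_coords[OF ext_deriv_L2[OF V_H]])

lemma subspace_V: "subspace (V j)"
proof -
  have "subspace {\<omega>. \<forall>K\<in>\<T>. \<exists>p\<in>local_space fam k s j. form_eq K \<omega> p}"
  proof (rule subspaceI)
    show "0 \<in> {\<omega>. \<forall>K\<in>\<T>. \<exists>p\<in>local_space fam k s j. form_eq K \<omega> p}"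
      using subspace_0[OF subspace_local_space] by (intro CollectI ballI bexI[of _ 0]) (simp_all add: form_eq_def)
  next
    fix x y assume x: "x \<in> {\<omega>. \<forall>K\<in>\<T>. \<exists>p\<in>local_space fam k s j. form_eq K \<omega> p}"
      and y: "y \<in> {\<omega>. \<forall>K\<in>\<T>. \<exists>p\<in>local_space fam k s j. form_eq K \<omega> p}"
    have "\<exists>p\<in>local_space fam k s j. form_eq K (x + y) p" if "K \<in> \<T>" for K
    proof -
      have "\<exists>p\<in>local_space fam k s j. form_eq K x p" "\<exists>p\<in>local_space fam k s j. form_eq K y p"
        using x y that by simp_all
      then obtain p q where p: "p \<in> local_space fam k s j" "form_eq K x p"
        and q: "q \<in> local_space fam k s j" "form_eq K y q"
        by (elim bexE)
      have "form_eq K (x + y) (p + q)" using p(2) q(2) unfolding form_eq_def by eventually_elim (simp add: plus_fun_def)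
      then show ?thesis using subspace_add[OF subspace_local_space p(1) q(1)] by (rule bexI)
    qed
    then show "x + y \<in> {\<omega>. \<forall>K\<in>\<T>. \<exists>p\<in>local_space fam k s j. form_eq K \<omega> p}" by simp
  next
    fix c x assume x: "x \<in> {\<omega>. \<forall>K\<in>\<T>. \<exists>p\<in>local_space fam k s j. form_eq K \<omega> p}"
    have "\<exists>p\<in>local_space fam k s j. form_eq K (c *\<^sub>R x) p" if "K \<in> \<T>" for K
    proof -
      have "\<exists>p\<in>local_space fam k s j. form_eq K x p" using x that by simp
      then obtain p where p: "p \<in> local_space fam k s j" "form_eq K x p" by (elim bexE)
      have "form_eq K (c *\<^sub>R x) (c *\<^sub>R p)" using p(2) unfolding form_eq_def by eventually_elim (simp add: scaleR_fun_def)
      then show ?thesis using subspace_scale[OF subspace_local_space p(1)] by (rule bexI)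
    qed
    then show "c *\<^sub>R x \<in> {\<omega>. \<forall>K\<in>\<T>. \<exists>p\<in>local_space fam k s j. form_eq K \<omega> p}" by simp
  qed
  moreover have "V j = H0_form \<Omega> j \<inter> {\<omega>. \<forall>K\<in>\<T>. \<exists>p\<in>local_space fam k s j. form_eq K \<omega> p}"
    by (auto simp: fe_space_def)
  ultimately show ?thesis by (simp add: subspace_inter subspace_H0_form)
qed

text \<open>Against test forms supported inside one simplex, both the weak derivative of \<sigma>
  and the classical derivative of its local polynomial are adjoint to \<open>codiff\<close>; by
  density they agree there almost everywhere. What is left of the simplex is a null set.\<close>

lemma ext_deriv_V:
  assumes \<sigma>: "\<sigma> \<in> V j"
  shows "ext_deriv \<Omega> j \<sigma> \<in> V (j + 1)"
proof -
  let ?d = "ext_deriv \<Omega> j \<sigma>"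
  have "\<exists>q\<in>local_space fam k s (j + 1). form_eq K ?d q" if K: "K \<in> \<T>" for K
  proof -
    obtain p where p: "p \<in> local_space fam k s j" "form_eq K \<sigma> p" using \<sigma> K by (auto simp: fe_space_def)
    have ps: "p \<in> smooth_form j" using p(1) local_space_poly_form[of fam k s j] poly_form_smooth by blast
    define q where "q = classical_ext_deriv p"
    have q: "q \<in> local_space fam k s (j + 1)" "q \<in> smooth_form (j + 1)"
      unfolding q_def using p(1) ps by (auto intro: local_space_classical_ext_deriv classical_ext_deriv_smooth_form)
    \<comment> \<open>A simplex lies in the closure of \<Omega> and its interior might meet the
      frontier, where the weak derivative says nothing; hence the intersection with
      \<Omega>.\<close>
    define O' where "O' = interior K \<inter> \<Omega>"
    interpret O': bounded_domain O'
      by unfold_locales (use bounded open_dom in \<open>auto simp: O'_def intro: bounded_subset\<close>)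
    have sub: "O' \<subseteq> \<Omega>" "O' \<subseteq> K" using interior_subset by (auto simp: O'_def)
    have ml: "O' \<in> sets lebesgue" "\<Omega> \<in> sets lebesgue" "K \<in> sets lebesgue"
      using O'.open_dom open_dom closed_T[OF K] by auto
    have dL: "?d \<in> L2_form \<Omega> (j + 1)" using ext_deriv_L2[OF V_H[OF \<sigma>]] .
    have dO: "?d \<in> L2_form O' (j + 1)"
      using dL L2_coords_subset[OF sub(1) ml(1,2)] sub(1) by (auto simp: L2_form_eq)
    have qO: "q \<in> L2_form O' (j + 1)"
      using O'.smooth_L2[OF q(2)] q(2) by (auto simp: L2_form_eq smooth_formD)
    have \<sigma>O: "\<sigma> \<in> L2_coords O'" using L2_coords_subset[OF sub(1) ml(1,2)] V_L2[OF \<sigma>] .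
    have pO: "p \<in> L2_coords O'" using O'.smooth_L2[OF ps] .
    have "AE x in lebesgue. x \<in> K \<longrightarrow> \<sigma> x = p x"
      using p(2) ml(3) by (simp add: form_eq_def AE_restrict_space_iff)
    then have "form_eq O' \<sigma> p"
      unfolding form_eq_def using ml(1) sub(2) by (subst AE_restrict_space_iff) (auto elim: eventually_mono)
    then have \<sigma>p: "form_inner O' j (\<sigma> - p) (\<sigma> - p) = 0" by (rule form_eq_imp_null)
    have "AE x in lebesgue_on O'. (?d - q) x = 0"
    proof (rule test_forms_dense[OF O'.bounded O'.open_dom])
      show "?d - q \<in> L2_form O' (j + 1)" using dO qO by (intro subspace_diff[OF subspace_L2_form])
      fix \<phi> :: "'n form" assume \<phi>: "\<phi> \<in> test_form O' (j + 1)"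
      have \<phi>\<Omega>: "\<phi> \<in> test_form \<Omega> (j + 1)" using \<phi> test_form_mono[OF sub(1)] by blast
      have c\<phi>: "codiff \<phi> \<in> test_form O' j" using \<phi> by (rule codiff_test_form)
      have \<phi>L: "\<phi> \<in> L2_coords O'" "codiff \<phi> \<in> L2_coords O'"
        using O'.smooth_L2 test_form_smooth \<phi> c\<phi> by blast+
      have "form_inner O' (j + 1) ?d \<phi> = form_inner \<Omega> (j + 1) ?d \<phi>"
        using sub(1) ml(1,2) test_form_outside[OF \<phi>] by (rule form_inner_restrict)
      also have "\<dots> = form_inner \<Omega> j \<sigma> (codiff \<phi>)"
        using ext_deriv_weak[OF V_H[OF \<sigma>]] \<phi>\<Omega> unfolding weak_ext_deriv_def by blast
      also have "\<dots> = form_inner O' j \<sigma> (codiff \<phi>)"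
        using sub(1) ml(1,2) test_form_outside[OF c\<phi>] by (rule form_inner_restrict[symmetric])
      also have "\<dots> = form_inner O' j p (codiff \<phi>)"
        using \<sigma>O pO \<phi>L(2) \<sigma>p by (rule L2.cong_left)
      also have "\<dots> = form_inner O' (j + 1) q \<phi>"
        unfolding q_def using O'.open_dom ps \<phi> by (rule form_integration_by_parts)
      finally show "form_inner O' (j + 1) (?d - q) \<phi> = 0"
        using L2_form_coords[OF dO] L2_form_coords[OF qO] \<phi>L(1) by (simp add: L2.diff_left)
    qed
    then have 1: "AE x in lebesgue. x \<in> O' \<longrightarrow> (?d - q) x = 0"
      using ml(1) by (simp add: AE_restrict_space_iff)
    have "K - O' \<subseteq> frontier K \<union> frontier \<Omega>"
      using K union_T closed_T[OF K] open_dom by (auto simp: O'_def frontier_def interior_open)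
    moreover have "negligible (frontier K \<union> frontier \<Omega>)"
      using frontier negligible_convex_frontier[OF convex_T[OF K]] by (simp add: negligible_Un)
    ultimately have "negligible (K - O')" using negligible_subset by blast
    then have "AE x in lebesgue. x \<notin> K - O'"
      by (intro AE_not_in) (simp add: negligible_iff_null_sets)
    with 1 have "AE x in lebesgue. x \<in> K \<longrightarrow> ?d x = q x"
      by eventually_elim (simp only: fun_diff_def[of ?d] right_minus_eq, blast)
    then have "form_eq K ?d q" using ml(3) by (simp add: form_eq_def AE_restrict_space_iff)
    then show ?thesis using q(1) by blast
  qed
  then show ?thesis using ext_deriv_H0[OF V_H0[OF \<sigma>]] by (simp add: fe_space_def)
qed

text \<open>Grouping the points by the set of all simplices containing them gives a partition without
  using that distinct simplices overlap in null sets only.\<close>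

definition cell :: "(real^'n) set set \<Rightarrow> (real^'n) set"
  where "cell \<S> = {x. {K\<in>\<T>. x \<in> K} = \<S>}"

text \<open>One scalar function in a single coordinate on a single cell. Finitely many of these span
  all piecewise polynomials of bounded degree in the coordinates that the pairing reads.\<close>

definition cell_form :: "(real^'n) set set \<Rightarrow> (real^'n) list \<Rightarrow> (real^'n \<Rightarrow> real) \<Rightarrow> 'n form"
  where "cell_form \<S> bs f = (\<lambda>x vs. if x \<in> cell \<S> \<and> vs = bs then f x else 0)"

lemma cell_measurable: "\<S> \<subseteq> \<T> \<Longrightarrow> cell \<S> \<in> sets borel"
proof -
  assume S: "\<S> \<subseteq> \<T>"
  have eq: "cell \<S> = (\<Inter>K\<in>\<T>. if K \<in> \<S> then K else - K)"
    unfolding cell_def using S by (auto split: if_splits)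
  show ?thesis
  proof (cases "\<T> = {}")
    case False
    then show ?thesis unfolding eq
      using finite_T closed_T by (intro sets.finite_INT) (auto intro: borel_closed)
  next
    case True
    then show ?thesis unfolding eq by simp
  qed
qed

lemma cell_form_L2:
  assumes "\<S> \<subseteq> \<T>" "continuous_on UNIV f"
  shows "cell_form \<S> bs f \<in> L2_coords \<Omega>"
proof -
  have f: "(\<lambda>x vs. f x) \<in> L2_coords \<Omega>"
    using assms(2) by (intro continuous_L2_coords[OF bounded open_dom])
  have c: "cell \<S> \<in> sets lebesgue" using cell_measurable[OF assms(1)] by simp
  then have c': "cell \<S> \<inter> \<Omega> \<in> sets (lebesgue_on \<Omega>)"
    using open_dom by (auto simp: sets_restrict_space)
  have "(\<lambda>x. if x \<in> cell \<S> \<and> vs = bs then f x else 0) \<in> borel_measurable (lebesgue_on \<Omega>) \<and>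
      integrable (lebesgue_on \<Omega>) (\<lambda>x. (if x \<in> cell \<S> \<and> vs = bs then f x else 0)\<^sup>2)" for vs
  proof -
    have eq: "(if x \<in> cell \<S> \<and> vs = bs then f x else 0) = indicator (cell \<S> \<inter> \<Omega>) x *\<^sub>R ((if vs = bs then 1 else 0) * f x)"
      if "x \<in> space (lebesgue_on \<Omega>)" for x using that by (auto simp: indicator_def)
    have eq2: "(if x \<in> cell \<S> \<and> vs = bs then f x else 0)\<^sup>2 = indicator (cell \<S> \<inter> \<Omega>) x *\<^sub>R ((if vs = bs then 1 else 0) * (f x)\<^sup>2)"
      if "x \<in> space (lebesgue_on \<Omega>)" for x using that by (auto simp: indicator_def)
    have "(\<lambda>x. indicator (cell \<S> \<inter> \<Omega>) x *\<^sub>R ((if vs = bs then 1 else 0) * f x)) \<in> borel_measurable (lebesgue_on \<Omega>)"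
      using f c' by (intro borel_measurable_scaleR borel_measurable_indicator borel_measurable_times) (auto simp: L2_coords_def)
    moreover have "integrable (lebesgue_on \<Omega>) (\<lambda>x. indicator (cell \<S> \<inter> \<Omega>) x *\<^sub>R ((if vs = bs then 1 else 0) * (f x)\<^sup>2))"
      using f c' by (intro integrable_mult_indicator integrable_mult_right) (auto simp: L2_coords_def)
    ultimately show ?thesis
      by (intro conjI measurable_cong[THEN iffD2, OF eq] Bochner_Integration.integrable_cong[THEN iffD2, OF refl eq2])
  qed
  then show ?thesis by (simp add: L2_coords_def cell_form_def)
qed

text \<open>It supplies the finite set that \<open>Riesz_finite\<close> asks for. The space itself
  need not be finite-dimensional, since its elements may be altered on null sets.\<close>

lemma V_finite_dimensional:
  "\<exists>E. finite E \<and> E \<subseteq> L2_coords \<Omega> \<and> (\<forall>v\<in>V j. \<exists>e\<in>span E. form_inner \<Omega> j (v - e) (v - e) = 0)"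
proof -
  obtain d where d: "local_space fam k s j \<subseteq> (poly_form d j :: 'n form set)" using local_space_poly_form by blast
  define M where "M = monomial ` {a :: 'n \<Rightarrow> nat. int (sum a UNIV) \<le> d}"
  define E where "E = (\<Union>\<S>\<in>Pow \<T>. \<Union>bs\<in>blists j. cell_form \<S> bs ` M)"
  have "finite E" unfolding E_def M_def using finite_T finite_monomial_degrees by auto
  moreover have EL: "E \<subseteq> L2_coords \<Omega>"
    unfolding E_def M_def using smooth_monomial by (auto intro!: cell_form_L2 smooth_continuous)
  moreover have "\<exists>e\<in>span E. form_inner \<Omega> j (v - e) (v - e) = 0" if v: "v \<in> V j" for v
  proof -
    have "\<forall>K\<in>\<T>. \<exists>p. p \<in> local_space fam k s j \<and> form_eq K v p" using v by (auto simp: fe_space_def)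
    from bchoice[OF this] obtain p where p: "\<And>K. K \<in> \<T> \<Longrightarrow> p K \<in> local_space fam k s j" "\<And>K. K \<in> \<T> \<Longrightarrow> form_eq K v (p K)"
      by blast
    define \<kappa> where "\<kappa> \<S> = (SOME K. K \<in> \<S>)" for \<S> :: "(real^'n) set set"
    have \<kappa>: "\<kappa> \<S> \<in> \<S>" if "\<S> \<noteq> {}" for \<S> unfolding \<kappa>_def using that by (simp add: some_in_eq)
    define e where "e = (\<Sum>\<S>\<in>Pow \<T> - {{}}. \<Sum>bs\<in>blists j. cell_form \<S> bs (\<lambda>x. p (\<kappa> \<S>) x bs))"
    have lin: "linear (cell_form \<S> bs)" for \<S> bs
      by (rule linearI) (auto simp: cell_form_def fun_ops intro!: ext)
    have "cell_form \<S> bs (\<lambda>x. p (\<kappa> \<S>) x bs) \<in> span E" if \<S>: "\<S> \<in> Pow \<T> - {{}}" "bs \<in> blists j" for \<S> bs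
    proof -
      have "\<kappa> \<S> \<in> \<T>" using \<S> \<kappa> by blast
      then have "(\<lambda>x. p (\<kappa> \<S>) x bs) \<in> span M"
        using p(1) d unfolding poly_form_def M_def by blast
      then have "cell_form \<S> bs (\<lambda>x. p (\<kappa> \<S>) x bs) \<in> span (cell_form \<S> bs ` M)"
        unfolding span_linear_image[OF lin] by blast
      moreover have "cell_form \<S> bs ` M \<subseteq> E" unfolding E_def using \<S> by blast
      ultimately show ?thesis using span_mono by blast
    qed
    then have eE: "e \<in> span E" unfolding e_def by (intro span_sum)
    have "span E \<subseteq> L2_coords \<Omega>" using EL subspace_L2_coords by (intro span_minimal)
    then have veL: "v - e \<in> L2_coords \<Omega>" using eE V_L2[OF v] by blast
    have "AE x in lebesgue. x \<in> K \<longrightarrow> v x = p K x" if "K \<in> \<T>" for K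
      using p(2)[OF that] closed_T[OF that] by (simp add: form_eq_def AE_restrict_space_iff)
    then have "AE x in lebesgue. \<forall>K\<in>\<T>. x \<in> K \<longrightarrow> v x = p K x"
      using finite_T by (intro AE_finite_allI) auto
    then have "AE x in lebesgue_on \<Omega>. \<forall>K\<in>\<T>. x \<in> K \<longrightarrow> v x = p K x"
      using open_dom by (subst AE_restrict_space_iff) (auto elim: eventually_mono)
    moreover have "AE x in lebesgue_on \<Omega>. x \<in> \<Omega>" by (rule AE_I2) simp
    ultimately have "AE x in lebesgue_on \<Omega>. \<forall>bs\<in>blists j. (v - e) x bs = 0"
    proof eventually_elim
      case (elim x)
      define \<S> where "\<S> = {K\<in>\<T>. x \<in> K}"
      have \<S>: "\<S> \<in> Pow \<T> - {{}}" using elim(2) union_T closure_subset[of \<Omega>] by (auto simp: \<S>_def)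
      show ?case
      proof
        fix bs :: "(real^'n) list" assume bs: "bs \<in> blists j"
        have "e x bs = (\<Sum>\<S>'\<in>Pow \<T> - {{}}. \<Sum>cs\<in>blists j. cell_form \<S>' cs (\<lambda>x. p (\<kappa> \<S>') x cs) x bs)"
          by (simp add: e_def sum_fun_apply)
        also have "\<dots> = (\<Sum>\<S>'\<in>Pow \<T> - {{}}. if \<S>' = \<S> then p (\<kappa> \<S>) x bs else 0)"
        proof (rule sum.cong[OF refl])
          fix \<S>' 
          have "(\<Sum>cs\<in>blists j. cell_form \<S>' cs (\<lambda>x. p (\<kappa> \<S>') x cs) x bs) =
              (\<Sum>cs\<in>blists j. if cs = bs then (if \<S>' = \<S> then p (\<kappa> \<S>) x bs else 0) else 0)"
            by (intro sum.cong refl) (auto simp: cell_form_def cell_def \<S>_def)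
          then show "(\<Sum>cs\<in>blists j. cell_form \<S>' cs (\<lambda>x. p (\<kappa> \<S>') x cs) x bs) =
              (if \<S>' = \<S> then p (\<kappa> \<S>) x bs else 0)" using bs by simp
        qed
        also have "\<dots> = p (\<kappa> \<S>) x bs" using \<S> finite_T by simp
        also have "\<dots> = v x bs" using elim(1) \<kappa>[of \<S>] \<S> by (auto simp: \<S>_def)
        finally show "(v - e) x bs = 0" by (simp add: fun_diff_def)
      qed
    qed
    then have "form_inner \<Omega> j (v - e) (v - e) = 0" using form_null_iff[OF veL] by simp
    then show ?thesis using eE by blast
  qed
  ultimately show ?thesis by blast
qed

section \<open>The discrete coderivative and the operator \<open>A\<close>\<close>

lemma V_closed: "\<lbrakk>x \<in> V j; y \<in> V j\<rbrakk> \<Longrightarrow> x + y \<in> V j" "x \<in> V j \<Longrightarrow> c *\<^sub>R x \<in> V j" "x \<in> V j \<Longrightarrow> - x \<in> V j"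
  using subspace_V[of j] by (auto simp: subspace_add subspace_scale subspace_neg)

text \<open>It validates the choice in the definition: the Riesz representative of the functional
  \<open>?l\<close> has the required property.\<close>

lemma discrete_coderiv:
  assumes \<omega>: "\<omega> \<in> L2_coords \<Omega>"
  shows "discrete_coderiv \<Omega> \<T> fam k s j \<omega> \<in> V (j - 1)"
    and "v \<in> V (j - 1) \<Longrightarrow>
      form_inner \<Omega> (j - 1) (discrete_coderiv \<Omega> \<T> fam k s j \<omega>) v = form_inner \<Omega> j \<omega> (ext_deriv \<Omega> (j - 1) v)"
proof -
  let ?l = "\<lambda>v. form_inner \<Omega> j \<omega> (ext_deriv \<Omega> (j - 1) v)"
  have lin: "?l (v + c *\<^sub>R w) = ?l v + c * ?l w" if "v \<in> V (j - 1)" "w \<in> V (j - 1)" for v w c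
    using inner_ext_deriv_add_scale[OF V_H[OF that(1)] V_H[OF that(2)] \<omega>] by (simp add: L2.sym[of \<Omega> j \<omega>])
  have zero: "weak_ext_deriv \<Omega> (j - 1) 0 0"
    unfolding weak_ext_deriv_def
    using subspace_0[OF subspace_L2_form[of \<Omega> "j - 1 + 1"]] L2.zero_left smooth_L2 codiff_L2 test_form_smooth
    by metis
  obtain E where E: "finite E" "E \<subseteq> L2_coords \<Omega>"
    "\<And>v. v \<in> V (j - 1) \<Longrightarrow> \<exists>e\<in>span E. form_inner \<Omega> (j - 1) (v - e) (v - e) = 0"
    using V_finite_dimensional by metis
  have "\<exists>u\<in>V (j - 1). \<forall>v\<in>V (j - 1). form_inner \<Omega> (j - 1) u v = ?l v"
  proof (rule L2.Riesz_finite[OF subspace_V _ E(1,2)])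
    show "V (j - 1) \<subseteq> L2_coords \<Omega>" using V_L2 by blast
    show "\<exists>e\<in>span E. form_inner \<Omega> (j - 1) (v - e) (v - e) = 0" if "v \<in> V (j - 1)" for v
      using that by (rule E(3))
    show "?l (v + w) = ?l v + ?l w" if "v \<in> V (j - 1)" "w \<in> V (j - 1)" for v w
      using lin[OF that, of 1] by simp
    show "?l (c *\<^sub>R v) = c * ?l v" if "v \<in> V (j - 1)" for c v
      using lin[OF that that, of "c - 1"] by (simp add: scaleR_left_diff_distrib algebra_simps)
    \<comment> \<open>The functional must be insensitive to null forms: a null \<open>v\<close> has
      a null exterior derivative, because 0 is a weak derivative of 0.\<close>
    fix v assume v: "v \<in> V (j - 1)" "form_inner \<Omega> (j - 1) v v = 0"
    have "form_inner \<Omega> (j - 1 + 1) (ext_deriv \<Omega> (j - 1) v - 0) (ext_deriv \<Omega> (j - 1) v - 0) = 0"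
      using v by (intro ext_deriv_null[OF V_H zero]) auto
    then show "?l v = 0" using d_L2[OF v(1)] \<omega> L2.null_right[of "ext_deriv \<Omega> (j - 1) v" \<Omega> \<omega> j] by simp
  qed
  then have "\<exists>u. u \<in> V (j - 1) \<and> (\<forall>v\<in>V (j - 1). form_inner \<Omega> (j - 1) u v = ?l v)" by blast
  from someI_ex[OF this, folded discrete_coderiv_def]
  show "discrete_coderiv \<Omega> \<T> fam k s j \<omega> \<in> V (j - 1)"
    and "v \<in> V (j - 1) \<Longrightarrow>
      form_inner \<Omega> (j - 1) (discrete_coderiv \<Omega> \<T> fam k s j \<omega>) v = form_inner \<Omega> j \<omega> (ext_deriv \<Omega> (j - 1) v)"
    by blast+
qed

abbreviation W :: "'n triple set" where "W \<equiv> fe_triple \<Omega> \<T> fam k s"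
abbreviation A :: "'n triple \<Rightarrow> 'n triple" where "A \<equiv> A_h \<Omega> \<T> fam k s"

lemma W_L2: "W \<subseteq> L2_coords3 \<Omega>"
  unfolding fe_triple_def using V_L2 by auto

lemma subspace_W: "subspace W"
  unfolding fe_triple_def by (intro subspace_Times subspace_V)

lemma A_W: "X \<in> W \<Longrightarrow> A X \<in> W"
proof -
  assume "X \<in> W"
  then obtain \<sigma> \<mu> \<omega> where X: "X = (\<sigma>, \<mu>, \<omega>)" "\<sigma> \<in> V (int k - 1)" "\<mu> \<in> V (int k)" "\<omega> \<in> V (int k + 1)"
    by (auto simp: fe_triple_def)
  then show ?thesis
    using ext_deriv_V[of \<sigma> "int k - 1"] ext_deriv_V[of \<mu> "int k"]
      discrete_coderiv(1)[OF V_L2[OF X(3)], of "int k"] discrete_coderiv(1)[OF V_L2[OF X(4)], of "int k + 1"]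
    by (auto simp: fe_triple_def intro!: V_closed)
qed

text \<open>On the finite element spaces \<open>d\<close> and the discrete coderivative are adjoint,
  and opposite off-diagonal blocks of \<open>A\<close> carry opposite signs. Membership of both
  triples in \<open>W\<close> matters, since the adjointness holds only for discrete test
  forms.\<close>

lemma A_skew:
  assumes "X \<in> W" "Y \<in> W"
  shows "triple_inner \<Omega> k (A X) Y = - triple_inner \<Omega> k X (A Y)"
proof -
  obtain \<sigma> \<mu> \<omega> where X: "X = (\<sigma>, \<mu>, \<omega>)" "\<sigma> \<in> V (int k - 1)" "\<mu> \<in> V (int k)" "\<omega> \<in> V (int k + 1)"
    using assms(1) by (auto simp: fe_triple_def)
  obtain a b c where Y: "Y = (a, b, c)" "a \<in> V (int k - 1)" "b \<in> V (int k)" "c \<in> V (int k + 1)"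
    using assms(2) by (auto simp: fe_triple_def)
  note L = X(2-4)[THEN V_L2] Y(2-4)[THEN V_L2] X(2-4)[THEN d_L2] Y(2-4)[THEN d_L2]
  note \<delta> = discrete_coderiv(1)[THEN V_L2, OF L(2), of "int k"] discrete_coderiv(1)[THEN V_L2, OF L(3), of "int k + 1"]
    discrete_coderiv(1)[THEN V_L2, OF L(5), of "int k"] discrete_coderiv(1)[THEN V_L2, OF L(6), of "int k + 1"]
  have 1: "form_inner \<Omega> (int k - 1) (discrete_coderiv \<Omega> \<T> fam k s (int k) \<mu>) a = form_inner \<Omega> (int k) \<mu> (ext_deriv \<Omega> (int k - 1) a)"
    using discrete_coderiv(2)[OF L(2), of a "int k"] Y(2) by simp
  have 2: "form_inner \<Omega> (int k) (discrete_coderiv \<Omega> \<T> fam k s (int k + 1) \<omega>) b = form_inner \<Omega> (int k + 1) \<omega> (ext_deriv \<Omega> (int k) b)"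
    using discrete_coderiv(2)[OF L(3), of b "int k + 1"] Y(3) by simp
  have 3: "form_inner \<Omega> (int k - 1) \<sigma> (discrete_coderiv \<Omega> \<T> fam k s (int k) b) = form_inner \<Omega> (int k) (ext_deriv \<Omega> (int k - 1) \<sigma>) b"
    using discrete_coderiv(2)[OF L(5), of \<sigma> "int k"] X(2) by (simp add: L2.sym[of \<Omega> _ b] L2.sym[of \<Omega> _ \<sigma>])
  have 4: "form_inner \<Omega> (int k) \<mu> (discrete_coderiv \<Omega> \<T> fam k s (int k + 1) c) = form_inner \<Omega> (int k + 1) (ext_deriv \<Omega> (int k) \<mu>) c"
    using discrete_coderiv(2)[OF L(6), of \<mu> "int k + 1"] X(3) by (simp add: L2.sym[of \<Omega> _ c] L2.sym[of \<Omega> _ \<mu>])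
  show ?thesis
    using L \<delta> by (simp add: X(1) Y(1) L2.add_left L2.add_right L2.minus_left L2.minus_right 1 2 3 4)
qed

end

section \<open>Functions of time\<close>

text \<open>This is completeness of Lebesgue measure, transferred to a subset by extending the
  functions by 0.\<close>

lemma AE_eq_measurable_lebesgue_on:
  fixes f g :: "'a::euclidean_space \<Rightarrow> real"
  assumes S: "S \<in> sets lebesgue" and f: "f \<in> borel_measurable (lebesgue_on S)"
    and ae: "AE x in lebesgue_on S. f x = g x"
  shows "g \<in> borel_measurable (lebesgue_on S)"
proof -
  have "(\<lambda>x. if x \<in> S then f x else 0) \<in> borel_measurable lebesgue"
    using f by (simp add: borel_measurable_if[OF S])
  moreover have "AE x in lebesgue. x \<in> S \<longrightarrow> f x = g x" using ae S by (simp add: AE_restrict_space_iff)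
  then have "AE x in lebesgue. (if x \<in> S then f x else 0) = (if x \<in> S then g x else 0)"
    by eventually_elim simp
  ultimately have "(\<lambda>x. if x \<in> S then g x else 0) \<in> borel_measurable lebesgue"
    by (rule borel_measurable_AE)
  then show ?thesis by (simp add: borel_measurable_if[OF S])
qed

lemma AE_lim_measurable_lebesgue_on:
  fixes f :: "'a::euclidean_space \<Rightarrow> real"
  assumes S: "S \<in> sets lebesgue" and u: "\<And>m. u m \<in> borel_measurable (lebesgue_on S)"
    and lim: "AE x in lebesgue_on S. (\<lambda>m. u m x) \<longlonglongrightarrow> f x"
  shows "f \<in> borel_measurable (lebesgue_on S)"
proof (rule AE_eq_measurable_lebesgue_on[OF S])
  show "(\<lambda>x. lim (\<lambda>m. u m x)) \<in> borel_measurable (lebesgue_on S)"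
    using u by (rule borel_measurable_lim_metric)
  show "AE x in lebesgue_on S. lim (\<lambda>m. u m x) = f x"
    using lim by eventually_elim (rule limI)
qed

lemma AE_interval_endpoints:
  "(AE t in lebesgue_on {a..b::real}. P t) \<longleftrightarrow> (AE t in lebesgue_on {a<..<b}. P t)"
proof -
  have ne: "AE t in lebesgue. t \<noteq> a \<and> t \<noteq> b"
    using AE_lborel_singleton[of a] AE_lborel_singleton[of b] by (intro AE_completion) auto
  have "(AE t in lebesgue. t \<in> {a..b} \<longrightarrow> P t) \<longleftrightarrow> (AE t in lebesgue. t \<in> {a<..<b} \<longrightarrow> P t)"
  proof
    assume "AE t in lebesgue. t \<in> {a..b} \<longrightarrow> P t"
    then show "AE t in lebesgue. t \<in> {a<..<b} \<longrightarrow> P t" by eventually_elim auto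
  next
    assume "AE t in lebesgue. t \<in> {a<..<b} \<longrightarrow> P t"
    with ne show "AE t in lebesgue. t \<in> {a..b} \<longrightarrow> P t" by eventually_elim auto
  qed
  then show ?thesis by (simp add: AE_restrict_space_iff)
qed

lemma integral_interval_endpoints:
  fixes q :: "real \<Rightarrow> real"
  shows "(\<integral>t. q t \<partial>lebesgue_on {a..b}) = (\<integral>t. q t \<partial>lebesgue_on {a<..<b})"
proof -
  let ?f = "\<lambda>t. indicator {a..b} t *\<^sub>R q t" and ?g = "\<lambda>t. indicator {a<..<b} t *\<^sub>R q t"
  have "AE t in lebesgue. t \<noteq> a \<and> t \<noteq> b"
    using AE_lborel_singleton[of a] AE_lborel_singleton[of b] by (intro AE_completion) auto
  then have ae: "AE t in lebesgue. ?f t = ?g t"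
    by eventually_elim (auto simp: indicator_def)
  then have ae': "AE t in lebesgue. ?g t = ?f t" by eventually_elim (rule sym)
  have "integral\<^sup>L lebesgue ?f = integral\<^sup>L lebesgue ?g"
  proof (cases "?f \<in> borel_measurable lebesgue")
    case True
    then have "?g \<in> borel_measurable lebesgue" using ae by (rule borel_measurable_AE)
    with True show ?thesis using ae by (rule integral_cong_AE)
  next
    \<comment> \<open>If one integrand is not measurable, neither is the other, and both integrals
      have the default value 0. The identity therefore holds for arbitrary \<open>q\<close>.\<close>
    case False
    then have "?g \<notin> borel_measurable lebesgue" using borel_measurable_AE[OF _ ae'] by blast
    with False have ni: "\<not> integrable lebesgue ?f" "\<not> integrable lebesgue ?g"
      using borel_measurable_integrable by blast+
    show ?thesis unfolding not_integrable_integral_eq[OF ni(1)] not_integrable_integral_eq[OF ni(2)] ..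
  qed
  then show ?thesis by (simp add: integral_restrict_space)
qed

section \<open>Bochner integrals tested against a fixed form\<close>

lemma simple_L2_range: "\<lbrakk>simple_L2 M \<Omega> j u; t \<in> space M\<rbrakk> \<Longrightarrow> u t \<in> L2_coords \<Omega>"
  unfolding simple_L2_def by (blast intro: L2_form_coords)

lemma simple_L2_inner_measurable:
  "simple_L2 M \<Omega> j u \<Longrightarrow> (\<lambda>t. form_inner \<Omega> j (u t) v) \<in> borel_measurable M"
  unfolding simple_L2_def
  by (intro borel_measurable_simple_function simple_function_compose1[where g = "\<lambda>\<omega>. form_inner \<Omega> j \<omega> v"]) auto

text \<open>Pairing with \<open>v\<close> is continuous in the form norm, so the scalar function is
  an almost everywhere limit of simple ones; completeness handles the exceptional set.\<close>

lemma strongly_measurable_inner: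
  assumes h: "strongly_measurable (lebesgue_on S) \<Omega> j h" and S: "S \<in> sets lebesgue"
    and hL: "\<And>t. t \<in> S \<Longrightarrow> h t \<in> L2_coords \<Omega>" and v: "v \<in> L2_coords \<Omega>"
  shows "(\<lambda>t. form_inner \<Omega> j (h t) v) \<in> borel_measurable (lebesgue_on S)"
proof -
  obtain u where u: "\<And>m. simple_L2 (lebesgue_on S) \<Omega> j (u m)"
    and lim: "AE t in lebesgue_on S. (\<lambda>m. form_norm \<Omega> j (u m t - h t)) \<longlonglongrightarrow> 0"
    using h by (auto simp: strongly_measurable_def)
  show ?thesis
  proof (rule AE_lim_measurable_lebesgue_on[OF S simple_L2_inner_measurable[OF u]])
    have "AE t in lebesgue_on S. t \<in> S" by (rule AE_I2) simp
    with lim show "AE t in lebesgue_on S. (\<lambda>m. form_inner \<Omega> j (u m t) v) \<longlonglongrightarrow> form_inner \<Omega> j (h t) v"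
    proof eventually_elim
      case (elim t)
      have le: "\<bar>form_inner \<Omega> j (u m t) v - form_inner \<Omega> j (h t) v\<bar> \<le> form_norm \<Omega> j (u m t - h t) * form_norm \<Omega> j v" for m
        using L2.abs_le[of "u m t - h t" \<Omega> v j] simple_L2_range[OF u, of t m] hL[OF elim(2)] v elim(2)
        by (simp add: L2.diff_left form_norm_def)
      show ?case
      proof (rule LIM_zero_cancel, rule Lim_null_comparison[OF always_eventually], rule allI)
        show "(\<lambda>m. form_norm \<Omega> j (u m t - h t) * form_norm \<Omega> j v) \<longlonglongrightarrow> 0"
          by (rule tendsto_mult_left_zero[OF elim(1)])
        show "norm (form_inner \<Omega> j (u m t) v - form_inner \<Omega> j (h t) v) \<le> form_norm \<Omega> j (u m t - h t) * form_norm \<Omega> j v" for m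
          unfolding real_norm_def by (rule le)
      qed
    qed
  qed
qed

lemma simple_L2_integral_inner:
  assumes M: "finite_measure M" and u: "simple_L2 M \<Omega> j u" and v: "v \<in> L2_coords \<Omega>"
  shows "simple_L2_integral M u \<in> L2_coords \<Omega>"
    and "integrable M (\<lambda>t. form_inner \<Omega> j (u t) v)"
    and "form_inner \<Omega> j (simple_L2_integral M u) v = (\<integral>t. form_inner \<Omega> j (u t) v \<partial>M)"
proof -
  interpret finite_measure M by fact
  have sf: "simple_function M u" using u by (simp add: simple_L2_def)
  have fin: "finite (u ` space M)" using sf by (rule simple_functionD)
  have R: "\<omega> \<in> L2_coords \<Omega>" if "\<omega> \<in> u ` space M" for \<omega> using that simple_L2_range[OF u] by auto
  show "simple_L2_integral M u \<in> L2_coords \<Omega>"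
    unfolding simple_L2_integral_def using R by (intro L2.L_sum L2.L_closed)
  have sets: "{t \<in> space M. u t = \<omega>} \<in> sets M" for \<omega>
  proof -
    have "{t \<in> space M. u t = \<omega>} = u -` {\<omega>} \<inter> space M" by auto
    then show ?thesis using simple_functionD(2)[OF sf, of "{\<omega>}"] by simp
  qed
  have eq: "form_inner \<Omega> j (u t) v =
      (\<Sum>\<omega>\<in>u ` space M. indicator {t \<in> space M. u t = \<omega>} t * form_inner \<Omega> j \<omega> v)" if "t \<in> space M" for t
  proof -
    have "(\<Sum>\<omega>\<in>u ` space M. indicator {t \<in> space M. u t = \<omega>} t * form_inner \<Omega> j \<omega> v) =
        (\<Sum>\<omega>\<in>u ` space M. if \<omega> = u t then form_inner \<Omega> j (u t) v else 0)"
      using that by (intro sum.cong refl) (auto simp: indicator_def)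
    also have "\<dots> = form_inner \<Omega> j (u t) v" using that fin by simp
    finally show ?thesis by simp
  qed
  have ef: "emeasure M A < \<infinity>" for A
    using emeasure_finite[of A] unfolding infinity_ennreal_def top.not_eq_extremum .
  have ind: "integrable M (\<lambda>t. indicator {t \<in> space M. u t = \<omega>} t * c)" for \<omega> and c :: real
    by (intro integrable_mult_left integrable_real_indicator sets ef)
  show "integrable M (\<lambda>t. form_inner \<Omega> j (u t) v)"
    by (subst Bochner_Integration.integrable_cong[OF refl eq]) (auto intro: ind)
  have "(\<integral>t. form_inner \<Omega> j (u t) v \<partial>M) =
      (\<integral>t. (\<Sum>\<omega>\<in>u ` space M. indicator {t \<in> space M. u t = \<omega>} t * form_inner \<Omega> j \<omega> v) \<partial>M)"
    using eq by (intro Bochner_Integration.integral_cong) auto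
  also have "\<dots> = (\<Sum>\<omega>\<in>u ` space M. (\<integral>t. indicator {t \<in> space M. u t = \<omega>} t * form_inner \<Omega> j \<omega> v \<partial>M))"
    using ind by (intro Bochner_Integration.integral_sum)
  also have "\<dots> = (\<Sum>\<omega>\<in>u ` space M. measure M {t \<in> space M. u t = \<omega>} * form_inner \<Omega> j \<omega> v)"
    using sets by (intro sum.cong refl) (simp add: sets.sets_into_space Int_absorb2)
  also have "\<dots> = form_inner \<Omega> j (simple_L2_integral M u) v"
    unfolding simple_L2_integral_def using R v by (subst L2.sum_left) (auto simp: L2.scale_left)
  finally show "form_inner \<Omega> j (simple_L2_integral M u) v = (\<integral>t. form_inner \<Omega> j (u t) v \<partial>M)" by simp
qed

text \<open>For \<open>form_norm \<Omega> j v \<le> 1\<close> the pairing is dominated directly by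
  the integrand that \<open>has_L2_integral\<close> makes small, with no factor to be taken out of
  the nonnegative integral. General \<open>v\<close> follows by scaling.\<close>

lemma has_L2_integral_inner_unit:
  assumes M: "finite_measure M" and I: "has_L2_integral M \<Omega> j h I"
    and hL: "\<And>t. t \<in> space M \<Longrightarrow> h t \<in> L2_coords \<Omega>" and v: "v \<in> L2_coords \<Omega>" "form_norm \<Omega> j v \<le> 1"
    and int: "integrable M (\<lambda>t. form_inner \<Omega> j (h t) v)"
  shows "form_inner \<Omega> j I v = (\<integral>t. form_inner \<Omega> j (h t) v \<partial>M)"
proof -
  obtain u where u: "\<And>m. simple_L2 M \<Omega> j (u m)"
    and lim1: "(\<lambda>m. \<integral>\<^sup>+t. ennreal (form_norm \<Omega> j (h t - u m t)) \<partial>M) \<longlonglongrightarrow> 0"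
    and lim2: "(\<lambda>m. form_norm \<Omega> j (simple_L2_integral M (u m) - I)) \<longlonglongrightarrow> 0"
    using I by (auto simp: has_L2_integral_def)
  have IL: "I \<in> L2_coords \<Omega>" using I by (auto simp: has_L2_integral_def intro: L2_form_coords)
  have le: "\<bar>form_inner \<Omega> j \<omega> v\<bar> \<le> form_norm \<Omega> j \<omega>" if "\<omega> \<in> L2_coords \<Omega>" for \<omega>
    using L2.abs_le[OF that v(1), of j] mult_left_mono[OF v(2), of "form_norm \<Omega> j \<omega>"] that
    by (simp add: form_norm_def L2.nonneg)
  note s = simple_L2_integral_inner[OF M u v(1)]
  let ?a = "\<lambda>m. form_inner \<Omega> j (simple_L2_integral M (u m)) v"
  have "?a \<longlonglongrightarrow> form_inner \<Omega> j I v"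
  proof (rule LIM_zero_cancel, rule Lim_null_comparison[OF always_eventually lim2], rule allI)
    fix m
    show "norm (?a m - form_inner \<Omega> j I v) \<le> form_norm \<Omega> j (simple_L2_integral M (u m) - I)"
      using le[of "simple_L2_integral M (u m) - I"] s(1) IL v(1) by (simp add: L2.diff_left)
  qed
  moreover have "?a \<longlonglongrightarrow> (\<integral>t. form_inner \<Omega> j (h t) v \<partial>M)"
  proof -
    have "ennreal (norm (?a m - (\<integral>t. form_inner \<Omega> j (h t) v \<partial>M))) \<le> (\<integral>\<^sup>+t. ennreal (form_norm \<Omega> j (h t - u m t)) \<partial>M)" for m
    proof -
      have "?a m - (\<integral>t. form_inner \<Omega> j (h t) v \<partial>M) = (\<integral>t. form_inner \<Omega> j (u m t) v - form_inner \<Omega> j (h t) v \<partial>M)"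
        using s(2,3) int by simp
      then have "ennreal (norm (?a m - (\<integral>t. form_inner \<Omega> j (h t) v \<partial>M))) \<le>
          (\<integral>\<^sup>+t. ennreal (norm (form_inner \<Omega> j (u m t) v - form_inner \<Omega> j (h t) v)) \<partial>M)"
        using s(2) int by (simp only:) (intro integral_norm_bound_ennreal Bochner_Integration.integrable_diff)
      also have "\<dots> \<le> (\<integral>\<^sup>+t. ennreal (form_norm \<Omega> j (h t - u m t)) \<partial>M)"
      proof (intro nn_integral_mono ennreal_leI)
        fix t assume t: "t \<in> space M"
        show "norm (form_inner \<Omega> j (u m t) v - form_inner \<Omega> j (h t) v) \<le> form_norm \<Omega> j (h t - u m t)"
          using le[of "h t - u m t"] hL[OF t] simple_L2_range[OF u t] v(1)
          by (simp add: L2.diff_left abs_minus_commute)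
      qed
      finally show ?thesis .
    qed
    then have "(\<lambda>m. ennreal (norm (?a m - (\<integral>t. form_inner \<Omega> j (h t) v \<partial>M)))) \<longlonglongrightarrow> 0"
      by (intro tendsto_sandwich[OF _ _ tendsto_const lim1]) auto
    then have "(\<lambda>m. norm (?a m - (\<integral>t. form_inner \<Omega> j (h t) v \<partial>M))) \<longlonglongrightarrow> 0"
      by (subst (asm) tendsto_ennreal_iff[of _ _ 0, simplified]) auto
    then show ?thesis by (rule LIM_zero_cancel[OF tendsto_norm_zero_cancel])
  qed
  ultimately show ?thesis by (rule LIMSEQ_unique)
qed

lemma has_L2_integral_inner:
  assumes M: "finite_measure M" and I: "has_L2_integral M \<Omega> j h I"
    and hL: "\<And>t. t \<in> space M \<Longrightarrow> h t \<in> L2_coords \<Omega>" and v: "v \<in> L2_coords \<Omega>"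
    and int: "integrable M (\<lambda>t. form_inner \<Omega> j (h t) v)"
  shows "form_inner \<Omega> j I v = (\<integral>t. form_inner \<Omega> j (h t) v \<partial>M)"
proof -
  \<comment> \<open>The summand 1 keeps the denominator positive when \<open>v\<close> is
    null.\<close>
  define c where "c = 1 / (form_norm \<Omega> j v + 1)"
  have n: "0 \<le> form_norm \<Omega> j v" using v by (simp add: form_norm_def L2.nonneg)
  then have c: "c > 0" by (simp add: c_def)
  have IL: "I \<in> L2_coords \<Omega>" using I by (auto simp: has_L2_integral_def intro: L2_form_coords)
  have eq: "form_inner \<Omega> j (h t) (c *\<^sub>R v) = c * form_inner \<Omega> j (h t) v" if "t \<in> space M" for t
    using hL[OF that] v by (rule L2.scale_right[rotated])
  have "form_inner \<Omega> j I (c *\<^sub>R v) = (\<integral>t. form_inner \<Omega> j (h t) (c *\<^sub>R v) \<partial>M)"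
  proof (rule has_L2_integral_inner_unit[OF M I hL])
    show "form_norm \<Omega> j (c *\<^sub>R v) \<le> 1"
      using L2.N_scale[OF v, of j c] c n by (simp add: form_norm_def c_def)
    show "integrable M (\<lambda>t. form_inner \<Omega> j (h t) (c *\<^sub>R v))"
      using int by (subst Bochner_Integration.integrable_cong[OF refl eq]) auto
  qed (use v in auto)
  also have "\<dots> = (\<integral>t. c * form_inner \<Omega> j (h t) v \<partial>M)"
    using eq by (intro Bochner_Integration.integral_cong) auto
  finally show ?thesis using L2.scale_right[OF v IL, of j c] c by simp
qed

lemma Bochner_L1_inner:
  assumes f: "f \<in> Bochner_L1 T \<Omega> j" and v: "v \<in> L2_coords \<Omega>"
  shows "integrable (lebesgue_on {0<..<T}) (\<lambda>t. form_inner \<Omega> j (f t) v)"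
proof (rule Bochner_Integration.integrable_bound)
  have fL: "f t \<in> L2_coords \<Omega>" if "t \<in> {0<..<T}" for t
    using f that by (auto simp: Bochner_L1_def intro: L2_form_coords)
  show "integrable (lebesgue_on {0<..<T}) (\<lambda>t. form_norm \<Omega> j (f t) * form_norm \<Omega> j v)"
    using f by (simp add: Bochner_L1_def)
  show "(\<lambda>t. form_inner \<Omega> j (f t) v) \<in> borel_measurable (lebesgue_on {0<..<T})"
    using f v fL by (intro strongly_measurable_inner) (auto simp: Bochner_L1_def)
  show "AE t in lebesgue_on {0<..<T}. norm (form_inner \<Omega> j (f t) v) \<le> norm (form_norm \<Omega> j (f t) * form_norm \<Omega> j v)"
  proof (rule AE_I2)
    fix t assume "t \<in> space (lebesgue_on {0<..<T})"
    then have "f t \<in> L2_coords \<Omega>" using fL by simp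
    from L2.abs_le[OF this v, of j]
    show "norm (form_inner \<Omega> j (f t) v) \<le> norm (form_norm \<Omega> j (f t) * form_norm \<Omega> j v)"
      by (simp add: form_norm_def)
  qed
qed

lemma integrable_bounded_times:
  fixes \<phi> h :: "'a \<Rightarrow> real"
  assumes "integrable M h" "\<phi> \<in> borel_measurable M" "\<And>t. t \<in> space M \<Longrightarrow> \<bar>\<phi> t\<bar> \<le> C"
  shows "integrable M (\<lambda>t. \<phi> t * h t)"
proof (rule Bochner_Integration.integrable_bound)
  show "integrable M (\<lambda>t. C * h t)" using assms(1) by simp
  show "(\<lambda>t. \<phi> t * h t) \<in> borel_measurable M" using assms by simp
  show "AE t in M. norm (\<phi> t * h t) \<le> norm (C * h t)"
  proof (rule AE_I2)
    fix t assume "t \<in> space M"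
    then have "\<bar>\<phi> t\<bar> \<le> \<bar>C\<bar>" using assms(3)[of t] by linarith
    then show "norm (\<phi> t * h t) \<le> norm (C * h t)" by (simp add: abs_mult mult_right_mono)
  qed
qed

lemma compact_support_bounded:
  fixes \<phi> :: "real \<Rightarrow> real"
  assumes "continuous_on UNIV \<phi>" "compact K" "\<And>t. t \<notin> K \<Longrightarrow> \<phi> t = 0"
  shows "\<exists>C. \<forall>t. \<bar>\<phi> t\<bar> \<le> C"
proof -
  have "bounded (\<phi> ` K)"
    using assms by (intro compact_imp_bounded compact_continuous_image) (auto intro: continuous_on_subset)
  then obtain C where "\<forall>t\<in>K. \<bar>\<phi> t\<bar> \<le> C" by (auto simp: bounded_iff)
  then have "\<bar>\<phi> t\<bar> \<le> max C 0" for t using assms(3)[of t] by (cases "t \<in> K") (auto simp: max_def)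
  then show ?thesis by blast
qed

lemma smooth_has_real_derivative:
  "smooth \<phi> \<Longrightarrow> (\<phi> has_real_derivative dir_deriv 1 \<phi> t) (at t)"
  using smooth_line_deriv[of \<phi> 0 1 t] by simp

lemma deriv_eq_dir_deriv: "smooth \<phi> \<Longrightarrow> deriv \<phi> = dir_deriv 1 \<phi>"
  by (intro ext DERIV_imp_deriv smooth_has_real_derivative)

text \<open>It turns the Bochner-valued definition of the weak time derivative into a scalar
  integration by parts, the only form in which it is used later.\<close>

lemma weak_time_deriv_inner:
  assumes g: "has_weak_time_deriv T \<Omega> j f g" and f: "f \<in> Bochner_L1 T \<Omega> j" and v: "v \<in> L2_coords \<Omega>"
    and \<phi>: "smooth \<phi>" "compact K" "K \<subseteq> {0<..<T}" "\<And>t. t \<notin> K \<Longrightarrow> \<phi> t = 0"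
  shows "(\<integral>t. \<phi> t * form_inner \<Omega> j (g t) v \<partial>lebesgue_on {0<..<T}) =
    - (\<integral>t. deriv \<phi> t * form_inner \<Omega> j (f t) v \<partial>lebesgue_on {0<..<T})"
proof -
  let ?M = "lebesgue_on {0<..<T}"
  have M: "finite_measure ?M" by (intro bounded_open_finite_measure) auto
  have gB: "g \<in> Bochner_L1 T \<Omega> j" using g by (simp add: has_weak_time_deriv_def)
  have fL: "f t \<in> L2_coords \<Omega>" and gL: "g t \<in> L2_coords \<Omega>" if "t \<in> space ?M" for t
    using f gB that by (auto simp: Bochner_L1_def intro: L2_form_coords)
  have sd: "smooth (deriv \<phi>)" using \<phi>(1) by (simp add: deriv_eq_dir_deriv smooth_dir_deriv)
  have dout: "deriv \<phi> t = 0" if "t \<notin> K" for t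
    unfolding deriv_eq_dir_deriv[OF \<phi>(1)] using compact_imp_closed[OF \<phi>(2)] \<phi>(4) that by (rule dir_deriv_zero_outside)
  have meas: "\<psi> \<in> borel_measurable ?M" if "smooth \<psi>" for \<psi> :: "real \<Rightarrow> real"
    using that by (intro continuous_imp_measurable_on_sets_lebesgue smooth_continuous) auto
  have int: "integrable ?M (\<lambda>t. \<psi> t * form_inner \<Omega> j (w t) v)"
    if \<psi>: "smooth \<psi>" "\<And>t. t \<notin> K \<Longrightarrow> \<psi> t = 0" and w: "w \<in> Bochner_L1 T \<Omega> j" for \<psi> w
  proof -
    obtain C where "\<forall>t. \<bar>\<psi> t\<bar> \<le> C"
      using compact_support_bounded[OF smooth_continuous[OF \<psi>(1)] \<phi>(2) \<psi>(2)] by blast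
    then show ?thesis using meas[OF \<psi>(1)] Bochner_L1_inner[OF w v] by (intro integrable_bounded_times) auto
  qed
  obtain I where I: "has_L2_integral ?M \<Omega> j (\<lambda>t. deriv \<phi> t *\<^sub>R f t) I"
    "has_L2_integral ?M \<Omega> j (\<lambda>t. \<phi> t *\<^sub>R g t) (- I)"
    using g \<phi> unfolding has_weak_time_deriv_def by blast
  have IL: "I \<in> L2_coords \<Omega>" using I(1) by (auto simp: has_L2_integral_def intro: L2_form_coords)
  have eqf: "form_inner \<Omega> j (deriv \<phi> t *\<^sub>R f t) v = deriv \<phi> t * form_inner \<Omega> j (f t) v" if "t \<in> space ?M" for t
    using fL[OF that] v by (rule L2.scale_left)
  have eqg: "form_inner \<Omega> j (\<phi> t *\<^sub>R g t) v = \<phi> t * form_inner \<Omega> j (g t) v" if "t \<in> space ?M" for t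
    using gL[OF that] v by (rule L2.scale_left)
  have "form_inner \<Omega> j I v = (\<integral>t. form_inner \<Omega> j (deriv \<phi> t *\<^sub>R f t) v \<partial>?M)"
    using fL by (intro has_L2_integral_inner[OF M I(1) _ v] L2.L_closed
        Bochner_Integration.integrable_cong[OF refl eqf, THEN iffD2, OF _ int[OF sd dout f]]) 
  also have "\<dots> = (\<integral>t. deriv \<phi> t * form_inner \<Omega> j (f t) v \<partial>?M)"
    using eqf by (rule Bochner_Integration.integral_cong[OF refl])
  finally have 1: "form_inner \<Omega> j I v = (\<integral>t. deriv \<phi> t * form_inner \<Omega> j (f t) v \<partial>?M)" .
  have "form_inner \<Omega> j (- I) v = (\<integral>t. form_inner \<Omega> j (\<phi> t *\<^sub>R g t) v \<partial>?M)"
    using gL by (intro has_L2_integral_inner[OF M I(2) _ v] L2.L_closed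
        Bochner_Integration.integrable_cong[OF refl eqg, THEN iffD2, OF _ int[OF \<phi>(1,4) gB]])
  also have "\<dots> = (\<integral>t. \<phi> t * form_inner \<Omega> j (g t) v \<partial>?M)"
    using eqg by (rule Bochner_Integration.integral_cong[OF refl])
  finally show ?thesis using 1 IL v by (simp add: L2.minus_left)
qed

section \<open>Hat functions as limits of test functions\<close>

lemma antiderivative_vanishing_left:
  fixes f :: "real \<Rightarrow> real"
  assumes f: "continuous_on UNIV f" and 0: "\<And>t. t \<le> a \<Longrightarrow> f t = 0"
  shows "\<exists>\<Phi>. (\<forall>t. (\<Phi> has_real_derivative f t) (at t)) \<and> (\<forall>t\<le>a. \<Phi> t = 0)"
proof (intro exI conjI allI impI)
  \<comment> \<open>Starting at \<open>a - 1\<close> makes every point from \<open>a\<close> on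
    interior to the interval of integration, so two-sided derivatives exist there.\<close>
  let ?\<Phi> = "\<lambda>t. integral {a - 1..t} f"
  show z: "?\<Phi> t = 0" if "t \<le> a" for t
    using that 0 by (intro integral_unique has_integral_is_0) auto
  show "(?\<Phi> has_real_derivative f t) (at t)" for t
  proof (cases "t < a")
    case True
    have "((\<lambda>t. 0) has_real_derivative 0) (at t)" by simp
    then have "(?\<Phi> has_real_derivative 0) (at t)"
      by (rule has_field_derivative_transform_within_open[of _ _ _ "{..<a}"]) (use True z in auto)
    then show ?thesis using True 0 by simp
  next
    case False
    have "(?\<Phi> has_real_derivative f t) (at t within {a - 1..t + 1})"
      using False f by (intro integral_has_real_derivative) (auto intro: continuous_on_subset)
    moreover have "at t within {a - 1..t + 1} = at t"
      using False by (intro at_within_interior) auto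
    ultimately show ?thesis by simp
  qed
qed

text \<open>Smooth approximations of the hat function with peak \<open>a + d\<close>, obtained as the difference
  quotient with step \<open>d\<close> of an antiderivative of \<open>bump n a (a + d)\<close>.\<close>

lemma smooth_hat:
  assumes d: "d > 0" and aT: "0 \<le> a" "a + 2 * d \<le> T"
  shows "\<exists>\<phi> K. smooth \<phi> \<and> compact K \<and> K \<subseteq> {0<..<T} \<and> (\<forall>t. t \<notin> K \<longrightarrow> \<phi> t = 0) \<and>
    (\<forall>t. deriv \<phi> t = (bump n a (a + d) t - bump n (a + d) (a + 2 * d) t) / d) \<and>
    (\<forall>t. 0 \<le> \<phi> t \<and> \<phi> t \<le> max 0 (1 - \<bar>t - (a + d)\<bar> / d))"
proof -
  let ?b = "bump n a (a + d)"
  have cont: "continuous_on UNIV ?b" by (intro smooth_continuous smooth_bump)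
  have sup: "n > 0 \<and> a + 1 / real n \<le> t \<and> t \<le> a + d - 1 / real n" if "?b t \<noteq> 0" for t
    using bump_support(1,2)[OF that] by (auto simp: mem_box)
  have sup0: "?b t = 0" if "t < a + 1 / real n \<or> a + d - 1 / real n < t" for t
    using sup[of t] that by (meson not_le)
  have 0: "?b t = 0" if "t \<le> a" for t
  proof (rule ccontr)
    assume "?b t \<noteq> 0"
    from sup[OF this] that show False by (smt (verit) divide_pos_pos of_nat_0_less_iff)
  qed
  obtain \<Phi> where \<Phi>: "\<And>t. (\<Phi> has_real_derivative ?b t) (at t)" and \<Phi>0: "\<And>t. t \<le> a \<Longrightarrow> \<Phi> t = 0"
    using antiderivative_vanishing_left[OF cont 0] by blast
  \<comment> \<open>Since the derivative of \<Phi> lies between 0 and 1, \<Phi> is increasing and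
    grows at most as fast as the identity.\<close>
  have mono: "\<Phi> x \<le> \<Phi> y" "\<Phi> y - \<Phi> x \<le> y - x" if "x \<le> y" for x y
  proof -
    show "\<Phi> x \<le> \<Phi> y"
      using that by (rule DERIV_nonneg_imp_nondecreasing) (use \<Phi> bump_nonneg in blast)
    have "(\<lambda>t. t - \<Phi> t) x \<le> (\<lambda>t. t - \<Phi> t) y"
      using that
    proof (rule DERIV_nonneg_imp_nondecreasing)
      fix t
      have "((\<lambda>t. t - \<Phi> t) has_real_derivative 1 - ?b t) (at t)"
        by (intro derivative_intros \<Phi>)
      then show "\<exists>z. ((\<lambda>t. t - \<Phi> t) has_real_derivative z) (at t) \<and> 0 \<le> z"
        using bump_le_1[of n a "a + d" t] by (intro exI[of _ "1 - ?b t"]) simp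
    qed
    then show "\<Phi> y - \<Phi> x \<le> y - x" by simp
  qed
  have const: "\<Phi> x = \<Phi> y" if "x \<le> y" "\<And>t. x \<le> t \<Longrightarrow> t \<le> y \<Longrightarrow> ?b t = 0" for x y
  proof (rule antisym)
    show "\<Phi> x \<le> \<Phi> y" using mono(1)[OF that(1)] .
    show "\<Phi> y \<le> \<Phi> x"
      using that(1)
    proof (rule DERIV_nonpos_imp_nonincreasing)
      fix t assume "x \<le> t" "t \<le> y"
      then show "\<exists>z. (\<Phi> has_real_derivative z) (at t) \<and> z \<le> 0"
        using \<Phi>[of t] that(2)[of t] by (intro exI[of _ "?b t"]) simp
    qed
  qed
  define \<phi> where "\<phi> t = (\<Phi> t - \<Phi> (t - d)) / d" for t
  have shift: "bump n a (a + d) (t - d) = bump n (a + d) (a + 2 * d) t" for t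
    by (simp add: bump_def algebra_simps)
  have D\<phi>: "(\<phi> has_real_derivative (bump n a (a + d) t - bump n (a + d) (a + 2 * d) t) / d) (at t)" for t
  proof -
    have "((\<lambda>t. \<Phi> (t - d)) has_real_derivative ?b (t - d)) (at t)"
      using \<Phi>[of "t - d"] DERIV_shift[of \<Phi> "?b (t - d)" t "- d"] by simp
    then show ?thesis unfolding \<phi>_def shift[symmetric] by (intro DERIV_cdivide DERIV_diff \<Phi>)
  qed
  have "smooth \<phi>"
  proof (rule smooth_step)
    show "\<phi> differentiable (at t)" for t
      using D\<phi> real_differentiable_def by blast
    have "dir_deriv v \<phi> = (\<lambda>t. (v / d) * (bump n a (a + d) t - bump n (a + d) (a + 2 * d) t))" for v
      using D\<phi> by (intro ext) (subst dir_deriv_eqI[OF D\<phi>[unfolded has_field_derivative_def]], simp)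
    then show "smooth (dir_deriv v \<phi>)" for v
      by (simp only:) (intro smooth_mult smooth_diff smooth_bump smooth_const)
  qed
  \<comment> \<open>For \<open>n = 0\<close> the bump vanishes but \<open>1 / real n\<close> is 0,
    and the interval could reach the endpoints 0 and \<open>T\<close>; hence the case
    distinction.\<close>
  moreover define K where "K = (if n = 0 then {} else {a + 1 / real n..a + 2 * d - 1 / real n})"
  have "compact K" by (simp add: K_def)
  moreover have "K \<subseteq> {0<..<T}"
  proof (cases "n = 0")
    case False
    then have e: "1 / real n > 0" by simp
    show ?thesis
    proof
      fix x assume "x \<in> K"
      then have "a + 1 / real n \<le> x" "x \<le> a + 2 * d - 1 / real n" using False by (simp_all add: K_def)
      then show "x \<in> {0<..<T}" using e aT unfolding greaterThanLessThan_iff by linarith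
    qed
  qed (simp add: K_def)
  moreover have "\<forall>t. t \<notin> K \<longrightarrow> \<phi> t = 0"
  proof (intro allI impI)
    fix t assume t: "t \<notin> K"
    show "\<phi> t = 0"
    proof (cases "n = 0")
      case True
      then have "?b x = 0" for x using sup by blast
      then have "\<Phi> (t - d) = \<Phi> t" using d by (intro const) auto
      then show ?thesis by (simp add: \<phi>_def)
    next
      case False
      then have "t < a + 1 / real n \<or> t > a + 2 * d - 1 / real n" using t by (auto simp: K_def)
      then show ?thesis
      proof
        assume *: "t < a + 1 / real n"
        have "\<Phi> (min a (t - d)) = \<Phi> t"
        proof (rule const)
          fix x assume "x \<le> t"
          then show "?b x = 0" using * d by (intro sup0) linarith
        qed (use d in auto)
        moreover have "\<Phi> (min a (t - d)) = \<Phi> (t - d)"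
        proof (rule const)
          fix x assume "x \<le> t - d"
          then show "?b x = 0" using * d by (intro sup0) linarith
        qed auto
        ultimately show ?thesis by (simp add: \<phi>_def)
      next
        assume *: "t > a + 2 * d - 1 / real n"
        have "\<Phi> (t - d) = \<Phi> t"
        proof (rule const)
          fix x assume "t - d \<le> x"
          then show "?b x = 0" using * d by (intro sup0) linarith
        qed (use d in auto)
        then show ?thesis by (simp add: \<phi>_def)
      qed
    qed
  qed
  moreover have "\<forall>t. deriv \<phi> t = (bump n a (a + d) t - bump n (a + d) (a + 2 * d) t) / d"
    using D\<phi> by (intro allI DERIV_imp_deriv)
  moreover have "0 \<le> \<phi> t \<and> \<phi> t \<le> max 0 (1 - \<bar>t - (a + d)\<bar> / d)" for t
  proof
    show "0 \<le> \<phi> t" using mono(1)[of "t - d" t] d by (simp add: \<phi>_def)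
    have right: "\<Phi> x = \<Phi> (a + d)" if x: "x \<ge> a + d" for x
    proof (rule const[symmetric, OF x])
      fix y assume "a + d \<le> y"
      show "?b y = 0"
      proof (rule ccontr)
        assume "?b y \<noteq> 0"
        from sup[OF this] \<open>a + d \<le> y\<close> show False by (smt (verit) divide_pos_pos of_nat_0_less_iff)
      qed
    qed
    \<comment> \<open>The increment is at most the length of the overlap of
      \<open>[t - d, t]\<close> with \<open>[a, a + d]\<close>, outside which \<Phi> is constant; as
      a function of \<open>t\<close> this overlap is the hat scaled by \<open>d\<close>.\<close>
    have "\<Phi> t - \<Phi> (t - d) \<le> max 0 (d - \<bar>t - (a + d)\<bar>)"
    proof (cases "t \<le> a + d")
      case True
      have l: "\<Phi> (t - d) = 0" using True by (intro \<Phi>0) simp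
      show ?thesis
      proof (cases "t \<le> a")
        case True
        then show ?thesis using l \<Phi>0[of t] by simp
      next
        case False
        then show ?thesis using l True mono(2)[of a t] \<Phi>0[of a] by simp
      qed
    next
      case False
      then have r: "\<Phi> t = \<Phi> (a + d)" by (intro right) simp
      show ?thesis
      proof (cases "t - d \<le> a + d")
        case True
        then show ?thesis using False r mono(2)[of "t - d" "a + d"] by simp
      next
        case f: False
        then show ?thesis using r right[of "t - d"] by simp
      qed
    qed
    then have "\<phi> t \<le> max 0 (d - \<bar>t - (a + d)\<bar>) / d" using d by (simp add: \<phi>_def divide_right_mono)
    also have "\<dots> = max 0 (1 - \<bar>t - (a + d)\<bar> / d)"
      using d by (simp add: max_def field_simps)
    finally show "\<phi> t \<le> max 0 (1 - \<bar>t - (a + d)\<bar> / d)" .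
  qed
  ultimately show ?thesis by blast
qed

text \<open>The smooth hats stay below the exact hat, so the right-hand bound is uniform in
  \<open>n\<close>, and only their derivatives need a limit: they converge boundedly to the
  difference of the two indicators divided by \<open>d\<close>.\<close>

lemma hat_estimate:
  fixes h q w :: "real \<Rightarrow> real"
  assumes d: "d > 0" and aT: "0 \<le> a" "a + 2 * d \<le> T"
    and h: "integrable (lebesgue_on {0<..<T}) h" and q: "integrable (lebesgue_on {0<..<T}) q"
    and w: "integrable (lebesgue_on {0<..<T}) w" and qw: "\<And>t. t \<in> {0<..<T} \<Longrightarrow> \<bar>q t\<bar> \<le> w t"
    and weak: "\<And>\<phi> K. \<lbrakk>smooth \<phi>; compact K; K \<subseteq> {0<..<T}; \<And>t. t \<notin> K \<Longrightarrow> \<phi> t = 0\<rbrakk> \<Longrightarrow>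
      (\<integral>t. \<phi> t * q t \<partial>lebesgue_on {0<..<T}) = - (\<integral>t. deriv \<phi> t * h t \<partial>lebesgue_on {0<..<T})"
  shows "\<bar>(\<integral>t. indicator {a + d<..<a + 2 * d} t * h t \<partial>lebesgue_on {0<..<T}) -
      (\<integral>t. indicator {a<..<a + d} t * h t \<partial>lebesgue_on {0<..<T})\<bar> / d \<le>
    (\<integral>t. max 0 (1 - \<bar>t - (a + d)\<bar> / d) * w t \<partial>lebesgue_on {0<..<T})"
proof -
  let ?M = "lebesgue_on {0<..<T}"
  let ?hat = "\<lambda>t. max 0 (1 - \<bar>t - (a + d)\<bar> / d)"
  define \<psi> where "\<psi> n t = (bump n a (a + d) t - bump n (a + d) (a + 2 * d) t) / d" for n t
  have meas: "\<psi>' \<in> borel_measurable ?M" if "continuous_on UNIV \<psi>'" for \<psi>' :: "real \<Rightarrow> real"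
    using that by (intro continuous_imp_measurable_on_sets_lebesgue) (auto intro: continuous_on_subset)
  have im: "indicator {x<..<y::real} \<in> borel_measurable ?M" for x y
    by (intro measurable_restrict_space1 borel_measurable_indicator) auto
  have \<psi>m: "\<psi> n \<in> borel_measurable ?M" for n
    unfolding \<psi>_def using d by (intro meas continuous_intros smooth_continuous smooth_bump) auto
  have hatm: "?hat \<in> borel_measurable ?M"
    using d by (intro meas continuous_intros) auto
  have "?hat t \<ge> 0" "?hat t \<le> 1" for t using d by auto
  then have hw: "integrable ?M (\<lambda>t. ?hat t * w t)"
    using w hatm by (intro integrable_bounded_times[where C = 1]) (auto simp: abs_le_iff)
  have bound: "\<bar>\<integral>t. \<psi> n t * h t \<partial>?M\<bar> \<le> (\<integral>t. ?hat t * w t \<partial>?M)" for n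
  proof -
    obtain \<phi> K where \<phi>: "smooth \<phi>" "compact K" "K \<subseteq> {0<..<T}" "\<And>t. t \<notin> K \<Longrightarrow> \<phi> t = 0"
      and D: "\<And>t. deriv \<phi> t = \<psi> n t" and b: "\<And>t. 0 \<le> \<phi> t" "\<And>t. \<phi> t \<le> ?hat t"
      using smooth_hat[OF d aT, of n] unfolding \<psi>_def by blast
    have "\<bar>\<integral>t. \<psi> n t * h t \<partial>?M\<bar> = \<bar>\<integral>t. \<phi> t * q t \<partial>?M\<bar>"
      using weak[OF \<phi>] by (simp add: D)
    also have "\<dots> \<le> (\<integral>t. \<bar>\<phi> t * q t\<bar> \<partial>?M)" by (rule integral_abs_bound)
    also have "\<dots> \<le> (\<integral>t. ?hat t * w t \<partial>?M)"
    proof (rule integral_mono'[OF hw])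
      fix t assume "t \<in> space ?M"
      then have "\<bar>q t\<bar> \<le> w t" using qw by simp
      then show "\<bar>\<phi> t * q t\<bar> \<le> ?hat t * w t" using b[of t] by (simp add: abs_mult mult_mono)
      show "0 \<le> ?hat t * w t" using \<open>\<bar>q t\<bar> \<le> w t\<close> by (intro mult_nonneg_nonneg) auto
    qed
    finally show ?thesis .
  qed
  have lim: "(\<lambda>n. \<integral>t. \<psi> n t * h t \<partial>?M) \<longlonglongrightarrow>
      (\<integral>t. (indicator {a<..<a + d} t - indicator {a + d<..<a + 2 * d} t) / d * h t \<partial>?M)"
  proof (rule integral_dominated_convergence[where w = "\<lambda>t. (2 / d) * \<bar>h t\<bar>"])
    show "(\<lambda>t. (indicator {a<..<a + d} t - indicator {a + d<..<a + 2 * d} t) / d * h t) \<in> borel_measurable ?M"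
      using h by (intro borel_measurable_times borel_measurable_divide borel_measurable_diff im) auto
    show "(\<lambda>t. \<psi> n t * h t) \<in> borel_measurable ?M" for n
      using \<psi>m h by (intro borel_measurable_times) (auto intro: borel_measurable_integrable)
    show "integrable ?M (\<lambda>t. (2 / d) * \<bar>h t\<bar>)" using h by simp
    show "AE t in ?M. (\<lambda>n. \<psi> n t * h t) \<longlonglongrightarrow> (indicator {a<..<a + d} t - indicator {a + d<..<a + 2 * d} t) / d * h t"
      using bump_tendsto[of a "a + d"] bump_tendsto[of "a + d" "a + 2 * d"] d unfolding \<psi>_def
      by (intro AE_I2 tendsto_intros) auto
    show "AE t in ?M. norm (\<psi> n t * h t) \<le> (2 / d) * \<bar>h t\<bar>" for n
    proof (rule AE_I2)
      fix t
      have "\<bar>bump n a (a + d) t - bump n (a + d) (a + 2 * d) t\<bar> \<le> 2"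
        using bump_nonneg[of n a "a + d" t] bump_le_1[of n a "a + d" t]
          bump_nonneg[of n "a + d" "a + 2 * d" t] bump_le_1[of n "a + d" "a + 2 * d" t] by linarith
      then have "\<bar>\<psi> n t\<bar> \<le> 2 / d" using d by (simp add: \<psi>_def divide_right_mono)
      then show "norm (\<psi> n t * h t) \<le> (2 / d) * \<bar>h t\<bar>" unfolding real_norm_def abs_mult
        by (intro mult_right_mono) auto
    qed
  qed
  have ih: "integrable ?M (\<lambda>t. indicator {x<..<y} t * h t)" for x y
    using h by (intro integrable_bounded_times[where C = 1] im) (auto simp: indicator_def)
  have "(\<integral>t. (indicator {a<..<a + d} t - indicator {a + d<..<a + 2 * d} t) / d * h t \<partial>?M) =
      ((\<integral>t. indicator {a<..<a + d} t * h t \<partial>?M) - (\<integral>t. indicator {a + d<..<a + 2 * d} t * h t \<partial>?M)) / d"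
    using ih by (simp add: diff_divide_distrib left_diff_distrib)
  moreover have "\<bar>\<integral>t. (indicator {a<..<a + d} t - indicator {a + d<..<a + 2 * d} t) / d * h t \<partial>?M\<bar> \<le> (\<integral>t. ?hat t * w t \<partial>?M)"
    using tendsto_rabs[OF lim] bound by (intro LIMSEQ_le_const2) auto
  ultimately show ?thesis using d by (simp add: abs_minus_commute)
qed

text \<open>The hats at all integers form a partition of unity: at \<open>x\<close> only those at
  \<open>m\<close> and \<open>m + 1\<close>, with \<open>m\<close> the floor of \<open>x\<close>,
  can be positive, and they add up to 1.\<close>

lemma sum_hats_le_1:
  fixes x :: real
  assumes "finite I" "x \<ge> 0"
  shows "(\<Sum>i\<in>I. max 0 (1 - \<bar>x - real i\<bar>)) \<le> 1"
proof -
  define m where "m = nat \<lfloor>x\<rfloor>"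
  have m: "real m \<le> x" "x < real m + 1" using assms(2) by (auto simp: m_def)
  have "(\<Sum>i\<in>I. max 0 (1 - \<bar>x - real i\<bar>)) \<le> (\<Sum>i\<in>I \<union> {m, m + 1}. max 0 (1 - \<bar>x - real i\<bar>))"
    using assms(1) by (intro sum_mono2) auto
  also have "\<dots> = (\<Sum>i\<in>{m, m + 1}. max 0 (1 - \<bar>x - real i\<bar>))"
  proof (rule sum.mono_neutral_right)
    show "\<forall>i\<in>I \<union> {m, m + 1} - {m, m + 1}. max 0 (1 - \<bar>x - real i\<bar>) = 0"
    proof
      fix i assume "i \<in> I \<union> {m, m + 1} - {m, m + 1}"
      then have "i < m \<or> i > m + 1" by auto
      then have "real i + 1 \<le> real m \<or> real m + 2 \<le> real i" by auto
      then show "max 0 (1 - \<bar>x - real i\<bar>) = 0" using m by auto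
    qed
  qed (use assms(1) in auto)
  also have "\<dots> = 1" using m by simp
  finally show ?thesis .
qed

section \<open>The fully discrete scheme\<close>

text \<open>Stated for arbitrary forms, unlike \<open>L2.zero_left\<close>: at the endpoints 0 and
  \<open>T\<close> the value \<open>f t\<close> is not known to be square integrable.\<close>

lemma form_inner_zero: "form_inner \<Omega> j 0 \<eta> = 0" "form_inner \<Omega> j \<omega> 0 = 0"
  by (simp_all add: form_inner_def alt_inner_eq zero_fun_def)

lemma form_inner_nonneg: "0 \<le> form_inner \<Omega> j \<omega> \<omega>"
  unfolding form_inner_def by (intro integral_nonneg_AE) (simp add: alt_inner_nonneg)

lemma triple_inner_load: "triple_inner \<Omega> k (load f t) X = form_inner \<Omega> (int k) (f t) (fst (snd X))"
  by (cases X) (simp add: load_def form_inner_zero)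

lemma triple_norm_load: "triple_norm \<Omega> k (load f t) = form_norm \<Omega> (int k) (f t)"
  by (simp add: triple_norm_def form_norm_def load_def form_inner_zero)

lemma triple_inner_zero_right: "triple_inner \<Omega> k X 0 = 0"
  by (cases X) (simp add: zero_prod_def form_inner_zero)

lemma form_norm_nonneg: "0 \<le> form_norm \<Omega> j \<omega>"
  by (simp add: form_norm_def form_inner_nonneg)

lemma triple_norm_nonneg: "0 \<le> triple_norm \<Omega> k X"
  by (cases X) (simp add: triple_norm_def form_inner_nonneg)

lemma form_norm_component_le: "form_norm \<Omega> (int k) (fst (snd X)) \<le> triple_norm \<Omega> k X"
  by (cases X) (simp add: triple_norm_def form_norm_def form_inner_nonneg)

text \<open>It serves the equality case. Each fixed \<open>v\<close> is orthogonal to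
  \<open>g t\<close> for almost every \<open>t\<close>, with an exceptional set depending on
  \<open>v\<close>; strong measurability supplies a countable set of directions that
  suffices.\<close>

lemma weak_time_deriv_zero:
  assumes g: "has_weak_time_deriv T \<Omega> j f g" and f: "f \<in> Bochner_L1 T \<Omega> j"
    and f0: "AE t in lebesgue_on {0<..<T}. form_norm \<Omega> j (f t) = 0"
  shows "AE t in lebesgue_on {0<..<T}. form_norm \<Omega> j (g t) = 0"
proof -
  let ?M = "lebesgue_on {0<..<T}"
  have gB: "g \<in> Bochner_L1 T \<Omega> j" using g by (simp add: has_weak_time_deriv_def)
  have fL: "f t \<in> L2_coords \<Omega>" and gL: "g t \<in> L2_coords \<Omega>" if "t \<in> {0<..<T}" for t
    using f gB that by (auto simp: Bochner_L1_def intro: L2_form_coords)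
  have inT: "AE t in ?M. t \<in> {0<..<T}" by (rule AE_I2) simp
  have orth: "AE t in ?M. form_inner \<Omega> j (g t) v = 0" if v: "v \<in> L2_coords \<Omega>" for v
  proof (rule bump_orthogonal_imp_AE_zero)
    show "integrable ?M (\<lambda>t. form_inner \<Omega> j (g t) v)" using gB v by (rule Bochner_L1_inner)
    fix n and a b :: real assume "box a b \<subseteq> {0<..<T}"
    then obtain K where K: "compact K" "K \<subseteq> {0<..<T}" "\<And>x. x \<notin> K \<Longrightarrow> bump n a b x = 0"
      using bump_compact_support by metis
    have "AE t in ?M. deriv (bump n a b) t * form_inner \<Omega> j (f t) v = 0"
      using f0 inT
    proof eventually_elim
      case (elim t)
      then have "form_inner \<Omega> j (f t) (f t) = 0" by (simp add: form_norm_def)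
      then show ?case using L2.null_left[OF fL[OF elim(2)] v] by simp
    qed
    then have "(\<integral>t. deriv (bump n a b) t * form_inner \<Omega> j (f t) v \<partial>?M) = 0"
      by (rule integral_eq_zero_AE)
    then show "(\<integral>t. bump n a b t * form_inner \<Omega> j (g t) v \<partial>?M) = 0"
      using weak_time_deriv_inner[OF g f v smooth_bump K] by simp
  qed simp
  obtain u where u: "\<And>m. simple_L2 ?M \<Omega> j (u m)"
    and lim: "AE t in ?M. (\<lambda>m. form_norm \<Omega> j (u m t - g t)) \<longlonglongrightarrow> 0"
    using gB by (auto simp: Bochner_L1_def strongly_measurable_def)
  \<comment> \<open>All values of all approximating simple functions: a countable set that comes
    arbitrarily close to \<open>g t\<close> for almost every \<open>t\<close>.\<close>
  define D where "D = (\<Union>m. u m ` space ?M)"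
  have "finite (u m ` space ?M)" for m using u[of m] by (simp add: simple_L2_def simple_function_def)
  then have "countable D" unfolding D_def by (intro countable_UN[OF countableI_type] countable_finite)
  moreover have "D \<subseteq> L2_coords \<Omega>" unfolding D_def using simple_L2_range[OF u] by blast
  ultimately have "AE t in ?M. \<forall>v\<in>D. form_inner \<Omega> j (g t) v = 0"
    using orth by (subst AE_ball_countable) auto
  then show ?thesis using lim inT
  proof eventually_elim
    case (elim t)
    have gt: "g t \<in> L2_coords \<Omega>" using gL[OF elim(3)] .
    have um: "u m t \<in> D" "u m t \<in> L2_coords \<Omega>" for m
    proof -
      show "u m t \<in> D" unfolding D_def using elim(3) by (intro UN_I[of m] UNIV_I imageI) simp
      show "u m t \<in> L2_coords \<Omega>" using elim(3) by (intro simple_L2_range[OF u]) simp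
    qed
    \<comment> \<open>Orthogonality to \<open>u m t\<close> allows it to be subtracted, and the
      remaining factor tends to 0 with \<open>m\<close>.\<close>
    have le: "form_inner \<Omega> j (g t) (g t) \<le> form_norm \<Omega> j (u m t - g t) * form_norm \<Omega> j (g t)" for m
    proof -
      have "form_inner \<Omega> j (g t) (g t) = - form_inner \<Omega> j (u m t - g t) (g t)"
        using gt um(2)[of m] bspec[OF elim(1) um(1)[of m]] by (simp add: L2.diff_left L2.sym[of \<Omega> j "u m t"])
      also have "\<dots> \<le> form_norm \<Omega> j (u m t - g t) * form_norm \<Omega> j (g t)"
        using L2.abs_le[of "u m t - g t" \<Omega> "g t" j] gt um(2)[of m] by (simp add: form_norm_def)
      finally show ?thesis .
    qed
    have "form_inner \<Omega> j (g t) (g t) \<le> 0"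
      by (rule LIMSEQ_le_const[OF tendsto_mult_left_zero[OF elim(2), of "form_norm \<Omega> j (g t)"]]) (use le in blast)
    then show "form_norm \<Omega> j (g t) = 0" using form_inner_nonneg[of \<Omega> j "g t"] by (simp add: form_norm_def)
  qed
qed

lemma node_0: "node T N 0 = 0"
  by (simp add: node_def)

lemma node_mono: "\<lbrakk>T > 0; N > 0; i \<le> j\<rbrakk> \<Longrightarrow> node T N i \<le> node T N j"
  unfolding node_def by (intro mult_right_mono) auto

lemma node_N: "N > 0 \<Longrightarrow> node T N N = T"
  by (simp add: node_def)

lemma node_Suc: "node T N (Suc i) = node T N i + T / real N"
  by (simp add: node_def algebra_simps add_divide_distrib)

lemma integral_affine_interval:
  fixes a b \<alpha> \<beta> :: real
  assumes "a \<le> b" "0 \<le> a" "b \<le> T"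
  shows "(\<integral>t. indicator {a<..<b} t * (\<alpha> + t * \<beta>) \<partial>lebesgue_on {0..T}) = \<alpha> * (b - a) + \<beta> * (b\<^sup>2 - a\<^sup>2) / 2"
proof -
  have "(\<integral>t. indicator {a<..<b} t * (\<alpha> + t * \<beta>) \<partial>lebesgue_on {0..T}) =
      (\<integral>t. indicator {0..T} t *\<^sub>R (indicator {a<..<b} t * (\<alpha> + t * \<beta>)) \<partial>lebesgue)"
    by (intro integral_restrict_space) simp
  also have "(\<lambda>t. indicator {0..T} t *\<^sub>R (indicator {a<..<b} t * (\<alpha> + t * \<beta>))) =
      (\<lambda>t. indicator {a<..<b} t *\<^sub>R (\<alpha> + t * \<beta>))"
    using assms by (intro ext) (auto simp: indicator_def)
  also have "integral\<^sup>L lebesgue \<dots> = (\<integral>t. \<alpha> + t * \<beta> \<partial>lebesgue_on {a<..<b})"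
    by (intro integral_restrict_space[symmetric]) simp
  also have "\<dots> = (\<integral>t. \<alpha> + t * \<beta> \<partial>lebesgue_on {a..b})"
    by (rule integral_interval_endpoints[symmetric])
  also have "\<dots> = integral {a..b} (\<lambda>t. \<alpha> + t * \<beta>)"
    by (intro lebesgue_integral_eq_integral continuous_imp_integrable_real continuous_intros) simp
  also have "\<dots> = (\<alpha> * b + \<beta> * b\<^sup>2 / 2) - (\<alpha> * a + \<beta> * a\<^sup>2 / 2)"
  proof (rule integral_unique, rule fundamental_theorem_of_calculus[OF assms(1)])
    fix t
    have "((\<lambda>t. \<alpha> * t + \<beta> * t\<^sup>2 / 2) has_real_derivative \<alpha> + t * \<beta>) (at t within {a..b})"
      by (auto intro!: derivative_eq_intros)
    then show "((\<lambda>t. \<alpha> * t + \<beta> * t\<^sup>2 / 2) has_vector_derivative \<alpha> + t * \<beta>) (at t within {a..b})"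
      by (simp add: has_real_derivative_iff_has_vector_derivative)
  qed
  finally show ?thesis by (simp add: algebra_simps diff_divide_distrib)
qed

section \<open>One step of the time discretization\<close>

context fe_setting
begin

lemma W_closed: "0 \<in> W" "\<lbrakk>X \<in> W; Y \<in> W\<rbrakk> \<Longrightarrow> X + Y \<in> W" "\<lbrakk>X \<in> W; Y \<in> W\<rbrakk> \<Longrightarrow> X - Y \<in> W" "X \<in> W \<Longrightarrow> c *\<^sub>R X \<in> W"
  using subspace_W by (auto simp: subspace_0 subspace_add subspace_diff subspace_scale)

lemma W_L: "X \<in> W \<Longrightarrow> X \<in> L2_coords3 \<Omega>"
  using W_L2 by blast

lemma W_L2_triple: "X \<in> W \<Longrightarrow> X \<in> L2_triple \<Omega> k"
  by (cases X) (auto simp: fe_triple_def L2_triple_def dest: V_H H_form_L2)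

lemma L2_triple_L: "X \<in> L2_triple \<Omega> k \<Longrightarrow> X \<in> L2_coords3 \<Omega>"
  by (cases X) (auto simp: L2_triple_def intro: L2_form_coords)

text \<open>Equivalent arguments may receive different values of \<open>A\<close>. The difference
  \<open>?D\<close> of these values is paired with itself, and skew-symmetry moves \<open>A\<close>
  onto \<open>?D\<close>, where the arguments enter only through inner products.\<close>

lemma A_norm_cong:
  assumes X: "X \<in> W" and Y: "Y \<in> W" and null: "triple_inner \<Omega> k (X - Y) (X - Y) = 0"
  shows "triple_norm \<Omega> k (A X) = triple_norm \<Omega> k (A Y)"
proof -
  let ?D = "A X - A Y"
  have D: "?D \<in> W" using X Y by (intro W_closed A_W)
  note L = W_L[OF X] W_L[OF Y] W_L[OF A_W[OF X]] W_L[OF A_W[OF Y]] W_L[OF D] W_L[OF A_W[OF D]]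
  have "triple_inner \<Omega> k ?D ?D = triple_inner \<Omega> k (A X) ?D - triple_inner \<Omega> k (A Y) ?D"
    using L(3,4,5) by (rule L2t.diff_left)
  also have "\<dots> = triple_inner \<Omega> k Y (A ?D) - triple_inner \<Omega> k X (A ?D)"
    using A_skew[OF X D] A_skew[OF Y D] by simp
  also have "\<dots> = 0" using L2t.cong_left[OF L(1,2,6) null] by simp
  finally show ?thesis using L2t.cong_norm[OF L(3,4)] by (simp add: triple_norm_def)
qed

text \<open>With \<open>w = A P - A Q\<close> as test triple, the first identity removes the time
  derivative because each triple is orthogonal to its image and the cross terms cancel. The second
  leaves \<open>A (A P - A Q)\<close> intact and moves the outer \<open>A\<close> back to
  \<open>P\<close> and \<open>Q\<close>.\<close>

lemma A_energy:
  assumes P: "P \<in> W" and Q: "Q \<in> W"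
  shows "triple_inner \<Omega> k (P - Q) (A P - A Q) = 0"
    and "triple_inner \<Omega> k (P + Q) (A (A P - A Q)) =
      (triple_norm \<Omega> k (A Q))\<^sup>2 - (triple_norm \<Omega> k (A P))\<^sup>2"
proof -
  have D: "A P - A Q \<in> W" using P Q by (intro W_closed A_W)
  note L = W_L[OF P] W_L[OF Q] W_L[OF A_W[OF P]] W_L[OF A_W[OF Q]] W_L[OF D] W_L[OF A_W[OF D]]
  have self: "triple_inner \<Omega> k X (A X) = 0" if "X \<in> W" for X
    using A_skew[OF that that] L2t.sym[of \<Omega> k X "A X"] by linarith
  have cross: "triple_inner \<Omega> k P (A Q) = - triple_inner \<Omega> k Q (A P)"
    using A_skew[OF P Q] L2t.sym[of \<Omega> k "A P" Q] by linarith
  have "triple_inner \<Omega> k (P - Q) (A P - A Q) =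
      (triple_inner \<Omega> k P (A P) - triple_inner \<Omega> k P (A Q)) - (triple_inner \<Omega> k Q (A P) - triple_inner \<Omega> k Q (A Q))"
    using L by (simp only: L2t.diff_left L2t.diff_right L2t.L_closed)
  then show "triple_inner \<Omega> k (P - Q) (A P - A Q) = 0" using self[OF P] self[OF Q] cross by linarith
  have "triple_inner \<Omega> k (P + Q) (A (A P - A Q)) =
      triple_inner \<Omega> k P (A (A P - A Q)) + triple_inner \<Omega> k Q (A (A P - A Q))"
    using L(1,2,6) by (rule L2t.add_left)
  also have "\<dots> = - triple_inner \<Omega> k (A P) (A P - A Q) - triple_inner \<Omega> k (A Q) (A P - A Q)"
    using A_skew[OF P D] A_skew[OF Q D] by linarith
  also have "\<dots> = triple_inner \<Omega> k (A Q) (A Q) - triple_inner \<Omega> k (A P) (A P)"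
    using L2t.diff_right[OF L(3,4,3), of k] L2t.diff_right[OF L(3,4,4), of k] L2t.sym[of \<Omega> k "A P" "A Q"] by linarith
  finally show "triple_inner \<Omega> k (P + Q) (A (A P - A Q)) =
      (triple_norm \<Omega> k (A Q))\<^sup>2 - (triple_norm \<Omega> k (A P))\<^sup>2"
    using L2t.N_power2[OF L(3), of k] L2t.N_power2[OF L(4), of k] by (simp add: triple_norm_def)
qed

text \<open>The affine representation is given only inside the interval, while the energies are
  taken at the nodes. Continuity in the norm carries it to the endpoints, up to null
  triples.\<close>

lemma P1_time_interval:
  assumes T: "T > 0" "N > 0" and U: "U \<in> P1_time T N \<Omega> k W" and i: "i < N"
  defines "a \<equiv> node T N i" and "b \<equiv> node T N (Suc i)"
  shows "\<exists>X\<in>W. \<exists>Y\<in>W. \<forall>t\<in>{a..b}. triple_inner \<Omega> k (U t - (X + t *\<^sub>R Y)) (U t - (X + t *\<^sub>R Y)) = 0"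
proof -
  have UW: "U t \<in> W" if "t \<in> {0..T}" for t using U that by (simp add: P1_time_def)
  have cont: "((\<lambda>r. triple_norm \<Omega> k (U r - U t)) \<longlongrightarrow> 0) (at t within {0..T})" if "t \<in> {0..T}" for t
    using U that by (simp add: P1_time_def)
  have si: "Suc i \<in> {1..N}" using i by simp
  have "\<forall>i\<in>{1..N}. \<exists>X\<in>W. \<exists>Y\<in>W. \<forall>t\<in>{node T N (i - 1)<..<node T N i}.
      triple_eq \<Omega> (U t) (X + t *\<^sub>R Y)"
    using U by (simp add: P1_time_def)
  from bspec[OF this si] obtain X Y where X: "X \<in> W" and Y: "Y \<in> W"
    and eq: "\<And>t. t \<in> {a<..<b} \<Longrightarrow> triple_eq \<Omega> (U t) (X + t *\<^sub>R Y)"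
    unfolding a_def b_def diff_Suc_1 by (elim bexE) (rule that, assumption+, erule bspec, simp add: a_def b_def)
  have ab: "a < b" "0 \<le> a" "b \<le> T"
    using T i node_mono[of T N 0 i] node_mono[of T N "Suc i" N] by (auto simp: a_def b_def node_Suc node_0 node_N)
  have XY: "X + t *\<^sub>R Y \<in> W" for t using X Y by (intro W_closed)
  let ?E = "\<lambda>t. U t - (X + t *\<^sub>R Y)"
  have inner: "triple_inner \<Omega> k (?E t) (?E t) = 0" if "t \<in> {a<..<b}" for t
    using eq[OF that] by (rule triple_eq_imp_null)
  have "triple_inner \<Omega> k (?E t) (?E t) = 0" if t: "t \<in> {a, b}" for t
  proof -
    have tT: "t \<in> {0..T}" using t ab by auto
    define m where "m = (a + b) / 2"
    \<comment> \<open>The sequence runs from the midpoint towards the endpoint \<open>t\<close>, so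
      it stays in the open interval.\<close>
    define r where "r n = t + (m - t) / real (Suc n)" for n
    have mt: "m \<noteq> t" using t ab by (auto simp: m_def)
    have r: "r n \<in> {a<..<b}" "r n \<noteq> t" for n
    proof -
      show "r n \<noteq> t" using mt by (simp add: r_def)
      have l: "0 < 1 / real (Suc n)" "1 / real (Suc n) \<le> 1" by auto
      define c where "c = 1 / real (Suc n)"
      have "c * (b - a) > 0" "c * (b - a) \<le> 1 * (b - a)"
        using l ab unfolding c_def by (intro mult_pos_pos mult_right_mono; simp)+
      moreover have "r n = t + c * (m - t)" by (simp add: r_def c_def)
      then have "r n = a + c * (b - a) / 2 \<or> r n = b - c * (b - a) / 2"
        using t by (auto simp: m_def field_simps)
      ultimately show "r n \<in> {a<..<b}"
        using ab(1) unfolding greaterThanLessThan_iff by argo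
    qed
    have rt: "r \<longlonglongrightarrow> t" unfolding r_def by real_asymp
    have "filterlim r (at t within {0..T}) sequentially"
      unfolding filterlim_at using rt r ab by (auto intro!: always_eventually intro: less_imp_le order_trans)
        (meson greaterThanLessThan_iff less_imp_le order_trans)+
    then have lim1: "(\<lambda>n. triple_norm \<Omega> k (U (r n) - U t)) \<longlonglongrightarrow> 0"
      using filterlim_compose[OF cont[OF tT]] by blast
    have "(\<lambda>n. triple_norm \<Omega> k (U (r n) - U t) + \<bar>r n - t\<bar> * triple_norm \<Omega> k Y) \<longlonglongrightarrow> 0 + \<bar>t - t\<bar> * triple_norm \<Omega> k Y"
      by (intro tendsto_intros lim1 rt)
    moreover have "triple_norm \<Omega> k (?E t) \<le> triple_norm \<Omega> k (U (r n) - U t) + \<bar>r n - t\<bar> * triple_norm \<Omega> k Y" for n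
    proof -
      have rT: "r n \<in> {0..T}" using r(1)[of n] ab by auto
      note L = W_L[OF UW[OF tT]] W_L[OF UW[OF rT]] W_L[OF Y] W_L[OF XY[of "r n"]]
      have "?E t = (U t - U (r n)) + (?E (r n) + (r n - t) *\<^sub>R Y)"
        by (simp add: algebra_simps)
      then have "triple_norm \<Omega> k (?E t) \<le> triple_norm \<Omega> k (U t - U (r n)) + triple_norm \<Omega> k (?E (r n) + (r n - t) *\<^sub>R Y)"
        using L2t.N_triangle[of "U t - U (r n)" \<Omega> "?E (r n) + (r n - t) *\<^sub>R Y" k] L
        unfolding triple_norm_def by (metis L2t.L_closed(2-4))
      also have "triple_norm \<Omega> k (?E (r n) + (r n - t) *\<^sub>R Y) \<le> triple_norm \<Omega> k (?E (r n)) + triple_norm \<Omega> k ((r n - t) *\<^sub>R Y)"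
        unfolding triple_norm_def using L W_L[OF X] by (intro L2t.N_triangle L2t.L_closed)
      also have "triple_norm \<Omega> k (?E (r n)) = 0" using inner[OF r(1)] by (simp add: triple_norm_def)
      also have "triple_norm \<Omega> k ((r n - t) *\<^sub>R Y) = \<bar>r n - t\<bar> * triple_norm \<Omega> k Y"
        unfolding triple_norm_def using L(3) by (rule L2t.N_scale)
      also have "triple_norm \<Omega> k (U t - U (r n)) = triple_norm \<Omega> k (U (r n) - U t)"
        unfolding triple_norm_def using L(1,2) by (rule L2t.N_diff_commute)
      finally show ?thesis by simp
    qed
    ultimately have "triple_norm \<Omega> k (?E t) \<le> 0 + \<bar>t - t\<bar> * triple_norm \<Omega> k Y"
      by (intro LIMSEQ_le_const) auto
    then have "triple_norm \<Omega> k (?E t) = 0" using triple_norm_nonneg[of \<Omega> k "?E t"] by simp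
    then show ?thesis by (simp add: triple_norm_def)
  qed
  then have "triple_inner \<Omega> k (?E t) (?E t) = 0" if "t \<in> {a..b}" for t
    using inner[of t] that by (cases "t \<in> {a<..<b}") auto
  then show ?thesis using X Y by blast
qed

text \<open>The difference quotients differ from the slope \<open>Y\<close> by null triples. Thus
  \<open>Y\<close> witnesses the specification of \<open>time_deriv\<close>, and whatever limit is
  chosen is equivalent to \<open>Y\<close>.\<close>

lemma time_deriv_affine:
  assumes U: "\<And>t. t \<in> {a<..<b} \<Longrightarrow> U t \<in> W" and X: "X \<in> W" and Y: "Y \<in> W"
    and null: "\<And>t. t \<in> {a<..<b} \<Longrightarrow> triple_inner \<Omega> k (U t - (X + t *\<^sub>R Y)) (U t - (X + t *\<^sub>R Y)) = 0"
    and t: "t \<in> {a<..<b}" and Z: "Z \<in> L2_coords3 \<Omega>"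
  shows "triple_inner \<Omega> k (time_deriv \<Omega> k U t) Z = triple_inner \<Omega> k Y Z"
proof -
  let ?q = "\<lambda>r. (1 / (r - t)) *\<^sub>R (U r - U t)"
  let ?P = "\<lambda>D. D \<in> L2_triple \<Omega> k \<and> ((\<lambda>r. triple_norm \<Omega> k (?q r - D)) \<longlongrightarrow> 0) (at t)"
  have ev: "eventually (\<lambda>r. r \<in> {a<..<b} \<and> r \<noteq> t) (at t)"
    using t by (intro eventually_conj eventually_at_topological[THEN iffD2])
      (auto intro!: exI[of _ "{a<..<b}"] simp: eventually_at_filter)
  have q0: "triple_inner \<Omega> k (?q r - Y) (?q r - Y) = 0" if r: "r \<in> {a<..<b}" "r \<noteq> t" for r
  proof -
    let ?E = "\<lambda>t. U t - (X + t *\<^sub>R Y)"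
    have EW: "?E x \<in> W" if "x \<in> {a<..<b}" for x
      using U[OF that] X Y by (intro W_closed)
    note L = W_L[OF EW[OF r(1)]] W_L[OF EW[OF t]]
    have "triple_inner \<Omega> k (?E r + (- 1) *\<^sub>R ?E t) (?E r + (- 1) *\<^sub>R ?E t) = 0"
      by (rule L2t.null_add[OF L(1) L2t.L_closed(4)[OF L(2)] null[OF r(1)] L2t.null_scale[OF L(2) null[OF t]]])
    then have "triple_inner \<Omega> k ((1 / (r - t)) *\<^sub>R (?E r + (- 1) *\<^sub>R ?E t)) ((1 / (r - t)) *\<^sub>R (?E r + (- 1) *\<^sub>R ?E t)) = 0"
      by (rule L2t.null_scale[OF L2t.L_closed(2)[OF L(1) L2t.L_closed(4)[OF L(2)]]])
    moreover have "?q r - Y = (1 / (r - t)) *\<^sub>R (?E r + (- 1) *\<^sub>R ?E t)"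
    proof -
      have *: "?E r + (- 1) *\<^sub>R ?E t = (U r - U t) - (r - t) *\<^sub>R Y" by (simp add: algebra_simps)
      show ?thesis unfolding * using r(2) by (simp add: scaleR_right_diff_distrib)
    qed
    ultimately show ?thesis by simp
  qed
  have "?P Y"
  proof
    show "Y \<in> L2_triple \<Omega> k" using Y by (rule W_L2_triple)
    show "((\<lambda>r. triple_norm \<Omega> k (?q r - Y)) \<longlongrightarrow> 0) (at t)"
      by (rule tendsto_eventually, rule eventually_mono[OF ev]) (use q0 in \<open>simp add: triple_norm_def\<close>)
  qed
  then have P: "?P (time_deriv \<Omega> k U t)" unfolding time_deriv_def by (rule someI)
  let ?D = "time_deriv \<Omega> k U t"
  have L: "?D \<in> L2_coords3 \<Omega>" "Y \<in> L2_coords3 \<Omega>" using P Y L2_triple_L W_L by blast+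
  have "triple_norm \<Omega> k (?D - Y) \<le> 0"
  proof (rule tendsto_lowerbound[OF conjunct2[OF P]])
    show "eventually (\<lambda>r. triple_norm \<Omega> k (?D - Y) \<le> triple_norm \<Omega> k (?q r - ?D)) (at t)"
      using ev
    proof eventually_elim
      case (elim r)
      have q: "?q r \<in> L2_coords3 \<Omega>" using U[OF t] U elim by (intro W_L W_closed) auto
      have "triple_norm \<Omega> k (?D - Y) \<le> triple_norm \<Omega> k (?D - ?q r) + triple_norm \<Omega> k (?q r - Y)"
        unfolding triple_norm_def using L q by (intro L2t.N_triangle3)
      also have "triple_norm \<Omega> k (?q r - Y) = 0" using q0 elim by (simp add: triple_norm_def)
      also have "triple_norm \<Omega> k (?D - ?q r) = triple_norm \<Omega> k (?q r - ?D)"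
        unfolding triple_norm_def using L(1) q by (rule L2t.N_diff_commute)
      finally show ?case by simp
    qed
  qed simp
  then have "triple_inner \<Omega> k (?D - Y) (?D - Y) = 0"
    using triple_norm_nonneg[of \<Omega> k "?D - Y"] by (simp add: triple_norm_def)
  then show ?thesis using L Z by (intro L2t.cong_left)
qed

text \<open>Skew-symmetry moves \<open>A\<close> onto the constant \<open>w\<close>, leaving an
  integrand affine in time. Its mean is exactly the average of the endpoint values, whence
  \<open>U b + U a\<close> with half the step length.\<close>

lemma scheme_step:
  assumes T: "T > 0" "N > 0" and U: "U \<in> P1_time T N \<Omega> k W" and i: "i < N" and w: "w \<in> W"
    and scheme: "\<forall>V\<in>P0_time T N \<Omega> W.
      (LINT t|lebesgue_on {0..T}.
         triple_inner \<Omega> k (time_deriv \<Omega> k U t) (V t) + triple_inner \<Omega> k (A (U t)) (V t)) =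
      (LINT t|lebesgue_on {0..T}. triple_inner \<Omega> k (load f t) (V t))"
  defines "a \<equiv> node T N i" and "b \<equiv> node T N (Suc i)"
  shows "triple_inner \<Omega> k (U b - U a) w - (T / real N / 2) * triple_inner \<Omega> k (U b + U a) (A w) =
    (LINT t|lebesgue_on {0<..<T}. indicator {a<..<b} t * form_inner \<Omega> (int k) (f t) (fst (snd w)))"
proof -
  have ab: "b - a = T / real N" "a < b" "0 \<le> a" "b \<le> T"
    using T i node_mono[of T N 0 i] node_mono[of T N "Suc i" N] by (auto simp: a_def b_def node_Suc node_0 node_N)
  have UW: "U t \<in> W" if "t \<in> {0..T}" for t using U that by (simp add: P1_time_def)
  obtain X Y where X: "X \<in> W" and Y: "Y \<in> W"
    and null: "\<And>t. t \<in> {a..b} \<Longrightarrow> triple_inner \<Omega> k (U t - (X + t *\<^sub>R Y)) (U t - (X + t *\<^sub>R Y)) = 0"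
    using P1_time_interval[OF T U i] unfolding a_def b_def by blast
  have XY: "X + t *\<^sub>R Y \<in> W" for t using X Y by (intro W_closed)
  have Aw: "A w \<in> W" using w by (rule A_W)
  note L = W_L[OF X] W_L[OF Y] W_L[OF w] W_L[OF Aw]
  have Uin: "triple_inner \<Omega> k (U t) Z = triple_inner \<Omega> k X Z + t * triple_inner \<Omega> k Y Z"
    if t: "t \<in> {a..b}" and Z: "Z \<in> L2_coords3 \<Omega>" for t Z
  proof -
    have "t \<in> {0..T}" using t ab by auto
    then have "triple_inner \<Omega> k (U t) Z = triple_inner \<Omega> k (X + t *\<^sub>R Y) Z"
      using null[OF t] Z by (intro L2t.cong_left W_L[OF UW] W_L[OF XY])
    also have "\<dots> = triple_inner \<Omega> k X Z + t * triple_inner \<Omega> k Y Z"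
      using L2t.add_left[OF L(1) L2t.L_closed(4)[OF L(2)] Z] L2t.scale_left[OF L(2) Z] by simp
    finally show ?thesis .
  qed
  define V where "V t = (if t \<in> {a<..<b} then w else 0)" for t
  have "V \<in> P0_time T N \<Omega> W"
    unfolding P0_time_def
  proof (intro CollectI conjI ballI)
    show "V t \<in> W" for t using w W_closed(1) by (simp add: V_def)
    fix l assume l: "l \<in> {1..N}"
    have refl: "triple_eq \<Omega> Z Z" for Z by (cases Z) (simp add: form_eq_def)
    show "\<exists>Z\<in>W. \<forall>t\<in>{node T N (l - 1)<..<node T N l}. triple_eq \<Omega> (V t) Z"
    proof (cases "l = Suc i")
      case True
      then show ?thesis using w refl by (intro bexI[of _ w]) (auto simp: V_def a_def b_def)
    next
      case False
      then have "l \<le> i \<or> Suc i \<le> l - 1" by linarith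
      then have "node T N l \<le> a \<or> b \<le> node T N (l - 1)"
        using node_mono[OF T] by (auto simp: a_def b_def)
      then have "V t = 0" if "t \<in> {node T N (l - 1)<..<node T N l}" for t
        using that by (auto simp: V_def)
      then show ?thesis using W_closed(1) refl by (intro bexI[of _ 0]) auto
    qed
  qed
  \<comment> \<open>These are the coefficients of the affine integrand on the open interval.
    Elsewhere the test function is 0, including the nodes, where \<open>time_deriv\<close> is an
    unspecified choice.\<close>
  define \<alpha> where "\<alpha> = triple_inner \<Omega> k Y w - triple_inner \<Omega> k X (A w)"
  define \<beta> where "\<beta> = - triple_inner \<Omega> k Y (A w)"
  have lhs: "triple_inner \<Omega> k (time_deriv \<Omega> k U t) (V t) + triple_inner \<Omega> k (A (U t)) (V t) =
      indicator {a<..<b} t * (\<alpha> + t * \<beta>)" for t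
  proof (cases "t \<in> {a<..<b}")
    case True
    have "triple_inner \<Omega> k (time_deriv \<Omega> k U t) w = triple_inner \<Omega> k Y w"
      using True ab null by (intro time_deriv_affine[OF _ X Y _ True L(3)] UW) auto
    moreover have "triple_inner \<Omega> k (A (U t)) w = - (triple_inner \<Omega> k X (A w) + t * triple_inner \<Omega> k Y (A w))"
      using A_skew[OF UW w, of t] Uin[OF _ L(4), of t] True ab by simp
    ultimately show ?thesis using True by (simp add: V_def \<alpha>_def \<beta>_def)
  next
    case False
    then have "V t = 0" unfolding V_def by (rule if_not_P)
    then show ?thesis using False by (simp add: triple_inner_zero_right)
  qed
  have rhs: "triple_inner \<Omega> k (load f t) (V t) = indicator {a<..<b} t * form_inner \<Omega> (int k) (f t) (fst (snd w))" for t
    unfolding triple_inner_load by (simp add: V_def form_inner_zero)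
  have "\<alpha> * (b - a) + \<beta> * (b\<^sup>2 - a\<^sup>2) / 2 =
      (LINT t|lebesgue_on {0..T}. indicator {a<..<b} t * form_inner \<Omega> (int k) (f t) (fst (snd w)))"
    using bspec[OF scheme \<open>V \<in> P0_time T N \<Omega> W\<close>] integral_affine_interval[of a b T \<alpha> \<beta>] ab
    unfolding lhs rhs by simp
  moreover have "triple_inner \<Omega> k (U b - U a) w - (T / real N / 2) * triple_inner \<Omega> k (U b + U a) (A w) =
      \<alpha> * (b - a) + \<beta> * (b\<^sup>2 - a\<^sup>2) / 2"
  proof -
    have ends: "a \<in> {a..b}" "b \<in> {a..b}" "a \<in> {0..T}" "b \<in> {0..T}" using ab by auto
    note LU = W_L[OF UW[OF ends(4)]] W_L[OF UW[OF ends(3)]]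
    have "triple_inner \<Omega> k (U b - U a) w = (b - a) * triple_inner \<Omega> k Y w"
      unfolding L2t.diff_left[OF LU L(3)] Uin[OF ends(1) L(3)] Uin[OF ends(2) L(3)] by (simp add: algebra_simps)
    moreover have "triple_inner \<Omega> k (U b + U a) (A w) = 2 * triple_inner \<Omega> k X (A w) + (a + b) * triple_inner \<Omega> k Y (A w)"
      unfolding L2t.add_left[OF LU L(4)] Uin[OF ends(1) L(4)] Uin[OF ends(2) L(4)] by (simp add: algebra_simps)
    ultimately show ?thesis
      unfolding ab(1)[symmetric] \<alpha>_def \<beta>_def by (simp add: power2_eq_square algebra_simps add_divide_distrib diff_divide_distrib)
  qed
  ultimately show ?thesis by (simp only: integral_interval_endpoints)
qed

end

section \<open>Summation by parts and the discrete energy estimate\<close>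

lemma energy_telescope:
  fixes E :: "nat \<Rightarrow> real" and r :: "nat \<Rightarrow> nat \<Rightarrow> real"
  assumes "\<And>i. i < N \<Longrightarrow> E (Suc i) - E i = r i (Suc i) - r i i"
  shows "Suc m \<le> N \<Longrightarrow> E (Suc m) - E 0 = r m (Suc m) - r 0 0 - (\<Sum>i<m. r (Suc i) (Suc i) - r i (Suc i))"
proof (induction m)
  case 0
  then show ?case using assms[of 0] by simp
next
  case (Suc m)
  then show ?case using assms[of "Suc m"] by simp
qed

text \<open>Here \<open>r i j\<close> is the load on interval \<open>i\<close> tested at node
  \<open>j\<close>. The two boundary terms contribute \<open>2 * d * F * e m\<close> and the jumps
  \<open>d * G * e m\<close>; clearing the factor \<open>d / 2\<close> on the left gives the
  constants 4 and 2.\<close>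

lemma discrete_energy_bound:
  fixes e :: "nat \<Rightarrow> real" and r :: "nat \<Rightarrow> nat \<Rightarrow> real"
  assumes d: "d > 0" and e: "\<And>i. 0 \<le> e i" and F: "0 \<le> F" and G: "0 \<le> G"
    and step: "\<And>i. i < N \<Longrightarrow> (d / 2) * ((e (Suc i))\<^sup>2 - (e i)\<^sup>2) = r i (Suc i) - r i i"
    and bound: "\<And>i j. \<lbrakk>i < N; j \<le> N\<rbrakk> \<Longrightarrow> \<bar>r i j\<bar> \<le> d * F * e j"
    and jumps: "\<And>m M. \<lbrakk>m < N; \<And>i. i \<le> N \<Longrightarrow> e i \<le> M\<rbrakk> \<Longrightarrow> \<bar>\<Sum>i<m. r (Suc i) (Suc i) - r i (Suc i)\<bar> \<le> d * G * M"
    and m: "m \<le> N" "\<And>i. i \<le> N \<Longrightarrow> e i \<le> e m"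
  shows "e m \<le> e 0 + 4 * F + 2 * G"
proof (cases "m = 0 \<or> e m = 0")
  case True
  then show ?thesis using F G e[of 0] by auto
next
  case False
  then obtain l where l: "m = Suc l" by (cases m) auto
  have pos: "e m > 0" using False e[of m] by simp
  have "(d / 2) * (e m)\<^sup>2 - (d / 2) * (e 0)\<^sup>2 = r l m - r 0 0 - (\<Sum>i<l. r (Suc i) (Suc i) - r i (Suc i))"
    unfolding l by (rule energy_telescope[where N = N]) (use step m l in \<open>auto simp: algebra_simps\<close>)
  also have "\<dots> \<le> d * F * e m + d * F * e m + d * G * e m"
  proof -
    have "\<bar>r l m\<bar> \<le> d * F * e m" using bound[of l m] m l by simp
    moreover have "\<bar>r 0 0\<bar> \<le> d * F * e m"
    proof -
      have "d * F * e 0 \<le> d * F * e m" using m d F by (intro mult_left_mono) auto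
      then show ?thesis using bound[of 0 0] m l by simp
    qed
    moreover have "\<bar>\<Sum>i<l. r (Suc i) (Suc i) - r i (Suc i)\<bar> \<le> d * G * e m" using jumps[of l "e m"] m l by simp
    ultimately show ?thesis by linarith
  qed
  finally have "d * ((e m)\<^sup>2 - (e 0)\<^sup>2) \<le> d * ((4 * F + 2 * G) * e m)" by (simp add: algebra_simps)
  then have "(e m)\<^sup>2 - (e 0)\<^sup>2 \<le> (4 * F + 2 * G) * e m" using d by simp
  \<comment> \<open>Maximality of \<open>e m\<close> gives every term on the right a factor
    \<open>e m\<close>, which can then be cancelled.\<close>
  moreover have "(e 0)\<^sup>2 \<le> e 0 * e m" unfolding power2_eq_square using m(2)[of 0] e by (intro mult_left_mono) auto
  ultimately have "e m * e m \<le> (e 0 + 4 * F + 2 * G) * e m"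
    by (simp add: power2_eq_square algebra_simps)
  then show ?thesis using pos by simp
qed

context fe_setting
begin

context
  fixes T :: real and N :: nat and f g :: "real \<Rightarrow> 'n form" and U :: "real \<Rightarrow> 'n triple"
  assumes T: "T > 0" and N: "N > 0"
    and f: "f \<in> Bochner_L1 T \<Omega> (int k)" and g: "has_weak_time_deriv T \<Omega> (int k) f g"
    and U: "U \<in> P1_time T N \<Omega> k W"
    and scheme: "\<forall>V\<in>P0_time T N \<Omega> W.
      (LINT t|lebesgue_on {0..T}.
         triple_inner \<Omega> k (time_deriv \<Omega> k U t) (V t) + triple_inner \<Omega> k (A (U t)) (V t)) =
      (LINT t|lebesgue_on {0..T}. triple_inner \<Omega> k (load f t) (V t))"
begin

abbreviation "M \<equiv> lebesgue_on {0<..<T}"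

text \<open>The step length times the pairing of the mean load with \<open>v\<close>. Working with
  this scalar avoids forming a mean in the space of forms.\<close>

definition load_integral :: "nat \<Rightarrow> 'n form \<Rightarrow> real"
  where "load_integral i v = (\<integral>t. indicator {node T N i<..<node T N (Suc i)} t * form_inner \<Omega> (int k) (f t) v \<partial>M)"

definition energy :: "nat \<Rightarrow> real"
  where "energy i = triple_norm \<Omega> k (A (U (node T N i)))"

text \<open>The only component of the test triple that the load \<open>(0, f, 0)\<close>
  sees.\<close>

definition middle :: "nat \<Rightarrow> 'n form"
  where "middle i = fst (snd (A (U (node T N i))))"

lemma node_in: "i \<le> N \<Longrightarrow> node T N i \<in> {0..T}"
  using node_mono[OF T N, of 0 i] node_mono[OF T N, of i N] by (simp add: node_0 node_N[OF N])

lemma U_W: "t \<in> {0..T} \<Longrightarrow> U t \<in> W"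
  using U by (simp add: P1_time_def)

lemma middle_L2: "i \<le> N \<Longrightarrow> middle i \<in> L2_coords \<Omega>"
  using W_L[OF A_W[OF U_W[OF node_in]], of i] unfolding middle_def mem_Times_iff by blast

lemma middle_le: "form_norm \<Omega> (int k) (middle i) \<le> energy i"
  unfolding middle_def energy_def by (rule form_norm_component_le)

lemma f_L2: "t \<in> {0<..<T} \<Longrightarrow> f t \<in> L2_coords \<Omega>"
  using f by (auto simp: Bochner_L1_def intro: L2_form_coords)

lemma indicator_measurable: "(indicator {x<..<y::real} :: real \<Rightarrow> real) \<in> borel_measurable M"
  by (intro measurable_restrict_space1 borel_measurable_indicator) auto

lemma integrable_load:
  "v \<in> L2_coords \<Omega> \<Longrightarrow> integrable M (\<lambda>t. indicator {x<..<y} t * form_inner \<Omega> (int k) (f t) v)"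
  using Bochner_L1_inner[OF f]
  by (intro integrable_bounded_times[where C = 1] indicator_measurable) (auto simp: indicator_def)

lemma load_integral_diff:
  assumes "v \<in> L2_coords \<Omega>" "w \<in> L2_coords \<Omega>"
  shows "load_integral i (v - w) = load_integral i v - load_integral i w"
proof -
  have "load_integral i (v - w) = (\<integral>t. indicator {node T N i<..<node T N (Suc i)} t * form_inner \<Omega> (int k) (f t) v
      - indicator {node T N i<..<node T N (Suc i)} t * form_inner \<Omega> (int k) (f t) w \<partial>M)"
    unfolding load_integral_def using f_L2 assms
    by (intro Bochner_Integration.integral_cong refl) (simp add: L2.diff_right right_diff_distrib)
  then show ?thesis using integrable_load[OF assms(1)] integrable_load[OF assms(2)]
    by (simp add: load_integral_def)
qed

lemma energy_step:
  assumes i: "i < N"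
  shows "(T / real N / 2) * ((energy (Suc i))\<^sup>2 - (energy i)\<^sup>2) =
    load_integral i (middle (Suc i)) - load_integral i (middle i)"
proof -
  let ?P = "U (node T N (Suc i))" and ?Q = "U (node T N i)"
  have PQ: "?P \<in> W" "?Q \<in> W" using i by (intro U_W node_in; simp)+
  have w: "A ?P - A ?Q \<in> W" using PQ by (intro W_closed A_W)
  have "fst (snd (A ?P - A ?Q)) = middle (Suc i) - middle i" by (simp add: middle_def)
  then have "triple_inner \<Omega> k (?P - ?Q) (A ?P - A ?Q) - (T / real N / 2) * triple_inner \<Omega> k (?P + ?Q) (A (A ?P - A ?Q)) =
      load_integral i (middle (Suc i) - middle i)"
    using scheme_step[OF T N U i w scheme] by (simp add: load_integral_def)
  also have "load_integral i (middle (Suc i) - middle i) = load_integral i (middle (Suc i)) - load_integral i (middle i)"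
    using i by (intro load_integral_diff middle_L2) auto
  finally show ?thesis
    unfolding A_energy[OF PQ] by (simp add: energy_def algebra_simps)
qed

lemma load_integral_bound:
  assumes F: "0 \<le> F" "AE t in M. form_norm \<Omega> (int k) (f t) \<le> F" and i: "i < N" and v: "v \<in> L2_coords \<Omega>"
  shows "\<bar>load_integral i v\<bar> \<le> T / real N * F * form_norm \<Omega> (int k) v"
proof -
  let ?a = "node T N i" and ?b = "node T N (Suc i)"
  let ?c = "F * form_norm \<Omega> (int k) v"
  interpret finite_measure M by (intro bounded_open_finite_measure) auto
  have "\<bar>load_integral i v\<bar> \<le> (\<integral>t. \<bar>indicator {?a<..<?b} t * form_inner \<Omega> (int k) (f t) v\<bar> \<partial>M)"
    unfolding load_integral_def by (rule integral_abs_bound)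
  \<comment> \<open>The term \<open>t * 0\<close> puts the constant into the affine shape evaluated
    by \<open>integral_affine_interval\<close>.\<close>
  also have "\<dots> \<le> (\<integral>t. indicator {?a<..<?b} t * (?c + t * 0) \<partial>M)"
  proof (rule integral_mono_AE)
    show "integrable M (\<lambda>t. \<bar>indicator {?a<..<?b} t * form_inner \<Omega> (int k) (f t) v\<bar>)"
      using integrable_load[OF v] by (rule integrable_abs)
    show "integrable M (\<lambda>t. indicator {?a<..<?b} t * (?c + t * 0))"
      by (intro integrable_bounded_times[where C = 1] indicator_measurable) (auto simp: indicator_def)
    have "AE t in M. t \<in> {0<..<T}" by (rule AE_I2) simp
    with F(2) show "AE t in M. \<bar>indicator {?a<..<?b} t * form_inner \<Omega> (int k) (f t) v\<bar> \<le> indicator {?a<..<?b} t * (?c + t * 0)"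
    proof eventually_elim
      case (elim t)
      have "\<bar>form_inner \<Omega> (int k) (f t) v\<bar> \<le> form_norm \<Omega> (int k) (f t) * form_norm \<Omega> (int k) v"
        using L2.abs_le[OF f_L2[OF elim(2)] v, of "int k"] by (simp add: form_norm_def)
      also have "\<dots> \<le> ?c" using elim by (intro mult_right_mono form_norm_nonneg)
      finally show ?case by (simp add: indicator_def)
    qed
  qed
  also have "\<dots> = (\<integral>t. indicator {?a<..<?b} t * (?c + t * 0) \<partial>lebesgue_on {0..T})"
    by (rule integral_interval_endpoints[symmetric])
  also have "\<dots> = ?c * (?b - ?a)"
    using i node_in[of i] node_in[of "Suc i"] node_mono[OF T N, of i "Suc i"]
    by (subst integral_affine_interval) auto
  finally show ?thesis by (simp add: node_Suc mult_ac)
qed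

text \<open>This is \<open>hat_estimate\<close> for the pairing with \<open>v\<close>, with the weak
  time derivative supplying the integration by parts. The hat is centred at the node shared by the
  two intervals.\<close>

lemma load_integral_jump:
  assumes i: "Suc i < N" and v: "v \<in> L2_coords \<Omega>"
  shows "\<bar>load_integral (Suc i) v - load_integral i v\<bar> \<le>
    T / real N * form_norm \<Omega> (int k) v *
      (\<integral>t. max 0 (1 - \<bar>t / (T / real N) - real (Suc i)\<bar>) * form_norm \<Omega> (int k) (g t) \<partial>M)"
proof -
  let ?d = "T / real N"
  have d: "?d > 0" using T N by simp
  have gB: "g \<in> Bochner_L1 T \<Omega> (int k)" using g by (simp add: has_weak_time_deriv_def)
  have nodes: "node T N i + ?d = node T N (Suc i)" "node T N i + 2 * ?d = node T N (Suc (Suc i))"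
    by (simp_all add: node_Suc)
  have "\<bar>load_integral (Suc i) v - load_integral i v\<bar> / ?d \<le>
      (\<integral>t. max 0 (1 - \<bar>t - (node T N i + ?d)\<bar> / ?d) * (form_norm \<Omega> (int k) (g t) * form_norm \<Omega> (int k) v) \<partial>M)"
    unfolding load_integral_def nodes(1)[symmetric] nodes(2)[symmetric, unfolded nodes(1)[symmetric]]
    unfolding nodes(2)[symmetric]
  proof (rule hat_estimate[OF d])
    show "0 \<le> node T N i" "node T N i + 2 * ?d \<le> T"
      unfolding nodes using node_in[of i] node_in[of "Suc (Suc i)"] i by auto
    show "integrable M (\<lambda>t. form_inner \<Omega> (int k) (f t) v)" using f v by (rule Bochner_L1_inner)
    show "integrable M (\<lambda>t. form_inner \<Omega> (int k) (g t) v)" using gB v by (rule Bochner_L1_inner)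
    show "integrable M (\<lambda>t. form_norm \<Omega> (int k) (g t) * form_norm \<Omega> (int k) v)"
      using gB by (simp add: Bochner_L1_def)
    show "\<bar>form_inner \<Omega> (int k) (g t) v\<bar> \<le> form_norm \<Omega> (int k) (g t) * form_norm \<Omega> (int k) v" if "t \<in> {0<..<T}" for t
    proof -
      have "g t \<in> L2_coords \<Omega>" using gB that by (auto simp: Bochner_L1_def intro: L2_form_coords)
      then show ?thesis using L2.abs_le[OF _ v, of "g t" "int k"] by (simp add: form_norm_def)
    qed
  qed (rule weak_time_deriv_inner[OF g f v])
  \<comment> \<open>Time is rescaled by the step length so that the hats are centred at integers, as
    \<open>sum_hats_le_1\<close> expects.\<close>
  also have "\<dots> = (\<integral>t. form_norm \<Omega> (int k) v * (max 0 (1 - \<bar>t / ?d - real (Suc i)\<bar>) * form_norm \<Omega> (int k) (g t)) \<partial>M)"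
  proof (intro Bochner_Integration.integral_cong refl)
    fix t
    have "\<bar>t - (node T N i + ?d)\<bar> / ?d = \<bar>(t - node T N (Suc i)) / ?d\<bar>" 
      unfolding nodes(1) abs_divide[of "t - node T N (Suc i)"] abs_of_pos[OF d] ..
    also have "(t - node T N (Suc i)) / ?d = t / ?d - real (Suc i)"
      unfolding node_def diff_divide_distrib nonzero_mult_div_cancel_right[OF less_imp_neq[OF d, symmetric]] ..
    finally show "max 0 (1 - \<bar>t - (node T N i + ?d)\<bar> / ?d) * (form_norm \<Omega> (int k) (g t) * form_norm \<Omega> (int k) v) =
        form_norm \<Omega> (int k) v * (max 0 (1 - \<bar>t / ?d - real (Suc i)\<bar>) * form_norm \<Omega> (int k) (g t))" by simp
  qed
  finally have "\<bar>load_integral (Suc i) v - load_integral i v\<bar> / ?d \<le>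
      form_norm \<Omega> (int k) v * (\<integral>t. max 0 (1 - \<bar>t / ?d - real (Suc i)\<bar>) * form_norm \<Omega> (int k) (g t) \<partial>M)"
    by simp
  then show ?thesis using d by (simp only: pos_divide_le_eq mult_ac)
qed

text \<open>The hats are summed under the integral before being estimated. Bounding each by 1 on its
  support would count almost every time up to twice and double the constant in front of the integral
  of \<open>F_t\<close>.\<close>

lemma load_jumps_bound:
  assumes m: "m < N" and E: "\<And>i. i \<le> N \<Longrightarrow> energy i \<le> E"
  shows "\<bar>\<Sum>i<m. load_integral (Suc i) (middle (Suc i)) - load_integral i (middle (Suc i))\<bar> \<le>
    T / real N * (\<integral>t. form_norm \<Omega> (int k) (g t) \<partial>M) * E"
proof -
  let ?d = "T / real N"
  let ?hat = "\<lambda>i t. max 0 (1 - \<bar>t / ?d - real i\<bar>)"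
  have d: "?d > 0" using T N by simp
  have gi: "integrable M (\<lambda>t. form_norm \<Omega> (int k) (g t))"
    using g by (simp add: has_weak_time_deriv_def Bochner_L1_def)
  have E0: "0 \<le> E" using E[of 0] triple_norm_nonneg order_trans unfolding energy_def by blast
  have hi: "integrable M (\<lambda>t. ?hat i t * form_norm \<Omega> (int k) (g t))" for i
  proof (rule integrable_bounded_times[where C = 1, OF gi])
    show "?hat i \<in> borel_measurable M"
      using T N by (intro continuous_imp_measurable_on_sets_lebesgue continuous_intros) auto
  qed simp
  have "\<bar>\<Sum>i<m. load_integral (Suc i) (middle (Suc i)) - load_integral i (middle (Suc i))\<bar> \<le>
      (\<Sum>i<m. \<bar>load_integral (Suc i) (middle (Suc i)) - load_integral i (middle (Suc i))\<bar>)"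
    by (rule sum_abs)
  also have "\<dots> \<le> (\<Sum>i<m. ?d * E * (\<integral>t. ?hat (Suc i) t * form_norm \<Omega> (int k) (g t) \<partial>M))"
  proof (rule sum_mono)
    fix i assume "i \<in> {..<m}"
    then have i: "Suc i < N" using m by simp
    have "\<bar>load_integral (Suc i) (middle (Suc i)) - load_integral i (middle (Suc i))\<bar> \<le>
        ?d * form_norm \<Omega> (int k) (middle (Suc i)) * (\<integral>t. ?hat (Suc i) t * form_norm \<Omega> (int k) (g t) \<partial>M)"
      using i by (intro load_integral_jump middle_L2) auto
    also have "\<dots> \<le> ?d * E * (\<integral>t. ?hat (Suc i) t * form_norm \<Omega> (int k) (g t) \<partial>M)"
    proof (intro mult_right_mono mult_left_mono)
      show "form_norm \<Omega> (int k) (middle (Suc i)) \<le> E" using middle_le[of "Suc i"] E[of "Suc i"] i by simp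
      show "0 \<le> (\<integral>t. ?hat (Suc i) t * form_norm \<Omega> (int k) (g t) \<partial>M)"
        by (intro Bochner_Integration.integral_nonneg mult_nonneg_nonneg form_norm_nonneg) simp
    qed (use d in simp)
    finally show "\<bar>load_integral (Suc i) (middle (Suc i)) - load_integral i (middle (Suc i))\<bar> \<le>
        ?d * E * (\<integral>t. ?hat (Suc i) t * form_norm \<Omega> (int k) (g t) \<partial>M)" .
  qed
  also have "\<dots> = ?d * E * (\<integral>t. (\<Sum>i<m. ?hat (Suc i) t * form_norm \<Omega> (int k) (g t)) \<partial>M)"
    unfolding Bochner_Integration.integral_sum[OF hi] by (simp add: sum_distrib_left)
  also have "\<dots> \<le> ?d * E * (\<integral>t. form_norm \<Omega> (int k) (g t) \<partial>M)"
  proof (intro mult_left_mono integral_mono Bochner_Integration.integrable_sum hi gi)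
    fix t assume "t \<in> space M"
    then have t: "t / ?d \<ge> 0" using d by simp
    have "(\<Sum>i<m. ?hat (Suc i) t) = (\<Sum>i\<in>Suc ` {..<m}. ?hat i t)"
      by (subst sum.reindex) auto
    also have "\<dots> \<le> 1" using t by (intro sum_hats_le_1) auto
    finally have "(\<Sum>i<m. ?hat (Suc i) t) * form_norm \<Omega> (int k) (g t) \<le> 1 * form_norm \<Omega> (int k) (g t)"
      by (intro mult_right_mono form_norm_nonneg)
    then show "(\<Sum>i<m. ?hat (Suc i) t * form_norm \<Omega> (int k) (g t)) \<le> form_norm \<Omega> (int k) (g t)"
      by (simp only: sum_distrib_right mult_1)
  qed (use T E0 in simp)
  finally show ?thesis by (simp only: mult_ac)
qed

lemma energy_bound:
  assumes F: "0 \<le> F" "AE t in M. form_norm \<Omega> (int k) (f t) \<le> F"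
    and m: "m \<le> N" "\<And>i. i \<le> N \<Longrightarrow> energy i \<le> energy m"
  shows "energy m \<le> energy 0 + 4 * F + 2 * (\<integral>t. form_norm \<Omega> (int k) (g t) \<partial>M)"
proof (rule discrete_energy_bound[where d = "T / real N" and N = N and r = "\<lambda>i j. load_integral i (middle j)"])
  show "T / real N > 0" using T N by simp
  show "0 \<le> energy i" for i unfolding energy_def by (rule triple_norm_nonneg)
  show "0 \<le> (\<integral>t. form_norm \<Omega> (int k) (g t) \<partial>M)"
    by (intro Bochner_Integration.integral_nonneg form_norm_nonneg)
  show "\<bar>load_integral i (middle j)\<bar> \<le> T / real N * F * energy j" if "i < N" "j \<le> N" for i j
  proof -
    have "\<bar>load_integral i (middle j)\<bar> \<le> T / real N * F * form_norm \<Omega> (int k) (middle j)"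
      using F that by (intro load_integral_bound middle_L2)
    also have "\<dots> \<le> T / real N * F * energy j"
      using T F(1) by (intro mult_left_mono middle_le) simp
    finally show ?thesis .
  qed
qed (use F m energy_step load_jumps_bound in auto)

lemma energy_conservation:
  assumes F: "AE t in M. form_norm \<Omega> (int k) (f t) = 0" and i: "i \<le> N"
  shows "energy i = energy 0"
  using i
proof (induction i)
  case (Suc i)
  have "AE t in M. form_norm \<Omega> (int k) (f t) \<le> 0" using F by eventually_elim simp
  \<comment> \<open>The bound for the loads is used with \<open>F = 0\<close>, so both tested loads
    in the energy identity vanish.\<close>
  then have "load_integral i (middle j) = 0" if "j \<le> N" for j
    using load_integral_bound[of 0 i "middle j"] middle_L2[OF that] Suc.prems by simp
  then have "(T / real N / 2) * ((energy (Suc i))\<^sup>2 - (energy i)\<^sup>2) = 0"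
    using energy_step[of i] Suc.prems by simp
  then have "(energy (Suc i))\<^sup>2 = (energy i)\<^sup>2" using T N by simp
  moreover have "0 \<le> energy l" for l unfolding energy_def by (rule triple_norm_nonneg)
  ultimately have "energy (Suc i) = energy i" by (metis power2_eq_imp_eq)
  then show ?case using Suc by simp
qed simp

end

end

section \<open>Essential suprema and the final estimate\<close>

lemma esssup_nonneg_real:
  fixes q :: "real \<Rightarrow> real"
  assumes "\<And>t. 0 \<le> q t" "T > 0"
  shows "0 \<le> esssup (lebesgue_on {0..T}) (\<lambda>t. ereal (q t))"
proof -
  have "emeasure (lebesgue_on {0..T}) (space (lebesgue_on {0..T})) \<noteq> 0"
    using assms(2) by (simp add: emeasure_restrict_space)
  then have "ae_filter (lebesgue_on {0..T}) \<noteq> bot" by (simp add: ae_filter_eq_bot_iff)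
  \<comment> \<open>The interval has positive measure, so the almost everywhere bound holds for at
    least one \<open>t\<close>, where the value is nonnegative.\<close>
  from eventually_happens'[OF this esssup_AE[of "\<lambda>t. ereal (q t)"]]
  obtain t where "ereal (q t) \<le> esssup (lebesgue_on {0..T}) (\<lambda>t. ereal (q t))" by (elim exE)
  then show ?thesis using assms(1)[of t] by (metis ereal_less_eq(5) order_trans)
qed

lemma esssup_AE_zero:
  fixes q :: "real \<Rightarrow> real"
  assumes "AE t in lebesgue_on {0..T}. q t = 0" "T > 0"
  shows "esssup (lebesgue_on {0..T}) (\<lambda>t. ereal (q t)) = 0"
proof -
  have ae: "AE t in lebesgue_on {0..T}. 0 = q t" using assms(1) by eventually_elim simp
  \<comment> \<open>Measurability comes from completeness, since \<open>q\<close> agrees almost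
    everywhere with the constant 0.\<close>
  have "q \<in> borel_measurable (lebesgue_on {0..T})"
    by (rule AE_eq_measurable_lebesgue_on[OF _ _ ae]) auto
  then have "(\<lambda>t. ereal (q t)) \<in> borel_measurable (lebesgue_on {0..T})" by simp
  moreover have "AE t in lebesgue_on {0..T}. ereal (q t) = ereal 0" using assms(1) by eventually_elim simp
  ultimately have "esssup (lebesgue_on {0..T}) (\<lambda>t. ereal (q t)) = esssup (lebesgue_on {0..T}) (\<lambda>t. ereal 0)"
    by (intro esssup_AE_cong) auto
  also have "\<dots> = ereal 0"
    using assms(2) by (intro esssup_const) (simp add: emeasure_restrict_space)
  finally show ?thesis by (simp add: zero_ereal_def)
qed

theorem theorem4p4:
  fixes \<Omega> :: "(real^'n) set" and \<T> :: "(real^'n) set set" and c T :: real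
    and k s N :: nat and fam :: family
    and f :: "real \<Rightarrow> 'n form" and U :: "real \<Rightarrow> 'n triple" and U0 :: "'n triple"
  defines "W \<equiv> fe_triple \<Omega> \<T> fam k s"
    and "A \<equiv> A_h \<Omega> \<T> fam k s"
    and "F \<equiv> load f"
    and "F\<^sub>t \<equiv> load (weak_time_deriv T \<Omega> (int k) f)"
  assumes "CARD('n) \<ge> 2" and "k \<le> CARD('n)"
    and "open \<Omega>" and "connected \<Omega>" and "bounded \<Omega>"
    and "\<Omega> homeomorphic ball (0 :: real^'n) 1"
    and "piecewise_smooth_lipschitz_boundary \<Omega>"
    and "shape_regular_triangulation c \<T> \<Omega>"
    and "T > 0" and "N > 0"
    and "f \<in> W11 T \<Omega> (int k)"
    and "U0 \<in> W"
    and "U \<in> P1_time T N \<Omega> k W" and "triple_eq \<Omega> (U 0) U0"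
    and "\<forall>V\<in>P0_time T N \<Omega> W.
      (LINT t|lebesgue_on {0..T}.
         triple_inner \<Omega> k (time_deriv \<Omega> k U t) (V t) + triple_inner \<Omega> k (A (U t)) (V t)) =
      (LINT t|lebesgue_on {0..T}. triple_inner \<Omega> k (F t) (V t))"
  shows "ereal (MAX i\<in>{0..N}. triple_norm \<Omega> k (A (U (node T N i)))) \<le>
           ereal (triple_norm \<Omega> k (A U0)) + 4 * Linf_L2_norm T \<Omega> k F +
           ereal (2 * (LINT t|lebesgue_on {0..T}. triple_norm \<Omega> k (F\<^sub>t t)))
       \<and> ((AE t in lebesgue_on {0..T}. triple_eq \<Omega> (F t) 0) \<longrightarrow>
           ereal (MAX i\<in>{0..N}. triple_norm \<Omega> k (A (U (node T N i)))) =
             ereal (triple_norm \<Omega> k (A U0)) + 4 * Linf_L2_norm T \<Omega> k F +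
             ereal (2 * (LINT t|lebesgue_on {0..T}. triple_norm \<Omega> k (F\<^sub>t t)))
           \<and> (\<forall>i\<in>{1..N}. triple_norm \<Omega> k (A (U (node T N i))) = triple_norm \<Omega> k (A U0)))"
proof -
  interpret fe_setting \<Omega> \<T> fam k s
  proof
    show "bounded \<Omega>" "open \<Omega>" by fact+
    show "negligible (frontier \<Omega>)"
      using assms(7,9,11) by (rule negligible_frontier_lipschitz)
    note tri = assms(12)[unfolded shape_regular_triangulation_def]
    show "finite \<T>" using tri by (simp add: triangulation_def)
    show "convex K" "closed K" if "K \<in> \<T>" for K
      using tri that by (auto intro: convex_simplex closed_simplex)
    show "\<Union>\<T> = closure \<Omega>" using tri by simp
  qed
  note T = assms(13) and N = assms(14)
  define g where "g = weak_time_deriv T \<Omega> (int k) f"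
  have fB: "f \<in> Bochner_L1 T \<Omega> (int k)" using assms(15) by (simp add: W11_def)
  have gw: "has_weak_time_deriv T \<Omega> (int k) f g"
    unfolding g_def weak_time_deriv_def 
    using assms(15) someI_ex[of "has_weak_time_deriv T \<Omega> (int k) f"] by (simp add: W11_def)
  note ctxt = T N fB gw assms(17)[unfolded W_def] assms(19)[unfolded W_def A_def F_def]
  define e where "e i = triple_norm \<Omega> k (A (U (node T N i)))" for i
  have energy: "energy T N U i = e i" for i
    unfolding e_def A_def by (rule energy_def[OF ctxt])
  let ?G = "\<integral>t. form_norm \<Omega> (int k) (g t) \<partial>lebesgue_on {0<..<T}"
  let ?L = "Linf_L2_norm T \<Omega> k F"
  have G: "(LINT t|lebesgue_on {0..T}. triple_norm \<Omega> k (F\<^sub>t t)) = ?G"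
    unfolding F\<^sub>t_def triple_norm_load g_def[symmetric] by (rule integral_interval_endpoints)
  \<comment> \<open>The initial value of \<open>U\<close> is equivalent, not identical, to
    \<open>U0\<close>, so \<open>A\<close> may choose different values; their norms agree.\<close>
  have e0: "e 0 = triple_norm \<Omega> k (A U0)"
    unfolding e_def A_def node_0
    using assms(16,17,18) T by (intro A_norm_cong triple_eq_imp_null) (auto simp: W_def P1_time_def)
  have L: "?L = esssup (lebesgue_on {0..T}) (\<lambda>t. ereal (form_norm \<Omega> (int k) (f t)))"
    unfolding Linf_L2_norm_def F_def triple_norm_load ..
  have Lnonneg: "0 \<le> ?L" unfolding L using T by (intro esssup_nonneg_real form_norm_nonneg)
  have "Max (e ` {0..N}) \<in> e ` {0..N}" by (intro Max_in) auto
  then obtain m where Max: "Max (e ` {0..N}) = e m" and "m \<in> {0..N}" by (rule imageE)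
  then have m: "m \<le> N" by simp
  have max: "e i \<le> e m" if "i \<le> N" for i
    unfolding Max[symmetric] using that by (intro Max_ge) auto
  \<comment> \<open>Nonnegativity excludes the value minus infinity, and for an infinite essential
    supremum the estimate is trivial.\<close>
  have bound: "ereal (e m) \<le> ereal (e 0) + 4 * ?L + ereal (2 * ?G)"
  proof (cases ?L)
    case (real F0)
    have "AE t in lebesgue_on {0..T}. ereal (form_norm \<Omega> (int k) (f t)) \<le> ?L"
      unfolding L by (rule esssup_AE)
    then have "AE t in lebesgue_on {0<..<T}. form_norm \<Omega> (int k) (f t) \<le> F0"
      unfolding real by (simp add: AE_interval_endpoints)
    then have "e m \<le> e 0 + 4 * F0 + 2 * ?G"
      using energy_bound[OF ctxt, of F0 m] m max Lnonneg real unfolding energy by simp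
    then show ?thesis using real by simp
  qed (use Lnonneg in auto)
  have conserve: "e m = e 0 \<and> ?L = 0 \<and> ?G = 0 \<and> (\<forall>i\<in>{1..N}. e i = e 0)"
    if zero: "AE t in lebesgue_on {0..T}. triple_eq \<Omega> (F t) 0"
  proof -
    have f0: "AE t in lebesgue_on {0..T}. form_norm \<Omega> (int k) (f t) = 0"
      using zero
    proof eventually_elim
      case (elim t)
      then have "form_eq \<Omega> (f t) 0" by (simp add: F_def load_def zero_prod_def)
      from form_eq_imp_null[OF this, of "int k"] show ?case by (simp add: form_norm_def)
    qed
    have f0': "AE t in lebesgue_on {0<..<T}. form_norm \<Omega> (int k) (f t) = 0"
      using f0 by (simp add: AE_interval_endpoints)
    have eq: "e i = e 0" if "i \<le> N" for i
      using energy_conservation[OF ctxt f0' that] unfolding energy .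
    have "?L = 0" unfolding L using f0 T by (rule esssup_AE_zero)
    \<comment> \<open>For the equality each summand on the right must be evaluated, including the
      one with the chosen weak derivative, which vanishes almost everywhere with
      \<open>f\<close>.\<close>
    moreover have "?G = 0" using weak_time_deriv_zero[OF gw fB f0'] by (rule integral_eq_zero_AE)
    moreover have "\<forall>i\<in>{1..N}. e i = e 0" by (intro ballI eq) simp
    ultimately show ?thesis using eq[OF m] by (intro conjI)
  qed
  show ?thesis
    unfolding G e_def[symmetric] e0[symmetric] Max
    using bound conserve by auto
qed

end
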